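(* Let $M_1$, $M_2$ and $N$ be combinatorial premodel categories. The tensor–Hom adjunction $$\mathrm{Hom}_{\mathbf{LPr}}(M_1\otimes M_2,N)\simeq\mathrm{Hom}_{\mathbf{LPr}}(M_1,\mathbf{LPr}(M_2,N))$$ restricts to an adjunction (equivalence of categories) $$\mathrm{Hom}_{\mathbf{CPM}}(M_1\otimes M_2,N)\simeq\mathrm{Hom}_{\mathbf{CPM}}(M_1,\mathbf{CPM}(M_2,N)).$$
   Context: A premodel category is a complete and cocomplete category with two weak factorization systems $(\mathsf C,\mathsf{AF})$ and $(\mathsf{AC},\mathsf F)$ with $\mathsf{AC}\subset\mathsf C$ (cofibrations $\mathsf C$, anodyne cofibrations $\mathsf{AC}$, fibrations $\mathsf F$, anodyne fibrations $\mathsf{AF}$). It is combinatorial if it is locally presentable and both weak factorization systems are generated by sets of morphisms. $\mathrm{Hom}_{\mathbf{LPr}}(C,D)=\mathbf{LPr}(C,D)$ is the category of left adjoints $C\to D$ and natural transformations, for locally presentable $C,D$ (it is again locally presentable). $\mathrm{Hom}_{\mathbf{CPM}}(M,N)$ is the full subcategory of $\mathbf{LPr}(M,N)$ on the left Quillen functors (left adjoints preserving cofibrations and anodyne cofibrations). $\mathbf{CPM}(M,N)$ denotes $\mathbf{LPr}(M,N)$ with the combinatorial premodel structure in which $t:F\to F'$ is a cofibration if for every cofibration $f:A\to B$ of $M$ the map $F'A\amalg_{FA}FB\to F'B$ is a cofibration, anodyne if $f$ is, and an anodyne cofibration if for every cofibration $f:A\to B$ this map is an anodyne cofibration. $M_1\otimes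 M_2$ is the tensor product of combinatorial premodel categories: its underlying locally presentable category carries the universal adjunction of two variables $\otimes:M_1\times M_2\to M_1\otimes M_2$, and it has the combinatorial premodel structure for which left Quillen functors $M_1\otimes M_2\to N$ correspond by composition with $\otimes$ to Quillen bifunctors $M_1\times M_2\to N$, i.e. left parts $F$ of adjunctions of two variables such that for cofibrations $f_i:A_i\to B_i$ the map $F(B_1,A_2)\amalg_{F(A_1,A_2)}F(A_1,B_2)\to F(B_1,B_2)$ is a cofibration, anodyne if $f_1$ or $f_2$ is. The first displayed equivalence sends a left adjoint corresponding to the adjunction of two variables $F_0:M_1\times M_2\to N$ to the functor $A_1\mapsto F_0(A_1,-)$. *)

theory Defs
  imports Main "HOL-Library.FuncSet"
begin

unbundle cardinal_syntax

section \<open>Categories, functors, natural transformations\<close>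

record ('o, 'a) cat =
  Obj :: "'o set"
  Arr :: "'a set"
  Dom :: "'a \<Rightarrow> 'o"
  Cod :: "'a \<Rightarrow> 'o"
  Id :: "'o \<Rightarrow> 'a"
  Comp :: "'a \<Rightarrow> 'a \<Rightarrow> 'a" (infixl "\<cdot>\<index>" 70)

definition hom :: "('o, 'a) cat \<Rightarrow> 'o \<Rightarrow> 'o \<Rightarrow> 'a set" where
  "hom C x y = {f \<in> Arr C. Dom C f = x \<and> Cod C f = y}"

definition category :: "('o, 'a) cat \<Rightarrow> bool" where
  "category C \<longleftrightarrow>
     (\<forall>f \<in> Arr C. Dom C f \<in> Obj C \<and> Cod C f \<in> Obj C) \<and>
     (\<forall>x \<in> Obj C. Id C x \<in> hom C x x) \<and>
     (\<forall>f \<in> Arr C. \<forall>g \<in> Arr C. Cod C f = Dom C g \<longrightarrow>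
        g \<cdot>\<^bsub>C\<^esub> f \<in> hom C (Dom C f) (Cod C g)) \<and>
     (\<forall>f \<in> Arr C. f \<cdot>\<^bsub>C\<^esub> Id C (Dom C f) = f \<and> Id C (Cod C f) \<cdot>\<^bsub>C\<^esub> f = f) \<and>
     (\<forall>f \<in> Arr C. \<forall>g \<in> Arr C. \<forall>h \<in> Arr C.
        Cod C f = Dom C g \<longrightarrow> Cod C g = Dom C h \<longrightarrow>
        h \<cdot>\<^bsub>C\<^esub> (g \<cdot>\<^bsub>C\<^esub> f) = (h \<cdot>\<^bsub>C\<^esub> g) \<cdot>\<^bsub>C\<^esub> f)"

definition iso :: "('o, 'a) cat \<Rightarrow> 'a \<Rightarrow> bool" where
  "iso C f \<longleftrightarrow> f \<in> Arr C \<and>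
     (\<exists>g \<in> hom C (Cod C f) (Dom C f).
        g \<cdot>\<^bsub>C\<^esub> f = Id C (Dom C f) \<and> f \<cdot>\<^bsub>C\<^esub> g = Id C (Cod C f))"

definition op_cat :: "('o, 'a) cat \<Rightarrow> ('o, 'a) cat" where
  "op_cat C = \<lparr>Obj = Obj C, Arr = Arr C, Dom = Cod C, Cod = Dom C, Id = Id C,
     Comp = (\<lambda>g f. f \<cdot>\<^bsub>C\<^esub> g)\<rparr>"

definition prod_cat :: "('o, 'a) cat \<Rightarrow> ('p, 'b) cat \<Rightarrow> ('o \<times> 'p, 'a \<times> 'b) cat" where
  "prod_cat C D = \<lparr>Obj = Obj C \<times> Obj D, Arr = Arr C \<times> Arr D,
     Dom = map_prod (Dom C) (Dom D), Cod = map_prod (Cod C) (Cod D),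
     Id = map_prod (Id C) (Id D),
     Comp = (\<lambda>g f. (fst g \<cdot>\<^bsub>C\<^esub> fst f, snd g \<cdot>\<^bsub>D\<^esub> snd f))\<rparr>"

definition full_subcat :: "('o, 'a) cat \<Rightarrow> ('o \<Rightarrow> bool) \<Rightarrow> ('o, 'a) cat" where
  "full_subcat C P = C\<lparr>Obj := {x \<in> Obj C. P x},
     Arr := {f \<in> Arr C. P (Dom C f) \<and> P (Cod C f)}\<rparr>"

text \<open>Functors and natural transformations are required to be undefined outside the
  source category. They are then determined by their values there, so equality in HOL is
  the intended equality and functor categories contain no spurious duplicates.\<close>

record ('o, 'a, 'p, 'b) fctr =
  fobj :: "'o \<Rightarrow> 'p"
  farr :: "'a \<Rightarrow> 'b"

definition is_functor :: "('o, 'a) cat \<Rightarrow> ('p, 'b) cat \<Rightarrow> ('o, 'a, 'p, 'b) fctr \<Rightarrow> bool" where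
  "is_functor C D F \<longleftrightarrow>
     fobj F \<in> Obj C \<rightarrow>\<^sub>E Obj D \<and> farr F \<in> Arr C \<rightarrow>\<^sub>E Arr D \<and>
     (\<forall>f \<in> Arr C. farr F f \<in> hom D (fobj F (Dom C f)) (fobj F (Cod C f))) \<and>
     (\<forall>x \<in> Obj C. farr F (Id C x) = Id D (fobj F x)) \<and>
     (\<forall>f \<in> Arr C. \<forall>g \<in> Arr C. Cod C f = Dom C g \<longrightarrow>
        farr F (g \<cdot>\<^bsub>C\<^esub> f) = farr F g \<cdot>\<^bsub>D\<^esub> farr F f)"

definition id_functor :: "('o, 'a) cat \<Rightarrow> ('o, 'a, 'o, 'a) fctr" where
  "id_functor C = \<lparr>fobj = (\<lambda>x \<in> Obj C. x), farr = (\<lambda>f \<in> Arr C. f)\<rparr>"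

text \<open>The first argument is the source category of the inner functor.\<close>

definition comp_functor ::
    "('o, 'a) cat \<Rightarrow> ('p, 'b, 'q, 'c) fctr \<Rightarrow> ('o, 'a, 'p, 'b) fctr \<Rightarrow> ('o, 'a, 'q, 'c) fctr" where
  "comp_functor C G F = \<lparr>fobj = (\<lambda>x \<in> Obj C. fobj G (fobj F x)),
     farr = (\<lambda>f \<in> Arr C. farr G (farr F f))\<rparr>"

definition restrict_functor :: "('o, 'a) cat \<Rightarrow> ('o, 'a, 'p, 'b) fctr \<Rightarrow> ('o, 'a, 'p, 'b) fctr" where
  "restrict_functor C F = \<lparr>fobj = restrict (fobj F) (Obj C), farr = restrict (farr F) (Arr C)\<rparr>"

record ('o, 'a, 'p, 'b) ntrans =
  ntdom :: "('o, 'a, 'p, 'b) fctr"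
  ntcod :: "('o, 'a, 'p, 'b) fctr"
  ntmap :: "'o \<Rightarrow> 'b"

definition is_ntrans :: "('o, 'a) cat \<Rightarrow> ('p, 'b) cat \<Rightarrow> ('o, 'a, 'p, 'b) ntrans \<Rightarrow> bool" where
  "is_ntrans C D \<tau> \<longleftrightarrow>
     is_functor C D (ntdom \<tau>) \<and> is_functor C D (ntcod \<tau>) \<and>
     ntmap \<tau> \<in> extensional (Obj C) \<and>
     (\<forall>x \<in> Obj C. ntmap \<tau> x \<in> hom D (fobj (ntdom \<tau>) x) (fobj (ntcod \<tau>) x)) \<and>
     (\<forall>f \<in> Arr C. ntmap \<tau> (Cod C f) \<cdot>\<^bsub>D\<^esub> farr (ntdom \<tau>) f =
                  farr (ntcod \<tau>) f \<cdot>\<^bsub>D\<^esub> ntmap \<tau> (Dom C f))"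

definition functor_cat ::
    "('o, 'a) cat \<Rightarrow> ('p, 'b) cat \<Rightarrow> (('o, 'a, 'p, 'b) fctr, ('o, 'a, 'p, 'b) ntrans) cat" where
  "functor_cat C D = \<lparr>Obj = {F. is_functor C D F}, Arr = {\<tau>. is_ntrans C D \<tau>},
     Dom = ntdom, Cod = ntcod,
     Id = (\<lambda>F. \<lparr>ntdom = F, ntcod = F, ntmap = (\<lambda>x \<in> Obj C. Id D (fobj F x))\<rparr>),
     Comp = (\<lambda>\<tau> \<sigma>. \<lparr>ntdom = ntdom \<sigma>, ntcod = ntcod \<tau>,
                     ntmap = (\<lambda>x \<in> Obj C. ntmap \<tau> x \<cdot>\<^bsub>D\<^esub> ntmap \<sigma> x)\<rparr>)\<rparr>"

definition naturally_isomorphic ::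
    "('o, 'a) cat \<Rightarrow> ('p, 'b) cat \<Rightarrow> ('o, 'a, 'p, 'b) fctr \<Rightarrow> ('o, 'a, 'p, 'b) fctr \<Rightarrow> bool" where
  "naturally_isomorphic C D F G \<longleftrightarrow>
     (\<exists>\<tau>. is_ntrans C D \<tau> \<and> ntdom \<tau> = F \<and> ntcod \<tau> = G \<and> (\<forall>x \<in> Obj C. iso D (ntmap \<tau> x)))"

definition equivalence :: "('o, 'a) cat \<Rightarrow> ('p, 'b) cat \<Rightarrow> ('o, 'a, 'p, 'b) fctr \<Rightarrow> bool" where
  "equivalence C D F \<longleftrightarrow> category C \<and> category D \<and> is_functor C D F \<and>
     (\<exists>G. is_functor D C G \<and>
        naturally_isomorphic C C (comp_functor C G F) (id_functor C) \<and>
        naturally_isomorphic D D (comp_functor D F G) (id_functor D))"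


section \<open>Adjunctions\<close>

definition left_adjoint :: "('o, 'a) cat \<Rightarrow> ('p, 'b) cat \<Rightarrow> ('o, 'a, 'p, 'b) fctr \<Rightarrow> bool" where
  "left_adjoint C D F \<longleftrightarrow> is_functor C D F \<and>
     (\<exists>G \<phi>. is_functor D C G \<and>
        (\<forall>x \<in> Obj C. \<forall>y \<in> Obj D. bij_betw (\<phi> x y) (hom D (fobj F x) y) (hom C x (fobj G y))) \<and>
        (\<forall>f \<in> Arr C. \<forall>g \<in> Arr D. \<forall>h \<in> hom D (fobj F (Cod C f)) (Dom D g).
           \<phi> (Dom C f) (Cod D g) (g \<cdot>\<^bsub>D\<^esub> h \<cdot>\<^bsub>D\<^esub> farr F f) =
           farr G g \<cdot>\<^bsub>C\<^esub> \<phi> (Cod C f) (Dom D g) h \<cdot>\<^bsub>C\<^esub> f))"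

text \<open>Left part of an adjunction of two variables: the right adjoints are bifunctors
  \<open>G1 : B\<^sup>o\<^sup>p \<times> D \<rightarrow> A\<close> and \<open>G2 : A\<^sup>o\<^sup>p \<times> D \<rightarrow> B\<close>, and the bijections
  \<open>A(a, G1(b, y)) \<cong> D(F(a, b), y) \<cong> B(b, G2(a, y))\<close> are natural in all three variables.\<close>

definition two_var_left_adjoint ::
    "('o, 'a) cat \<Rightarrow> ('p, 'b) cat \<Rightarrow> ('q, 'c) cat \<Rightarrow> ('o \<times> 'p, 'a \<times> 'b, 'q, 'c) fctr \<Rightarrow> bool" where
  "two_var_left_adjoint A B D F \<longleftrightarrow> is_functor (prod_cat A B) D F \<and>
     (\<exists>G1 \<phi>. is_functor (prod_cat (op_cat B) D) A G1 \<and>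
        (\<forall>a \<in> Obj A. \<forall>b \<in> Obj B. \<forall>y \<in> Obj D.
           bij_betw (\<phi> a b y) (hom D (fobj F (a, b)) y) (hom A a (fobj G1 (b, y)))) \<and>
        (\<forall>f \<in> Arr A. \<forall>g \<in> Arr B. \<forall>k \<in> Arr D. \<forall>h \<in> hom D (fobj F (Cod A f, Cod B g)) (Dom D k).
           \<phi> (Dom A f) (Dom B g) (Cod D k) (k \<cdot>\<^bsub>D\<^esub> h \<cdot>\<^bsub>D\<^esub> farr F (f, g)) =
           farr G1 (g, k) \<cdot>\<^bsub>A\<^esub> \<phi> (Cod A f) (Cod B g) (Dom D k) h \<cdot>\<^bsub>A\<^esub> f)) \<and>
     (\<exists>G2 \<psi>. is_functor (prod_cat (op_cat A) D) B G2 \<and>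
        (\<forall>a \<in> Obj A. \<forall>b \<in> Obj B. \<forall>y \<in> Obj D.
           bij_betw (\<psi> a b y) (hom D (fobj F (a, b)) y) (hom B b (fobj G2 (a, y)))) \<and>
        (\<forall>f \<in> Arr A. \<forall>g \<in> Arr B. \<forall>k \<in> Arr D. \<forall>h \<in> hom D (fobj F (Cod A f, Cod B g)) (Dom D k).
           \<psi> (Dom A f) (Dom B g) (Cod D k) (k \<cdot>\<^bsub>D\<^esub> h \<cdot>\<^bsub>D\<^esub> farr F (f, g)) =
           farr G2 (f, k) \<cdot>\<^bsub>B\<^esub> \<psi> (Cod A f) (Cod B g) (Dom D k) h \<cdot>\<^bsub>B\<^esub> g))"

definition two_var_cat ::
    "('o, 'a) cat \<Rightarrow> ('p, 'b) cat \<Rightarrow> ('q, 'c) cat \<Rightarrow>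
     (('o \<times> 'p, 'a \<times> 'b, 'q, 'c) fctr, ('o \<times> 'p, 'a \<times> 'b, 'q, 'c) ntrans) cat" where
  "two_var_cat A B D = full_subcat (functor_cat (prod_cat A B) D) (two_var_left_adjoint A B D)"

definition LPr ::
    "('o, 'a) cat \<Rightarrow> ('p, 'b) cat \<Rightarrow> (('o, 'a, 'p, 'b) fctr, ('o, 'a, 'p, 'b) ntrans) cat" where
  "LPr C D = full_subcat (functor_cat C D) (left_adjoint C D)"


section \<open>Limits, colimits, local presentability\<close>

text \<open>Smallness is cardinality below a fixed infinite regular cardinal \<open>\<kappa> :: 'k rel\<close>. A
  Grothendieck universe is the case of an inaccessible \<open>\<kappa>\<close>, but being a strong limit is
  never required. Every small category is isomorphic to one whose objects and arrows
  have type \<open>'k\<close>, so it is enough to consider diagrams indexed by these. The same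
  holds for the small regular cardinals \<open>\<mu> :: 'k rel\<close> below.\<close>

definition regular_cardinal :: "'k rel \<Rightarrow> bool" where
  "regular_cardinal \<kappa> \<longleftrightarrow> Cinfinite \<kappa> \<and> regularCard \<kappa>"

definition category_below :: "'k rel \<Rightarrow> ('o, 'a) cat \<Rightarrow> bool" where
  "category_below \<kappa> J \<longleftrightarrow> category J \<and> |Obj J| <o \<kappa> \<and> |Arr J| <o \<kappa>"

definition is_cocone ::
    "('i, 'j) cat \<Rightarrow> ('o, 'a) cat \<Rightarrow> ('i, 'j, 'o, 'a) fctr \<Rightarrow> 'o \<Rightarrow> ('i \<Rightarrow> 'a) \<Rightarrow> bool" where
  "is_cocone J C D c \<iota> \<longleftrightarrow> c \<in> Obj C \<and>
     (\<forall>j \<in> Obj J. \<iota> j \<in> hom C (fobj D j) c) \<and>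
     (\<forall>u \<in> Arr J. \<iota> (Cod J u) \<cdot>\<^bsub>C\<^esub> farr D u = \<iota> (Dom J u))"

definition is_colimit ::
    "('i, 'j) cat \<Rightarrow> ('o, 'a) cat \<Rightarrow> ('i, 'j, 'o, 'a) fctr \<Rightarrow> 'o \<Rightarrow> ('i \<Rightarrow> 'a) \<Rightarrow> bool" where
  "is_colimit J C D c \<iota> \<longleftrightarrow> is_cocone J C D c \<iota> \<and>
     (\<forall>d \<theta>. is_cocone J C D d \<theta> \<longrightarrow>
        (\<exists>!h. h \<in> hom C c d \<and> (\<forall>j \<in> Obj J. h \<cdot>\<^bsub>C\<^esub> \<iota> j = \<theta> j)))"

definition is_cone ::
    "('i, 'j) cat \<Rightarrow> ('o, 'a) cat \<Rightarrow> ('i, 'j, 'o, 'a) fctr \<Rightarrow> 'o \<Rightarrow> ('i \<Rightarrow> 'a) \<Rightarrow> bool" where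
  "is_cone J C D c \<pi> \<longleftrightarrow> c \<in> Obj C \<and>
     (\<forall>j \<in> Obj J. \<pi> j \<in> hom C c (fobj D j)) \<and>
     (\<forall>u \<in> Arr J. farr D u \<cdot>\<^bsub>C\<^esub> \<pi> (Dom J u) = \<pi> (Cod J u))"

definition is_limit ::
    "('i, 'j) cat \<Rightarrow> ('o, 'a) cat \<Rightarrow> ('i, 'j, 'o, 'a) fctr \<Rightarrow> 'o \<Rightarrow> ('i \<Rightarrow> 'a) \<Rightarrow> bool" where
  "is_limit J C D c \<pi> \<longleftrightarrow> is_cone J C D c \<pi> \<and>
     (\<forall>d \<theta>. is_cone J C D d \<theta> \<longrightarrow>
        (\<exists>!h. h \<in> hom C d c \<and> (\<forall>j \<in> Obj J. \<pi> j \<cdot>\<^bsub>C\<^esub> h = \<theta> j)))"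

definition cocomplete :: "'k rel \<Rightarrow> ('o, 'a) cat \<Rightarrow> bool" where
  "cocomplete \<kappa> C \<longleftrightarrow>
     (\<forall>(J :: ('k, 'k) cat) D. category_below \<kappa> J \<and> is_functor J C D \<longrightarrow> (\<exists>c \<iota>. is_colimit J C D c \<iota>))"

definition complete_cat :: "'k rel \<Rightarrow> ('o, 'a) cat \<Rightarrow> bool" where
  "complete_cat \<kappa> C \<longleftrightarrow>
     (\<forall>(J :: ('k, 'k) cat) D. category_below \<kappa> J \<and> is_functor J C D \<longrightarrow> (\<exists>c \<pi>. is_limit J C D c \<pi>))"

definition filtered :: "'k rel \<Rightarrow> ('i, 'j) cat \<Rightarrow> bool" where
  "filtered \<mu> J \<longleftrightarrow> category J \<and>
     (\<forall>(K :: ('k, 'k) cat) D. category_below \<mu> K \<and> is_functor K J D \<longrightarrow> (\<exists>c \<iota>. is_cocone K J D c \<iota>))"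

text \<open>The functor \<open>hom C a\<close> preserves small \<open>\<mu>\<close>-filtered colimits. This is expressed by the
  explicit description of filtered colimits of sets: the canonical map from the colimit of
  the \<open>hom C a (fobj D j)\<close> to \<open>hom C a c\<close> is surjective and injective.\<close>

definition presentable :: "'k rel \<Rightarrow> 'k rel \<Rightarrow> ('o, 'a) cat \<Rightarrow> 'o \<Rightarrow> bool" where
  "presentable \<kappa> \<mu> C a \<longleftrightarrow> a \<in> Obj C \<and>
     (\<forall>(J :: ('k, 'k) cat) D c \<iota>.
        category_below \<kappa> J \<and> filtered \<mu> J \<and> is_functor J C D \<and> is_colimit J C D c \<iota> \<longrightarrow>
        (\<forall>f \<in> hom C a c. \<exists>j \<in> Obj J. \<exists>u \<in> hom C a (fobj D j). \<iota> j \<cdot>\<^bsub>C\<^esub> u = f) \<and>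
        (\<forall>i \<in> Obj J. \<forall>j \<in> Obj J. \<forall>u \<in> hom C a (fobj D i). \<forall>v \<in> hom C a (fobj D j).
           \<iota> i \<cdot>\<^bsub>C\<^esub> u = \<iota> j \<cdot>\<^bsub>C\<^esub> v \<longrightarrow>
           (\<exists>k \<in> Obj J. \<exists>p \<in> hom J i k. \<exists>q \<in> hom J j k.
              farr D p \<cdot>\<^bsub>C\<^esub> u = farr D q \<cdot>\<^bsub>C\<^esub> v)))"

definition locally_presentable :: "'k rel \<Rightarrow> ('o, 'a) cat \<Rightarrow> bool" where
  "locally_presentable \<kappa> C \<longleftrightarrow> category C \<and>
     (\<forall>x \<in> Obj C. \<forall>y \<in> Obj C. |hom C x y| <o \<kappa>) \<and>
     cocomplete \<kappa> C \<and>
     (\<exists>(\<mu> :: 'k rel) S. regular_cardinal \<mu> \<and> \<mu> <o \<kappa> \<and> |S| <o \<kappa> \<and>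
        (\<forall>s \<in> S. presentable \<kappa> \<mu> C s) \<and>
        (\<forall>x \<in> Obj C. \<exists>(J :: ('k, 'k) cat) D \<iota>.
           category_below \<kappa> J \<and> filtered \<mu> J \<and> is_functor J C D \<and>
           (\<forall>j \<in> Obj J. fobj D j \<in> S) \<and> is_colimit J C D x \<iota>))"


section \<open>Combinatorial premodel categories\<close>

definition lifts :: "('o, 'a) cat \<Rightarrow> 'a \<Rightarrow> 'a \<Rightarrow> bool" where
  "lifts C l r \<longleftrightarrow>
     (\<forall>u \<in> hom C (Dom C l) (Dom C r). \<forall>v \<in> hom C (Cod C l) (Cod C r).
        r \<cdot>\<^bsub>C\<^esub> u = v \<cdot>\<^bsub>C\<^esub> l \<longrightarrow>
        (\<exists>d \<in> hom C (Cod C l) (Dom C r). d \<cdot>\<^bsub>C\<^esub> l = u \<and> r \<cdot>\<^bsub>C\<^esub> d = v))"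

definition llp :: "('o, 'a) cat \<Rightarrow> 'a set \<Rightarrow> 'a set" where
  "llp C R = {l \<in> Arr C. \<forall>r \<in> R. lifts C l r}"

definition rlp :: "('o, 'a) cat \<Rightarrow> 'a set \<Rightarrow> 'a set" where
  "rlp C L = {r \<in> Arr C. \<forall>l \<in> L. lifts C l r}"

definition weak_factorization_system :: "('o, 'a) cat \<Rightarrow> 'a set \<Rightarrow> 'a set \<Rightarrow> bool" where
  "weak_factorization_system C L R \<longleftrightarrow> L = llp C R \<and> R = rlp C L \<and>
     (\<forall>f \<in> Arr C. \<exists>l \<in> L. \<exists>r \<in> R. Dom C l = Dom C f \<and> Cod C l = Dom C r \<and>
        Cod C r = Cod C f \<and> r \<cdot>\<^bsub>C\<^esub> l = f)"

definition generated_by_small_set :: "'k rel \<Rightarrow> ('o, 'a) cat \<Rightarrow> 'a set \<Rightarrow> bool" where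
  "generated_by_small_set \<kappa> C R \<longleftrightarrow> (\<exists>I. I \<subseteq> Arr C \<and> |I| <o \<kappa> \<and> R = rlp C I)"

record ('o, 'a) premodel =
  cat_of :: "('o, 'a) cat"
  Cof :: "'a set"
  ACof :: "'a set"
  Fib :: "'a set"
  AFib :: "'a set"

definition premodel_category :: "'k rel \<Rightarrow> ('o, 'a) premodel \<Rightarrow> bool" where
  "premodel_category \<kappa> M \<longleftrightarrow> category (cat_of M) \<and>
     complete_cat \<kappa> (cat_of M) \<and> cocomplete \<kappa> (cat_of M) \<and>
     weak_factorization_system (cat_of M) (Cof M) (AFib M) \<and>
     weak_factorization_system (cat_of M) (ACof M) (Fib M) \<and>
     ACof M \<subseteq> Cof M"

definition combinatorial_premodel_category :: "'k rel \<Rightarrow> ('o, 'a) premodel \<Rightarrow> bool" where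
  "combinatorial_premodel_category \<kappa> M \<longleftrightarrow> premodel_category \<kappa> M \<and>
     locally_presentable \<kappa> (cat_of M) \<and>
     generated_by_small_set \<kappa> (cat_of M) (AFib M) \<and>
     generated_by_small_set \<kappa> (cat_of M) (Fib M)"

definition left_quillen ::
    "('o, 'a) premodel \<Rightarrow> ('p, 'b) premodel \<Rightarrow> ('o, 'a, 'p, 'b) fctr \<Rightarrow> bool" where
  "left_quillen M N F \<longleftrightarrow> left_adjoint (cat_of M) (cat_of N) F \<and>
     (\<forall>f \<in> Cof M. farr F f \<in> Cof N) \<and> (\<forall>f \<in> ACof M. farr F f \<in> ACof N)"

definition Hom_CPM ::
    "('o, 'a) premodel \<Rightarrow> ('p, 'b) premodel \<Rightarrow>
     (('o, 'a, 'p, 'b) fctr, ('o, 'a, 'p, 'b) ntrans) cat" where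
  "Hom_CPM M N = full_subcat (LPr (cat_of M) (cat_of N)) (left_quillen M N)"

definition is_pushout :: "('o, 'a) cat \<Rightarrow> 'a \<Rightarrow> 'a \<Rightarrow> 'a \<Rightarrow> 'a \<Rightarrow> bool" where
  "is_pushout C p q i j \<longleftrightarrow> p \<in> Arr C \<and> q \<in> Arr C \<and> Dom C p = Dom C q \<and>
     i \<in> hom C (Cod C p) (Cod C i) \<and> j \<in> hom C (Cod C q) (Cod C i) \<and>
     i \<cdot>\<^bsub>C\<^esub> p = j \<cdot>\<^bsub>C\<^esub> q \<and>
     (\<forall>w \<in> Obj C. \<forall>r \<in> hom C (Cod C p) w. \<forall>s \<in> hom C (Cod C q) w.
        r \<cdot>\<^bsub>C\<^esub> p = s \<cdot>\<^bsub>C\<^esub> q \<longrightarrow>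
        (\<exists>!m. m \<in> hom C (Cod C i) w \<and> m \<cdot>\<^bsub>C\<^esub> i = r \<and> m \<cdot>\<^bsub>C\<^esub> j = s))"

text \<open>For a commutative square \<open>r \<cdot> p = s \<cdot> q\<close>, the maps out of the pushouts of
  \<open>p\<close> and \<open>q\<close> induced by \<open>r\<close> and \<open>s\<close>. There is one for each choice of the pushout, and any
  two differ by an isomorphism of pushouts.\<close>

definition corner_maps :: "('o, 'a) cat \<Rightarrow> 'a \<Rightarrow> 'a \<Rightarrow> 'a \<Rightarrow> 'a \<Rightarrow> 'a set" where
  "corner_maps C p q r s = {m. \<exists>i j. is_pushout C p q i j \<and> m \<in> hom C (Cod C i) (Cod C r) \<and>
     m \<cdot>\<^bsub>C\<^esub> i = r \<and> m \<cdot>\<^bsub>C\<^esub> j = s}"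

text \<open>The maps \<open>F' A \<amalg>\<^bsub>F A\<^esub> F B \<rightarrow> F' B\<close> for \<open>\<tau> : F \<rightarrow> F'\<close> and \<open>f : A \<rightarrow> B\<close> in \<open>C\<close>.\<close>

definition ntrans_corner ::
    "('o, 'a) cat \<Rightarrow> ('p, 'b) cat \<Rightarrow> ('o, 'a, 'p, 'b) ntrans \<Rightarrow> 'a \<Rightarrow> 'b set" where
  "ntrans_corner C D \<tau> f = corner_maps D
     (ntmap \<tau> (Dom C f)) (farr (ntdom \<tau>) f) (farr (ntcod \<tau>) f) (ntmap \<tau> (Cod C f))"

definition CPM_Cof :: "('o, 'a) premodel \<Rightarrow> ('p, 'b) premodel \<Rightarrow> ('o, 'a, 'p, 'b) ntrans set" where
  "CPM_Cof M N = {\<tau> \<in> Arr (LPr (cat_of M) (cat_of N)). \<forall>f \<in> Cof M.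
     ntrans_corner (cat_of M) (cat_of N) \<tau> f \<subseteq> Cof N \<and>
     (f \<in> ACof M \<longrightarrow> ntrans_corner (cat_of M) (cat_of N) \<tau> f \<subseteq> ACof N)}"

definition CPM_ACof :: "('o, 'a) premodel \<Rightarrow> ('p, 'b) premodel \<Rightarrow> ('o, 'a, 'p, 'b) ntrans set" where
  "CPM_ACof M N = {\<tau> \<in> Arr (LPr (cat_of M) (cat_of N)). \<forall>f \<in> Cof M.
     ntrans_corner (cat_of M) (cat_of N) \<tau> f \<subseteq> ACof N}"

definition CPM ::
    "('o, 'a) premodel \<Rightarrow> ('p, 'b) premodel \<Rightarrow>
     (('o, 'a, 'p, 'b) fctr, ('o, 'a, 'p, 'b) ntrans) premodel" where
  "CPM M N = \<lparr>cat_of = LPr (cat_of M) (cat_of N),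
     Cof = CPM_Cof M N, ACof = CPM_ACof M N,
     Fib = rlp (LPr (cat_of M) (cat_of N)) (CPM_ACof M N),
     AFib = rlp (LPr (cat_of M) (cat_of N)) (CPM_Cof M N)\<rparr>"

text \<open>The maps \<open>F(B1, A2) \<amalg>\<^bsub>F(A1, A2)\<^esub> F(A1, B2) \<rightarrow> F(B1, B2)\<close> for \<open>f : A1 \<rightarrow> B1\<close> in \<open>A\<close> and
  \<open>g : A2 \<rightarrow> B2\<close> in \<open>B\<close>.\<close>

definition bifunctor_corner ::
    "('o, 'a) cat \<Rightarrow> ('p, 'b) cat \<Rightarrow> ('q, 'c) cat \<Rightarrow> ('o \<times> 'p, 'a \<times> 'b, 'q, 'c) fctr \<Rightarrow>
     'a \<Rightarrow> 'b \<Rightarrow> 'c set" where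
  "bifunctor_corner A B D F f g = corner_maps D
     (farr F (f, Id B (Dom B g))) (farr F (Id A (Dom A f), g))
     (farr F (Id A (Cod A f), g)) (farr F (f, Id B (Cod B g)))"

definition quillen_bifunctor ::
    "('o, 'a) premodel \<Rightarrow> ('p, 'b) premodel \<Rightarrow> ('q, 'c) premodel \<Rightarrow>
     ('o \<times> 'p, 'a \<times> 'b, 'q, 'c) fctr \<Rightarrow> bool" where
  "quillen_bifunctor M1 M2 N F \<longleftrightarrow>
     two_var_left_adjoint (cat_of M1) (cat_of M2) (cat_of N) F \<and>
     (\<forall>f \<in> Cof M1. \<forall>g \<in> Cof M2.
        bifunctor_corner (cat_of M1) (cat_of M2) (cat_of N) F f g \<subseteq> Cof N \<and>
        (f \<in> ACof M1 \<or> g \<in> ACof M2 \<longrightarrow>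
           bifunctor_corner (cat_of M1) (cat_of M2) (cat_of N) F f g \<subseteq> ACof N))"


section \<open>Tensor product and the tensor-Hom functor\<close>

text \<open>Composition with \<open>t : A \<rightarrow> B\<close>, as a functor defined on a category \<open>H\<close> of functors
  out of \<open>B\<close>.\<close>

definition precomp ::
    "('o, 'a) cat \<Rightarrow> (('p, 'b, 'q, 'c) fctr, ('p, 'b, 'q, 'c) ntrans) cat \<Rightarrow>
     ('o, 'a, 'p, 'b) fctr \<Rightarrow>
     (('p, 'b, 'q, 'c) fctr, ('p, 'b, 'q, 'c) ntrans,
      ('o, 'a, 'q, 'c) fctr, ('o, 'a, 'q, 'c) ntrans) fctr" where
  "precomp A H t = \<lparr>fobj = (\<lambda>F \<in> Obj H. comp_functor A F t),
     farr = (\<lambda>\<tau> \<in> Arr H. \<lparr>ntdom = comp_functor A (ntdom \<tau>) t,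
                         ntcod = comp_functor A (ntcod \<tau>) t,
                         ntmap = (\<lambda>x \<in> Obj A. ntmap \<tau> (fobj t x))\<rparr>)\<rparr>"

text \<open>\<open>T\<close> with \<open>t : M1 \<times> M2 \<rightarrow> T\<close> is a tensor product of \<open>M1\<close> and \<open>M2\<close>. The first universal
  property is that of the underlying locally presentable category; the second determines
  the premodel structure of \<open>T\<close>.\<close>

definition is_tensor_product ::
    "'k rel \<Rightarrow> ('o1, 'a1) premodel \<Rightarrow> ('o2, 'a2) premodel \<Rightarrow> ('o, 'a) premodel \<Rightarrow>
     ('o1 \<times> 'o2, 'a1 \<times> 'a2, 'o, 'a) fctr \<Rightarrow> bool" where
  "is_tensor_product \<kappa> M1 M2 T t \<longleftrightarrow>
     combinatorial_premodel_category \<kappa> T \<and>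
     two_var_left_adjoint (cat_of M1) (cat_of M2) (cat_of T) t \<and>
     (\<forall>D :: ('o, 'a) cat. locally_presentable \<kappa> D \<longrightarrow>
        equivalence (LPr (cat_of T) D) (two_var_cat (cat_of M1) (cat_of M2) D)
          (precomp (prod_cat (cat_of M1) (cat_of M2)) (LPr (cat_of T) D) t)) \<and>
     (\<forall>N :: ('o, 'a) premodel. combinatorial_premodel_category \<kappa> N \<longrightarrow>
        (\<forall>F. left_adjoint (cat_of T) (cat_of N) F \<longrightarrow>
           (left_quillen T N F \<longleftrightarrow>
            quillen_bifunctor M1 M2 N (comp_functor (prod_cat (cat_of M1) (cat_of M2)) F t))))"

text \<open>\<open>partial_functor A B F a = F(a, -)\<close>.\<close>

definition partial_functor ::
    "('o, 'a) cat \<Rightarrow> ('p, 'b) cat \<Rightarrow> ('o \<times> 'p, 'a \<times> 'b, 'q, 'c) fctr \<Rightarrow> 'o \<Rightarrow>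
     ('p, 'b, 'q, 'c) fctr" where
  "partial_functor A B F a =
     \<lparr>fobj = (\<lambda>b \<in> Obj B. fobj F (a, b)), farr = (\<lambda>g \<in> Arr B. farr F (Id A a, g))\<rparr>"

definition curry_obj ::
    "('o, 'a) cat \<Rightarrow> ('p, 'b) cat \<Rightarrow> ('o \<times> 'p, 'a \<times> 'b, 'q, 'c) fctr \<Rightarrow>
     ('o, 'a, ('p, 'b, 'q, 'c) fctr, ('p, 'b, 'q, 'c) ntrans) fctr" where
  "curry_obj A B F = \<lparr>fobj = (\<lambda>a \<in> Obj A. partial_functor A B F a),
     farr = (\<lambda>f \<in> Arr A. \<lparr>ntdom = partial_functor A B F (Dom A f),
                         ntcod = partial_functor A B F (Cod A f),
                         ntmap = (\<lambda>b \<in> Obj B. farr F (f, Id B b))\<rparr>)\<rparr>"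

definition curry_arr ::
    "('o, 'a) cat \<Rightarrow> ('p, 'b) cat \<Rightarrow> ('o \<times> 'p, 'a \<times> 'b, 'q, 'c) ntrans \<Rightarrow>
     ('o, 'a, ('p, 'b, 'q, 'c) fctr, ('p, 'b, 'q, 'c) ntrans) ntrans" where
  "curry_arr A B \<tau> = \<lparr>ntdom = curry_obj A B (ntdom \<tau>), ntcod = curry_obj A B (ntcod \<tau>),
     ntmap = (\<lambda>a \<in> Obj A. \<lparr>ntdom = partial_functor A B (ntdom \<tau>) a,
                          ntcod = partial_functor A B (ntcod \<tau>) a,
                          ntmap = (\<lambda>b \<in> Obj B. ntmap \<tau> (a, b))\<rparr>)\<rparr>"

definition curry_functor ::
    "('o, 'a) cat \<Rightarrow> ('p, 'b) cat \<Rightarrow>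
     (('o \<times> 'p, 'a \<times> 'b, 'q, 'c) fctr, ('o \<times> 'p, 'a \<times> 'b, 'q, 'c) ntrans) cat \<Rightarrow>
     (('o \<times> 'p, 'a \<times> 'b, 'q, 'c) fctr, ('o \<times> 'p, 'a \<times> 'b, 'q, 'c) ntrans,
      ('o, 'a, ('p, 'b, 'q, 'c) fctr, ('p, 'b, 'q, 'c) ntrans) fctr,
      ('o, 'a, ('p, 'b, 'q, 'c) fctr, ('p, 'b, 'q, 'c) ntrans) ntrans) fctr" where
  "curry_functor A B H =
     \<lparr>fobj = restrict (curry_obj A B) (Obj H), farr = restrict (curry_arr A B) (Arr H)\<rparr>"

text \<open>The functor \<open>F \<mapsto> (A1 \<mapsto> F(A1 \<otimes> -))\<close> from \<open>LPr T D\<close> to \<open>LPr A (LPr B D)\<close>, where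
  \<open>t : A \<times> B \<rightarrow> T\<close> is \<open>\<otimes>\<close>.\<close>

definition tensor_hom_functor ::
    "('o, 'a) cat \<Rightarrow> ('p, 'b) cat \<Rightarrow> ('r, 'd) cat \<Rightarrow> ('q, 'c) cat \<Rightarrow>
     ('o \<times> 'p, 'a \<times> 'b, 'r, 'd) fctr \<Rightarrow>
     (('r, 'd, 'q, 'c) fctr, ('r, 'd, 'q, 'c) ntrans,
      ('o, 'a, ('p, 'b, 'q, 'c) fctr, ('p, 'b, 'q, 'c) ntrans) fctr,
      ('o, 'a, ('p, 'b, 'q, 'c) fctr, ('p, 'b, 'q, 'c) ntrans) ntrans) fctr" where
  "tensor_hom_functor A B T D t = comp_functor (LPr T D)
     (curry_functor A B (two_var_cat A B D)) (precomp (prod_cat A B) (LPr T D) t)"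

end

theory Submission
  imports Defs
begin

text \<open>
  The tensor-Hom functor \<open>F \<mapsto> (A1 \<mapsto> F(A1 \<otimes> -))\<close> is precomposition with \<open>\<otimes>\<close> followed by currying.
  Precomposition is an equivalence onto the adjunctions of two variables because that is the
  universal property of the tensor product. So everything rests on currying
  (\<open>curry_equivalence\<close>): it identifies adjunctions of two variables \<open>A \<times> B \<rightarrow> D\<close> with left adjoints
  \<open>A \<rightarrow> LPr B D\<close>. On underlying functors and transformations it is bijective by inspection. What
  has to be shown is that being a left adjoint means the same on both sides.

  \<^item> Let \<open>F\<close> be an adjunction of two variables, \<open>G1\<close> its right adjoint in the first variable. The
    right adjoint of \<open>a \<mapsto> F(a, -)\<close> must send \<open>H\<close> to the end of \<open>G1(b, H b)\<close> over all \<open>b\<close> in \<open>B\<close>,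
    which is a large limit. But \<open>F(a, -)\<close> preserves colimits, so a transformation
    \<open>F(a, -) \<rightarrow> H\<close> is the same as a natural family on a small set of generators of \<open>B\<close>
    (\<open>ntrans_extends_from_generators\<close>). The end over the generators exists in \<open>A\<close> and does the
    job (\<open>curry_obj_left_adjoint\<close>).

  \<^item> Let \<open>K : A \<rightarrow> LPr B D\<close> be a left adjoint. Each \<open>K(a)\<close> is a left adjoint, and the same is needed
    of \<open>K(-)(b)\<close> for each \<open>b\<close>. The pointwise colimit of a small diagram of left adjoints \<open>B \<rightarrow> D\<close>
    preserves small colimits, hence is a left adjoint by the adjoint functor theorem on \<open>B\<close>. So
    colimits in \<open>LPr B D\<close> are pointwise (\<open>eval_preserves_small_colimits\<close>), \<open>K(-)(b)\<close> preserves small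
    colimits, and the adjoint functor theorem on \<open>A\<close> applies (\<open>uncurry_two_var_left_adjoint\<close>).

  For the premodel structures, the corner map of the transformation \<open>F(f, -)\<close> at \<open>g\<close> is literally the
  corner map of \<open>F\<close> at \<open>f\<close> and \<open>g\<close>. Therefore the curried functor is left Quillen into \<open>CPM M2 N\<close> if
  and only if \<open>F\<close> is a Quillen bifunctor (\<open>left_quillen_curry_iff\<close>), and by the choice of the
  premodel structure on the tensor product this holds if and only if the functor on the tensor
  product is left Quillen. An equivalence restricts to full subcategories that correspond to each
  other in this way, provided that the one in the target is closed under isomorphism
  (\<open>equivalence_restrict\<close>). It is, since cofibrations are defined by a lifting property and
  hence are closed under composition with isomorphisms (\<open>quillen_bifunctor_iso\<close>).
\<close>

section \<open>Categories and functors\<close>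

lemma homD:
  assumes "f \<in> hom C x y"
  shows "f \<in> Arr C" "Dom C f = x" "Cod C f = y"
  using assms by (simp_all add: hom_def)

lemma arr_hom: "f \<in> Arr C \<Longrightarrow> f \<in> hom C (Dom C f) (Cod C f)"
  by (simp add: hom_def)

lemma hom_obj:
  assumes "category C" "f \<in> hom C x y"
  shows "x \<in> Obj C" "y \<in> Obj C"
  using assms by (auto simp: category_def hom_def)

lemma arr_obj:
  assumes "category C" "f \<in> Arr C"
  shows "Dom C f \<in> Obj C" "Cod C f \<in> Obj C"
  using assms by (auto simp: category_def)

lemma id_hom: "category C \<Longrightarrow> x \<in> Obj C \<Longrightarrow> Id C x \<in> hom C x x"
  by (simp add: category_def)

lemma comp_hom:
  "category C \<Longrightarrow> f \<in> hom C x y \<Longrightarrow> g \<in> hom C y z \<Longrightarrow> g \<cdot>\<^bsub>C\<^esub> f \<in> hom C x z"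
  unfolding category_def hom_def by auto

lemma comp_id_right: "category C \<Longrightarrow> f \<in> hom C x y \<Longrightarrow> f \<cdot>\<^bsub>C\<^esub> Id C x = f"
  unfolding category_def hom_def by auto

lemma comp_id_left: "category C \<Longrightarrow> f \<in> hom C x y \<Longrightarrow> Id C y \<cdot>\<^bsub>C\<^esub> f = f"
  unfolding category_def hom_def by auto

lemma comp_assoc:
  "category C \<Longrightarrow> f \<in> hom C w x \<Longrightarrow> g \<in> hom C x y \<Longrightarrow> h \<in> hom C y z \<Longrightarrow>
     h \<cdot>\<^bsub>C\<^esub> (g \<cdot>\<^bsub>C\<^esub> f) = h \<cdot>\<^bsub>C\<^esub> g \<cdot>\<^bsub>C\<^esub> f"
  unfolding category_def hom_def by auto

lemma categoryI:
  assumes "\<And>f. f \<in> Arr C \<Longrightarrow> Dom C f \<in> Obj C \<and> Cod C f \<in> Obj C"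
    and "\<And>x. x \<in> Obj C \<Longrightarrow> Id C x \<in> hom C x x"
    and "\<And>f g x y z. f \<in> hom C x y \<Longrightarrow> g \<in> hom C y z \<Longrightarrow> g \<cdot>\<^bsub>C\<^esub> f \<in> hom C x z"
    and "\<And>f x y. f \<in> hom C x y \<Longrightarrow> f \<cdot>\<^bsub>C\<^esub> Id C x = f \<and> Id C y \<cdot>\<^bsub>C\<^esub> f = f"
    and "\<And>f g h w x y z. f \<in> hom C w x \<Longrightarrow> g \<in> hom C x y \<Longrightarrow> h \<in> hom C y z \<Longrightarrow>
        h \<cdot>\<^bsub>C\<^esub> (g \<cdot>\<^bsub>C\<^esub> f) = h \<cdot>\<^bsub>C\<^esub> g \<cdot>\<^bsub>C\<^esub> f"
  shows "category C"
  unfolding category_def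
proof (intro conjI ballI impI)
  fix f g assume "f \<in> Arr C" "g \<in> Arr C" "Cod C f = Dom C g"
  then show "g \<cdot>\<^bsub>C\<^esub> f \<in> hom C (Dom C f) (Cod C g)"
    using assms(3) by (metis arr_hom)
next
  fix f g h assume "f \<in> Arr C" "g \<in> Arr C" "h \<in> Arr C" "Cod C f = Dom C g" "Cod C g = Dom C h"
  then show "h \<cdot>\<^bsub>C\<^esub> (g \<cdot>\<^bsub>C\<^esub> f) = h \<cdot>\<^bsub>C\<^esub> g \<cdot>\<^bsub>C\<^esub> f"
    using assms(5) by (metis arr_hom)
qed (use assms(1,2,4) arr_hom in \<open>fast+\<close>)

lemma functor_obj: "is_functor C D F \<Longrightarrow> x \<in> Obj C \<Longrightarrow> fobj F x \<in> Obj D"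
  unfolding is_functor_def by auto

lemma functor_hom: "is_functor C D F \<Longrightarrow> f \<in> hom C x y \<Longrightarrow> farr F f \<in> hom D (fobj F x) (fobj F y)"
  unfolding is_functor_def hom_def by auto

lemma functor_id: "is_functor C D F \<Longrightarrow> x \<in> Obj C \<Longrightarrow> farr F (Id C x) = Id D (fobj F x)"
  unfolding is_functor_def by auto

lemma functor_comp:
  "is_functor C D F \<Longrightarrow> f \<in> hom C x y \<Longrightarrow> g \<in> hom C y z \<Longrightarrow>
     farr F (g \<cdot>\<^bsub>C\<^esub> f) = farr F g \<cdot>\<^bsub>D\<^esub> farr F f"
  unfolding is_functor_def hom_def by auto

lemma functorI:
  assumes "fobj F \<in> extensional (Obj C)" "farr F \<in> extensional (Arr C)"
    and "\<And>x. x \<in> Obj C \<Longrightarrow> fobj F x \<in> Obj D"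
    and "\<And>f x y. f \<in> hom C x y \<Longrightarrow> farr F f \<in> hom D (fobj F x) (fobj F y)"
    and "\<And>x. x \<in> Obj C \<Longrightarrow> farr F (Id C x) = Id D (fobj F x)"
    and "\<And>f g x y z. f \<in> hom C x y \<Longrightarrow> g \<in> hom C y z \<Longrightarrow>
        farr F (g \<cdot>\<^bsub>C\<^esub> f) = farr F g \<cdot>\<^bsub>D\<^esub> farr F f"
  shows "is_functor C D F"
proof -
  have "farr F f \<in> hom D (fobj F (Dom C f)) (fobj F (Cod C f))" if "f \<in> Arr C" for f
    using assms(4)[OF arr_hom[OF that]] .
  moreover have "farr F (g \<cdot>\<^bsub>C\<^esub> f) = farr F g \<cdot>\<^bsub>D\<^esub> farr F f"
    if "f \<in> Arr C" "g \<in> Arr C" "Cod C f = Dom C g" for f g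
    using assms(6)[of f "Dom C f" "Cod C f" g "Cod C g"] that by (simp add: hom_def)
  ultimately show ?thesis
    using assms(1,2,3,5) unfolding is_functor_def by (auto simp: PiE_def dest: homD(1))
qed

lemma functor_eqI:
  assumes "is_functor C D F" "is_functor C D G"
    and "\<And>x. x \<in> Obj C \<Longrightarrow> fobj F x = fobj G x" "\<And>f. f \<in> Arr C \<Longrightarrow> farr F f = farr G f"
  shows "F = G"
proof -
  have "fobj F \<in> extensional (Obj C)" "fobj G \<in> extensional (Obj C)"
    "farr F \<in> extensional (Arr C)" "farr G \<in> extensional (Arr C)"
    using assms(1,2) unfolding is_functor_def PiE_def by blast+
  then have "fobj F = fobj G" "farr F = farr G"
    using assms(3,4) by (auto intro: extensionalityI)
  then show ?thesis by simp
qed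

lemma is_functor_comp:
  assumes "category C" "is_functor C D F" "is_functor D E G"
  shows "is_functor C E (comp_functor C G F)"
proof (rule functorI)
  fix f g x y z assume f: "f \<in> hom C x y" and g: "g \<in> hom C y z"
  note fg = comp_hom[OF assms(1) f g]
  show "farr (comp_functor C G F) (g \<cdot>\<^bsub>C\<^esub> f) = farr (comp_functor C G F) g \<cdot>\<^bsub>E\<^esub> farr (comp_functor C G F) f"
    using f g fg functor_comp[OF assms(2) f g]
      functor_comp[OF assms(3) functor_hom[OF assms(2) f] functor_hom[OF assms(2) g]]
    by (simp add: comp_functor_def homD(1))
next
  fix f x y assume f: "f \<in> hom C x y"
  show "farr (comp_functor C G F) f \<in> hom E (fobj (comp_functor C G F) x) (fobj (comp_functor C G F) y)"
    using functor_hom[OF assms(3) functor_hom[OF assms(2) f]] hom_obj[OF assms(1) f] homD(1)[OF f]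
    by (simp add: comp_functor_def)
qed (use assms in \<open>auto simp: comp_functor_def functor_obj functor_id homD(1)[OF id_hom]\<close>)

lemma category_op: "category C \<Longrightarrow> category (op_cat C)"
  unfolding category_def op_cat_def hom_def by auto

lemma hom_op: "hom (op_cat C) x y = hom C y x"
  unfolding hom_def op_cat_def by auto

lemma op_simps [simp]:
  "Obj (op_cat C) = Obj C" "Arr (op_cat C) = Arr C" "Dom (op_cat C) = Cod C" "Cod (op_cat C) = Dom C"
  "Id (op_cat C) = Id C" "f \<cdot>\<^bsub>op_cat C\<^esub> g = g \<cdot>\<^bsub>C\<^esub> f"
  unfolding op_cat_def by simp_all

lemma prod_simps [simp]:
  "Obj (prod_cat C D) = Obj C \<times> Obj D" "Arr (prod_cat C D) = Arr C \<times> Arr D"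
  "Dom (prod_cat C D) (f, g) = (Dom C f, Dom D g)" "Cod (prod_cat C D) (f, g) = (Cod C f, Cod D g)"
  "Id (prod_cat C D) (x, y) = (Id C x, Id D y)"
  "(f, g) \<cdot>\<^bsub>prod_cat C D\<^esub> (f', g') = (f \<cdot>\<^bsub>C\<^esub> f', g \<cdot>\<^bsub>D\<^esub> g')"
  unfolding prod_cat_def by simp_all

lemma hom_prod: "hom (prod_cat C D) (x, x') (y, y') = hom C x y \<times> hom D x' y'"
  unfolding hom_def prod_cat_def by auto

lemma category_prod:
  assumes "category C" "category D"
  shows "category (prod_cat C D)"
proof (rule categoryI)
  show "\<And>f. f \<in> Arr (prod_cat C D) \<Longrightarrow>
      Dom (prod_cat C D) f \<in> Obj (prod_cat C D) \<and> Cod (prod_cat C D) f \<in> Obj (prod_cat C D)"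
    using assms by (auto simp: arr_obj)
  show "\<And>x. x \<in> Obj (prod_cat C D) \<Longrightarrow> Id (prod_cat C D) x \<in> hom (prod_cat C D) x x"
    using assms by (auto simp: id_hom hom_prod)
  show "\<And>f g x y z. f \<in> hom (prod_cat C D) x y \<Longrightarrow> g \<in> hom (prod_cat C D) y z \<Longrightarrow>
      g \<cdot>\<^bsub>prod_cat C D\<^esub> f \<in> hom (prod_cat C D) x z"
    using assms by (auto simp: hom_prod intro: comp_hom)
  show "\<And>f x y. f \<in> hom (prod_cat C D) x y \<Longrightarrow>
      f \<cdot>\<^bsub>prod_cat C D\<^esub> Id (prod_cat C D) x = f \<and> Id (prod_cat C D) y \<cdot>\<^bsub>prod_cat C D\<^esub> f = f"
    using assms by (auto simp: hom_prod intro: comp_id_left comp_id_right)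
  show "\<And>f g h w x y z. f \<in> hom (prod_cat C D) w x \<Longrightarrow> g \<in> hom (prod_cat C D) x y \<Longrightarrow>
      h \<in> hom (prod_cat C D) y z \<Longrightarrow>
      h \<cdot>\<^bsub>prod_cat C D\<^esub> (g \<cdot>\<^bsub>prod_cat C D\<^esub> f) = h \<cdot>\<^bsub>prod_cat C D\<^esub> g \<cdot>\<^bsub>prod_cat C D\<^esub> f"
    using assms by (auto simp: hom_prod intro: comp_assoc)
qed

lemma full_subcat_simps [simp]:
  "Obj (full_subcat C P) = {x \<in> Obj C. P x}"
  "Arr (full_subcat C P) = {f \<in> Arr C. P (Dom C f) \<and> P (Cod C f)}"
  "Dom (full_subcat C P) = Dom C" "Cod (full_subcat C P) = Cod C" "Id (full_subcat C P) = Id C"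
  "f \<cdot>\<^bsub>full_subcat C P\<^esub> g = f \<cdot>\<^bsub>C\<^esub> g"
  unfolding full_subcat_def by simp_all

lemma hom_full_subcat: "hom (full_subcat C P) x y = (if P x \<and> P y then hom C x y else {})"
  unfolding hom_def by auto

lemma category_full_subcat: "category C \<Longrightarrow> category (full_subcat C P)"
  unfolding category_def by (auto simp: hom_full_subcat hom_def)

section \<open>Natural transformations and categories of left adjoints\<close>

lemma functor_cat_simps [simp]:
  "Obj (functor_cat C D) = {F. is_functor C D F}" "Arr (functor_cat C D) = {\<tau>. is_ntrans C D \<tau>}"
  "Dom (functor_cat C D) = ntdom" "Cod (functor_cat C D) = ntcod"
  "Id (functor_cat C D) F = \<lparr>ntdom = F, ntcod = F, ntmap = (\<lambda>x \<in> Obj C. Id D (fobj F x))\<rparr>"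
  "\<tau> \<cdot>\<^bsub>functor_cat C D\<^esub> \<sigma> = \<lparr>ntdom = ntdom \<sigma>, ntcod = ntcod \<tau>,
     ntmap = (\<lambda>x \<in> Obj C. ntmap \<tau> x \<cdot>\<^bsub>D\<^esub> ntmap \<sigma> x)\<rparr>"
  unfolding functor_cat_def by simp_all

lemma hom_functor_cat: "hom (functor_cat C D) F G = {\<tau>. is_ntrans C D \<tau> \<and> ntdom \<tau> = F \<and> ntcod \<tau> = G}"
  by (auto simp: hom_def)

lemma ntrans_functor:
  assumes "\<tau> \<in> hom (functor_cat C D) F G"
  shows "is_functor C D F" "is_functor C D G"
  using assms by (auto simp: hom_functor_cat is_ntrans_def)

lemma ntrans_hom:
  "\<tau> \<in> hom (functor_cat C D) F G \<Longrightarrow> x \<in> Obj C \<Longrightarrow> ntmap \<tau> x \<in> hom D (fobj F x) (fobj G x)"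
  by (auto simp: hom_functor_cat is_ntrans_def)

lemma ntrans_nat:
  "\<tau> \<in> hom (functor_cat C D) F G \<Longrightarrow> f \<in> hom C x y \<Longrightarrow>
     ntmap \<tau> y \<cdot>\<^bsub>D\<^esub> farr F f = farr G f \<cdot>\<^bsub>D\<^esub> ntmap \<tau> x"
  by (auto simp: hom_functor_cat is_ntrans_def hom_def)

lemma ntransI:
  assumes "is_functor C D F" "is_functor C D G" "ntdom \<tau> = F" "ntcod \<tau> = G"
    and "ntmap \<tau> \<in> extensional (Obj C)"
    and "\<And>x. x \<in> Obj C \<Longrightarrow> ntmap \<tau> x \<in> hom D (fobj F x) (fobj G x)"
    and "\<And>f x y. f \<in> hom C x y \<Longrightarrow> ntmap \<tau> y \<cdot>\<^bsub>D\<^esub> farr F f = farr G f \<cdot>\<^bsub>D\<^esub> ntmap \<tau> x"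
  shows "\<tau> \<in> hom (functor_cat C D) F G"
  using assms arr_hom[of _ C] by (auto simp: hom_functor_cat is_ntrans_def)

lemma ntrans_eqI:
  assumes "\<tau> \<in> hom (functor_cat C D) F G" "\<sigma> \<in> hom (functor_cat C D) F G"
    and "\<And>x. x \<in> Obj C \<Longrightarrow> ntmap \<tau> x = ntmap \<sigma> x"
  shows "\<tau> = \<sigma>"
proof -
  have "ntmap \<tau> = ntmap \<sigma>"
    using assms by (intro extensionalityI[of _ "Obj C"]) (auto simp: hom_functor_cat is_ntrans_def)
  then show ?thesis using assms(1,2) by (simp add: hom_functor_cat)
qed

lemma functor_cat_id:
  assumes "category C" "category D" "is_functor C D F"
  shows "Id (functor_cat C D) F \<in> hom (functor_cat C D) F F"
proof (rule ntransI[OF assms(3,3)])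
  fix f x y assume f: "f \<in> hom C x y"
  then have "x \<in> Obj C \<and> y \<in> Obj C"
    using hom_obj[OF assms(1)] by blast
  then show "ntmap (Id (functor_cat C D) F) y \<cdot>\<^bsub>D\<^esub> farr F f = farr F f \<cdot>\<^bsub>D\<^esub> ntmap (Id (functor_cat C D) F) x"
    using comp_id_left[OF assms(2) functor_hom[OF assms(3) f]]
      comp_id_right[OF assms(2) functor_hom[OF assms(3) f]] by simp
qed (use assms in \<open>auto simp: functor_obj id_hom\<close>)

lemma functor_cat_comp:
  assumes "category C" "category D" "\<tau> \<in> hom (functor_cat C D) F G" "\<sigma> \<in> hom (functor_cat C D) G H"
  shows "\<sigma> \<cdot>\<^bsub>functor_cat C D\<^esub> \<tau> \<in> hom (functor_cat C D) F H"
proof (rule ntransI)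
  fix f x y assume f: "f \<in> hom C x y"
  note xy = hom_obj[OF assms(1) f]
  note F = functor_hom[OF ntrans_functor(1)[OF assms(3)] f]
    and G = functor_hom[OF ntrans_functor(1)[OF assms(4)] f]
    and H = functor_hom[OF ntrans_functor(2)[OF assms(4)] f]
  note t = ntrans_hom[OF assms(3) xy(1)] ntrans_hom[OF assms(3) xy(2)]
    and s = ntrans_hom[OF assms(4) xy(1)] ntrans_hom[OF assms(4) xy(2)]
  have "ntmap \<sigma> y \<cdot>\<^bsub>D\<^esub> ntmap \<tau> y \<cdot>\<^bsub>D\<^esub> farr F f = ntmap \<sigma> y \<cdot>\<^bsub>D\<^esub> (farr G f \<cdot>\<^bsub>D\<^esub> ntmap \<tau> x)"
    using comp_assoc[OF assms(2) F t(2) s(2)] ntrans_nat[OF assms(3) f] by simp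
  also have "\<dots> = farr H f \<cdot>\<^bsub>D\<^esub> ntmap \<sigma> x \<cdot>\<^bsub>D\<^esub> ntmap \<tau> x"
    using comp_assoc[OF assms(2) t(1) G s(2)] ntrans_nat[OF assms(4) f] by simp
  also have "\<dots> = farr H f \<cdot>\<^bsub>D\<^esub> (ntmap \<sigma> x \<cdot>\<^bsub>D\<^esub> ntmap \<tau> x)"
    using comp_assoc[OF assms(2) t(1) s(1) H] by simp
  finally show "ntmap (\<sigma> \<cdot>\<^bsub>functor_cat C D\<^esub> \<tau>) y \<cdot>\<^bsub>D\<^esub> farr F f = farr H f \<cdot>\<^bsub>D\<^esub> ntmap (\<sigma> \<cdot>\<^bsub>functor_cat C D\<^esub> \<tau>) x"
    using xy by simp
next
  fix x assume "x \<in> Obj C"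
  then show "ntmap (\<sigma> \<cdot>\<^bsub>functor_cat C D\<^esub> \<tau>) x \<in> hom D (fobj F x) (fobj H x)"
    using comp_hom[OF assms(2) ntrans_hom[OF assms(3)] ntrans_hom[OF assms(4)]] by simp
qed (use assms(3,4) in \<open>auto simp: hom_functor_cat is_ntrans_def\<close>)

lemma category_functor_cat:
  assumes C: "category C" and D: "category D"
  shows "category (functor_cat C D)"
proof (rule categoryI)
  show "\<And>f. f \<in> Arr (functor_cat C D) \<Longrightarrow>
      Dom (functor_cat C D) f \<in> Obj (functor_cat C D) \<and> Cod (functor_cat C D) f \<in> Obj (functor_cat C D)"
    by (simp add: is_ntrans_def)
  show "\<And>x. x \<in> Obj (functor_cat C D) \<Longrightarrow> Id (functor_cat C D) x \<in> hom (functor_cat C D) x x"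
    using functor_cat_id[OF C D] by (simp del: functor_cat_simps(5))
  show comp: "\<And>f g x y z. f \<in> hom (functor_cat C D) x y \<Longrightarrow> g \<in> hom (functor_cat C D) y z \<Longrightarrow>
      g \<cdot>\<^bsub>functor_cat C D\<^esub> f \<in> hom (functor_cat C D) x z"
    by (rule functor_cat_comp[OF C D])
  fix \<rho> W X assume r: "\<rho> \<in> hom (functor_cat C D) W X"
  have iW: "Id (functor_cat C D) W \<in> hom (functor_cat C D) W W"
    and iX: "Id (functor_cat C D) X \<in> hom (functor_cat C D) X X"
    using functor_cat_id[OF C D] ntrans_functor[OF r] by blast+
  show "\<rho> \<cdot>\<^bsub>functor_cat C D\<^esub> Id (functor_cat C D) W = \<rho> \<and> Id (functor_cat C D) X \<cdot>\<^bsub>functor_cat C D\<^esub> \<rho> = \<rho>"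
    using ntrans_eqI[OF comp[OF iW r] r] ntrans_eqI[OF comp[OF r iX] r]
      comp_id_left[OF D ntrans_hom[OF r]] comp_id_right[OF D ntrans_hom[OF r]] by simp
  fix \<sigma> \<tau> Y Z assume s: "\<sigma> \<in> hom (functor_cat C D) X Y" and t: "\<tau> \<in> hom (functor_cat C D) Y Z"
  show "\<tau> \<cdot>\<^bsub>functor_cat C D\<^esub> (\<sigma> \<cdot>\<^bsub>functor_cat C D\<^esub> \<rho>) = \<tau> \<cdot>\<^bsub>functor_cat C D\<^esub> \<sigma> \<cdot>\<^bsub>functor_cat C D\<^esub> \<rho>"
    by (rule ntrans_eqI[OF comp[OF comp[OF r s] t] comp[OF r comp[OF s t]]])
      (simp add: comp_assoc[OF D ntrans_hom[OF r] ntrans_hom[OF s] ntrans_hom[OF t]])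
qed

lemma LPr_simps [simp]:
  "Obj (LPr C D) = {F. left_adjoint C D F}"
  "Dom (LPr C D) = ntdom" "Cod (LPr C D) = ntcod" "Id (LPr C D) = Id (functor_cat C D)"
  "\<tau> \<cdot>\<^bsub>LPr C D\<^esub> \<sigma> = \<tau> \<cdot>\<^bsub>functor_cat C D\<^esub> \<sigma>"
  unfolding LPr_def by (auto simp: left_adjoint_def)

lemma category_LPr: "category C \<Longrightarrow> category D \<Longrightarrow> category (LPr C D)"
  unfolding LPr_def by (intro category_full_subcat category_functor_cat)

lemma hom_LPr:
  "\<tau> \<in> hom (LPr C D) F G \<longleftrightarrow> \<tau> \<in> hom (functor_cat C D) F G \<and> left_adjoint C D F \<and> left_adjoint C D G"
  unfolding LPr_def by (simp add: hom_full_subcat)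

lemma left_adjoint_functor: "left_adjoint C D F \<Longrightarrow> is_functor C D F"
  by (simp add: left_adjoint_def)

section \<open>Equivalences are the fully faithful, essentially surjective functors\<close>

definition fully_faithful :: "('o, 'a) cat \<Rightarrow> ('p, 'b) cat \<Rightarrow> ('o, 'a, 'p, 'b) fctr \<Rightarrow> bool" where
  "fully_faithful C D F \<longleftrightarrow>
     (\<forall>x \<in> Obj C. \<forall>y \<in> Obj C. bij_betw (farr F) (hom C x y) (hom D (fobj F x) (fobj F y)))"

definition essentially_surjective ::
    "('o, 'a) cat \<Rightarrow> ('p, 'b) cat \<Rightarrow> ('o, 'a, 'p, 'b) fctr \<Rightarrow> bool" where
  "essentially_surjective C D F \<longleftrightarrow>
     (\<forall>y \<in> Obj D. \<exists>x \<in> Obj C. \<exists>f \<in> hom D (fobj F x) y. iso D f)"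

lemma isoE:
  assumes "iso C f" "f \<in> hom C x y"
  obtains g where "g \<in> hom C y x" "g \<cdot>\<^bsub>C\<^esub> f = Id C x" "f \<cdot>\<^bsub>C\<^esub> g = Id C y"
  using assms by (auto simp: iso_def hom_def)

lemma isoI:
  "f \<in> hom C x y \<Longrightarrow> g \<in> hom C y x \<Longrightarrow> g \<cdot>\<^bsub>C\<^esub> f = Id C x \<Longrightarrow> f \<cdot>\<^bsub>C\<^esub> g = Id C y \<Longrightarrow> iso C f"
  by (auto simp: iso_def hom_def)

lemma iso_id: "category C \<Longrightarrow> x \<in> Obj C \<Longrightarrow> iso C (Id C x)"
  by (rule isoI[OF id_hom id_hom]) (auto intro: comp_id_left id_hom)

lemma iso_comp:
  assumes C: "category C" and f: "iso C f" "f \<in> hom C x y" and g: "iso C g" "g \<in> hom C y z"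
  shows "iso C (g \<cdot>\<^bsub>C\<^esub> f)"
proof -
  obtain f' where f': "f' \<in> hom C y x" "f' \<cdot>\<^bsub>C\<^esub> f = Id C x" "f \<cdot>\<^bsub>C\<^esub> f' = Id C y" using isoE[OF f] .
  obtain g' where g': "g' \<in> hom C z y" "g' \<cdot>\<^bsub>C\<^esub> g = Id C y" "g \<cdot>\<^bsub>C\<^esub> g' = Id C z" using isoE[OF g] .
  have "f' \<cdot>\<^bsub>C\<^esub> g' \<cdot>\<^bsub>C\<^esub> (g \<cdot>\<^bsub>C\<^esub> f) = f' \<cdot>\<^bsub>C\<^esub> (g' \<cdot>\<^bsub>C\<^esub> g) \<cdot>\<^bsub>C\<^esub> f"
    using comp_assoc[OF C f(2) g(2) comp_hom[OF C g'(1) f'(1)]] comp_assoc[OF C g(2) g'(1) f'(1)] by simp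
  then have 1: "f' \<cdot>\<^bsub>C\<^esub> g' \<cdot>\<^bsub>C\<^esub> (g \<cdot>\<^bsub>C\<^esub> f) = Id C x"
    using f'(1,2) g'(2) comp_id_right[OF C f'(1)] by simp
  have "g \<cdot>\<^bsub>C\<^esub> f \<cdot>\<^bsub>C\<^esub> (f' \<cdot>\<^bsub>C\<^esub> g') = g \<cdot>\<^bsub>C\<^esub> (f \<cdot>\<^bsub>C\<^esub> f') \<cdot>\<^bsub>C\<^esub> g'"
    using comp_assoc[OF C g'(1) f'(1) comp_hom[OF C f(2) g(2)]] comp_assoc[OF C f'(1) f(2) g(2)] by simp
  then have 2: "g \<cdot>\<^bsub>C\<^esub> f \<cdot>\<^bsub>C\<^esub> (f' \<cdot>\<^bsub>C\<^esub> g') = Id C z"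
    using f'(3) g'(3) comp_id_right[OF C g(2)] by simp
  show ?thesis
    by (rule isoI[OF comp_hom[OF C f(2) g(2)] comp_hom[OF C g'(1) f'(1)] 1 2])
qed

lemma functor_iso:
  assumes "category C" "is_functor C D F" "iso C f" "f \<in> hom C x y"
  shows "iso D (farr F f)"
proof -
  obtain g where g: "g \<in> hom C y x" "g \<cdot>\<^bsub>C\<^esub> f = Id C x" "f \<cdot>\<^bsub>C\<^esub> g = Id C y" using isoE[OF assms(3,4)] .
  show ?thesis
  proof (rule isoI[OF functor_hom[OF assms(2,4)] functor_hom[OF assms(2) g(1)]])
    show "farr F g \<cdot>\<^bsub>D\<^esub> farr F f = Id D (fobj F x)"
      using functor_comp[OF assms(2,4) g(1)] g(2) functor_id[OF assms(2) hom_obj(1)[OF assms(1,4)]] by simp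
    show "farr F f \<cdot>\<^bsub>D\<^esub> farr F g = Id D (fobj F y)"
      using functor_comp[OF assms(2) g(1) assms(4)] g(3) functor_id[OF assms(2) hom_obj(2)[OF assms(1,4)]] by simp
  qed
qed

lemma iso_cancel_left:
  assumes C: "category C" and f: "iso C f" "f \<in> hom C x y"
    and u: "u \<in> hom C w x" and v: "v \<in> hom C w x" and "f \<cdot>\<^bsub>C\<^esub> u = f \<cdot>\<^bsub>C\<^esub> v"
  shows "u = v"
proof -
  obtain g where g: "g \<in> hom C y x" "g \<cdot>\<^bsub>C\<^esub> f = Id C x" using isoE[OF f] by metis
  have "g \<cdot>\<^bsub>C\<^esub> (f \<cdot>\<^bsub>C\<^esub> u) = u" "g \<cdot>\<^bsub>C\<^esub> (f \<cdot>\<^bsub>C\<^esub> v) = v"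
    using comp_assoc[OF C u f(2) g(1)] comp_assoc[OF C v f(2) g(1)] g(2)
      comp_id_left[OF C u] comp_id_left[OF C v] by simp_all
  then show ?thesis using assms(6) by metis
qed

lemma iso_cancel_right:
  assumes C: "category C" and f: "iso C f" "f \<in> hom C x y"
    and u: "u \<in> hom C y z" and v: "v \<in> hom C y z" and "u \<cdot>\<^bsub>C\<^esub> f = v \<cdot>\<^bsub>C\<^esub> f"
  shows "u = v"
proof -
  obtain g where g: "g \<in> hom C y x" "f \<cdot>\<^bsub>C\<^esub> g = Id C y" using isoE[OF f] by metis
  have "u \<cdot>\<^bsub>C\<^esub> f \<cdot>\<^bsub>C\<^esub> g = u" "v \<cdot>\<^bsub>C\<^esub> f \<cdot>\<^bsub>C\<^esub> g = v"
    using comp_assoc[OF C g(1) f(2) u] comp_assoc[OF C g(1) f(2) v] g(2)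
      comp_id_right[OF C u] comp_id_right[OF C v] by simp_all
  then show ?thesis using assms(6) by metis
qed

lemma fully_faithful_inj:
  "fully_faithful C D F \<Longrightarrow> category C \<Longrightarrow> u \<in> hom C x y \<Longrightarrow> v \<in> hom C x y \<Longrightarrow> farr F u = farr F v \<Longrightarrow> u = v"
  unfolding fully_faithful_def bij_betw_def inj_on_def by (metis hom_obj)

lemma fully_faithful_surj:
  assumes "fully_faithful C D F" "x \<in> Obj C" "y \<in> Obj C" "h \<in> hom D (fobj F x) (fobj F y)"
  obtains u where "u \<in> hom C x y" "farr F u = h"
proof -
  have "h \<in> farr F ` hom C x y"
    using assms unfolding fully_faithful_def bij_betw_def by simp
  then show thesis using that by auto
qed

lemma fully_faithful_reflects_iso:
  assumes C: "category C" and F: "is_functor C D F" "fully_faithful C D F"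
    and u: "u \<in> hom C x y" and "iso D (farr F u)"
  shows "iso C u"
proof -
  obtain g where g: "g \<in> hom D (fobj F y) (fobj F x)" "g \<cdot>\<^bsub>D\<^esub> farr F u = Id D (fobj F x)"
      "farr F u \<cdot>\<^bsub>D\<^esub> g = Id D (fobj F y)"
    using isoE[OF assms(5) functor_hom[OF F(1) u]] .
  note xy = hom_obj[OF C u]
  obtain v where v: "v \<in> hom C y x" "farr F v = g"
    using fully_faithful_surj[OF F(2) xy(2,1) g(1)] .
  have "farr F (v \<cdot>\<^bsub>C\<^esub> u) = farr F (Id C x)" "farr F (u \<cdot>\<^bsub>C\<^esub> v) = farr F (Id C y)"
    using functor_comp[OF F(1) u v(1)] functor_comp[OF F(1) v(1) u] functor_id[OF F(1)] xy g v(2) by auto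
  then show ?thesis
    using fully_faithful_inj[OF F(2) C comp_hom[OF C u v(1)] id_hom[OF C xy(1)]]
      fully_faithful_inj[OF F(2) C comp_hom[OF C v(1) u] id_hom[OF C xy(2)]]
    by (intro isoI[OF u v(1)])
qed

lemma natural_iso_to_identity:
  assumes "naturally_isomorphic C C (comp_functor C G F) (id_functor C)" "category C" "is_functor C D F"
  obtains \<eta> where "\<And>x. x \<in> Obj C \<Longrightarrow> \<eta> x \<in> hom C (fobj G (fobj F x)) x"
    "\<And>x. x \<in> Obj C \<Longrightarrow> iso C (\<eta> x)"
    "\<And>f x y. f \<in> hom C x y \<Longrightarrow> \<eta> y \<cdot>\<^bsub>C\<^esub> farr G (farr F f) = f \<cdot>\<^bsub>C\<^esub> \<eta> x"
proof -
  obtain \<tau> where t: "is_ntrans C C \<tau>" "ntdom \<tau> = comp_functor C G F" "ntcod \<tau> = id_functor C"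
    "\<forall>x \<in> Obj C. iso C (ntmap \<tau> x)"
    using assms(1) by (auto simp: naturally_isomorphic_def)
  have h: "\<tau> \<in> hom (functor_cat C C) (comp_functor C G F) (id_functor C)"
    using t by (simp add: hom_functor_cat)
  show thesis
  proof
    show "ntmap \<tau> x \<in> hom C (fobj G (fobj F x)) x" if "x \<in> Obj C" for x
      using ntrans_hom[OF h that] that by (simp add: comp_functor_def id_functor_def)
    show "iso C (ntmap \<tau> x)" if "x \<in> Obj C" for x using t(4) that by blast
    show "ntmap \<tau> y \<cdot>\<^bsub>C\<^esub> farr G (farr F f) = f \<cdot>\<^bsub>C\<^esub> ntmap \<tau> x" if "f \<in> hom C x y" for f x y
      using ntrans_nat[OF h that] homD(1)[OF that] by (simp add: comp_functor_def id_functor_def)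
  qed
qed

text \<open>An arrow \<open>u\<close> is recovered from \<open>F u\<close> by conjugating \<open>G (F u)\<close> with the isomorphisms \<open>G F x \<cong> x\<close>.\<close>

lemma faithful_if_left_inverse:
  assumes "naturally_isomorphic C C (comp_functor C G F) (id_functor C)" "category C" "is_functor C D F"
    and u: "u \<in> hom C x y" and v: "v \<in> hom C x y" and eq: "farr F u = farr F v"
  shows "u = v"
proof -
  obtain \<eta> where e: "\<And>x. x \<in> Obj C \<Longrightarrow> \<eta> x \<in> hom C (fobj G (fobj F x)) x"
    "\<And>x. x \<in> Obj C \<Longrightarrow> iso C (\<eta> x)"
    "\<And>f x y. f \<in> hom C x y \<Longrightarrow> \<eta> y \<cdot>\<^bsub>C\<^esub> farr G (farr F f) = f \<cdot>\<^bsub>C\<^esub> \<eta> x"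
    using natural_iso_to_identity[OF assms(1-3)] by metis
  have "u \<cdot>\<^bsub>C\<^esub> \<eta> x = v \<cdot>\<^bsub>C\<^esub> \<eta> x" using e(3)[OF u] e(3)[OF v] eq by simp
  then show ?thesis
    using iso_cancel_right[OF assms(2) e(2) e(1) u v] hom_obj[OF assms(2) u] by blast
qed

text \<open>Fullness uses that both \<open>F\<close> and its quasi-inverse \<open>G\<close> are faithful: conjugating \<open>G h\<close> with \<open>G F \<cong> id\<close> gives an
  arrow whose image under \<open>F\<close> agrees with \<open>h\<close> after applying \<open>G\<close>.\<close>

lemma equivalence_imp_fully_faithful:
  assumes "equivalence C D F"
  shows "fully_faithful C D F" "essentially_surjective C D F"
proof -
  obtain G where C: "category C" and D: "category D" and F: "is_functor C D F" and G: "is_functor D C G"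
    and nC: "naturally_isomorphic C C (comp_functor C G F) (id_functor C)"
    and nD: "naturally_isomorphic D D (comp_functor D F G) (id_functor D)"
    using assms by (auto simp: equivalence_def)
  obtain \<eta> where e: "\<And>x. x \<in> Obj C \<Longrightarrow> \<eta> x \<in> hom C (fobj G (fobj F x)) x"
    "\<And>x. x \<in> Obj C \<Longrightarrow> iso C (\<eta> x)"
    "\<And>f x y. f \<in> hom C x y \<Longrightarrow> \<eta> y \<cdot>\<^bsub>C\<^esub> farr G (farr F f) = f \<cdot>\<^bsub>C\<^esub> \<eta> x"
    using natural_iso_to_identity[OF nC C F] by metis
  obtain \<epsilon> where d: "\<And>y. y \<in> Obj D \<Longrightarrow> \<epsilon> y \<in> hom D (fobj F (fobj G y)) y"
    "\<And>y. y \<in> Obj D \<Longrightarrow> iso D (\<epsilon> y)"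
    using natural_iso_to_identity[OF nD D G] by metis
  show "essentially_surjective C D F"
    unfolding essentially_surjective_def using d functor_obj[OF G] by blast
  show "fully_faithful C D F"
    unfolding fully_faithful_def bij_betw_def
  proof (intro ballI conjI)
    fix x y assume x: "x \<in> Obj C" and y: "y \<in> Obj C"
    show "inj_on (farr F) (hom C x y)"
      using faithful_if_left_inverse[OF nC C F] by (auto simp: inj_on_def)
    show "farr F ` hom C x y = hom D (fobj F x) (fobj F y)"
    proof
      show "farr F ` hom C x y \<subseteq> hom D (fobj F x) (fobj F y)" using functor_hom[OF F] by blast
      show "hom D (fobj F x) (fobj F y) \<subseteq> farr F ` hom C x y"
      proof
        fix h assume h: "h \<in> hom D (fobj F x) (fobj F y)"
        note Gh = functor_hom[OF G h]
        obtain e' where e': "e' \<in> hom C x (fobj G (fobj F x))" "e' \<cdot>\<^bsub>C\<^esub> \<eta> x = Id C (fobj G (fobj F x))"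
          using isoE[OF e(2) e(1), OF x x] by metis
        \<comment> \<open>The preimage of \<open>h\<close> under \<open>F\<close>.\<close>
        define f where "f = \<eta> y \<cdot>\<^bsub>C\<^esub> farr G h \<cdot>\<^bsub>C\<^esub> e'"
        have f: "f \<in> hom C x y"
          unfolding f_def using comp_hom[OF C e'(1) comp_hom[OF C Gh e(1)[OF y]]] .
        have "\<eta> y \<cdot>\<^bsub>C\<^esub> farr G (farr F f) = \<eta> y \<cdot>\<^bsub>C\<^esub> farr G h \<cdot>\<^bsub>C\<^esub> e' \<cdot>\<^bsub>C\<^esub> \<eta> x"
          using e(3)[OF f] unfolding f_def .
        also have "\<dots> = \<eta> y \<cdot>\<^bsub>C\<^esub> farr G h"
          using comp_assoc[OF C e(1)[OF x] e'(1) comp_hom[OF C Gh e(1)[OF y]]] e'(2)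
            comp_id_right[OF C comp_hom[OF C Gh e(1)[OF y]]] by simp
        finally have "farr G (farr F f) = farr G h"
          using iso_cancel_left[OF C e(2)[OF y] e(1)[OF y] functor_hom[OF G functor_hom[OF F f]] Gh] by blast
        then have "farr F f = h"
          using faithful_if_left_inverse[OF nD D G functor_hom[OF F f] h] by blast
        then show "h \<in> farr F ` hom C x y" using f by blast
      qed
    qed
  qed
qed

text \<open>The quasi-inverse picks preimages of objects up to isomorphism. Its action on arrows, and the
  second natural isomorphism, are obtained by lifting along \<open>F\<close>, and all equations between lifts hold
  because \<open>F\<close> reflects them.\<close>

lemma equivalenceI:
  assumes C: "category C" and D: "category D" and F: "is_functor C D F"
    and ff: "fully_faithful C D F" and es: "essentially_surjective C D F"
  shows "equivalence C D F"
proof -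
  obtain r \<epsilon> where r: "\<And>y. y \<in> Obj D \<Longrightarrow> r y \<in> Obj C"
    and e: "\<And>y. y \<in> Obj D \<Longrightarrow> \<epsilon> y \<in> hom D (fobj F (r y)) y"
    and ei: "\<And>y. y \<in> Obj D \<Longrightarrow> iso D (\<epsilon> y)"
    using es unfolding essentially_surjective_def by metis
  have lift: "\<exists>u. u \<in> hom C x (r y) \<and> \<epsilon> y \<cdot>\<^bsub>D\<^esub> farr F u = h"
    if x: "x \<in> Obj C" and y: "y \<in> Obj D" and h: "h \<in> hom D (fobj F x) y" for x y h
  proof -
    obtain e' where e': "e' \<in> hom D y (fobj F (r y))" "\<epsilon> y \<cdot>\<^bsub>D\<^esub> e' = Id D y"
      using isoE[OF ei[OF y] e[OF y]] by metis
    obtain u where "u \<in> hom C x (r y)" "farr F u = e' \<cdot>\<^bsub>D\<^esub> h"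
      using fully_faithful_surj[OF ff x r[OF y] comp_hom[OF D h e'(1)]] .
    then show ?thesis
      using comp_assoc[OF D h e'(1) e[OF y]] e'(2) comp_id_left[OF D h] by metis
  qed
  have unique: "u = v" if "y \<in> Obj D" "u \<in> hom C x (r y)" "v \<in> hom C x (r y)"
    "\<epsilon> y \<cdot>\<^bsub>D\<^esub> farr F u = \<epsilon> y \<cdot>\<^bsub>D\<^esub> farr F v" for x y u v
    using fully_faithful_inj[OF ff C that(2,3)]
      iso_cancel_left[OF D ei[OF that(1)] e[OF that(1)] functor_hom[OF F that(2)] functor_hom[OF F that(3)] that(4)]
    by blast
  define g where "g k = (SOME u. u \<in> hom C (r (Dom D k)) (r (Cod D k)) \<and>
    \<epsilon> (Cod D k) \<cdot>\<^bsub>D\<^esub> farr F u = k \<cdot>\<^bsub>D\<^esub> \<epsilon> (Dom D k))" for k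
  have g: "g k \<in> hom C (r y) (r z)" "\<epsilon> z \<cdot>\<^bsub>D\<^esub> farr F (g k) = k \<cdot>\<^bsub>D\<^esub> \<epsilon> y" if k: "k \<in> hom D y z" for k y z
  proof -
    note yz = hom_obj[OF D k]
    have "\<exists>u. u \<in> hom C (r y) (r z) \<and> \<epsilon> z \<cdot>\<^bsub>D\<^esub> farr F u = k \<cdot>\<^bsub>D\<^esub> \<epsilon> y"
      using lift[OF r[OF yz(1)] yz(2) comp_hom[OF D e[OF yz(1)] k]] .
    from someI_ex[OF this] show "g k \<in> hom C (r y) (r z)" "\<epsilon> z \<cdot>\<^bsub>D\<^esub> farr F (g k) = k \<cdot>\<^bsub>D\<^esub> \<epsilon> y"
      using homD(2,3)[OF k] by (simp_all add: g_def)
  qed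
  define G where "G = \<lparr>fobj = restrict r (Obj D), farr = restrict g (Arr D)\<rparr>"
  have G: "is_functor D C G"
  proof (rule functorI)
    fix y assume y: "y \<in> Obj D"
    note i = id_hom[OF D y]
    have "g (Id D y) = Id C (r y)"
      using unique[OF y g(1)[OF i] id_hom[OF C r[OF y]]] g(2)[OF i]
        comp_id_left[OF D e[OF y]] comp_id_right[OF D e[OF y]] functor_id[OF F r[OF y]] by simp
    then show "farr G (Id D y) = Id C (fobj G y)" using homD(1)[OF i] y by (simp add: G_def)
  next
    fix k l x y z assume k: "k \<in> hom D x y" and l: "l \<in> hom D y z"
    note kl = comp_hom[OF D k l] and x = hom_obj[OF D k] and z = hom_obj[OF D l]
    note gk = functor_hom[OF F g(1)[OF k]] and gl = functor_hom[OF F g(1)[OF l]]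
    have "\<epsilon> z \<cdot>\<^bsub>D\<^esub> farr F (g l \<cdot>\<^bsub>C\<^esub> g k) = \<epsilon> z \<cdot>\<^bsub>D\<^esub> farr F (g l) \<cdot>\<^bsub>D\<^esub> farr F (g k)"
      using functor_comp[OF F g(1)[OF k] g(1)[OF l]] comp_assoc[OF D gk gl e[OF z(2)]] by simp
    also have "\<dots> = l \<cdot>\<^bsub>D\<^esub> (k \<cdot>\<^bsub>D\<^esub> \<epsilon> x)"
      using g(2)[OF l] comp_assoc[OF D gk e[OF x(2)] l] g(2)[OF k] by simp
    also have "\<dots> = \<epsilon> z \<cdot>\<^bsub>D\<^esub> farr F (g (l \<cdot>\<^bsub>D\<^esub> k))"
      using g(2)[OF kl] comp_assoc[OF D e[OF x(1)] k l] by simp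
    finally have "g (l \<cdot>\<^bsub>D\<^esub> k) = g l \<cdot>\<^bsub>C\<^esub> g k"
      using unique[OF z(2) g(1)[OF kl] comp_hom[OF C g(1)[OF k] g(1)[OF l]]] by simp
    then show "farr G (l \<cdot>\<^bsub>D\<^esub> k) = farr G l \<cdot>\<^bsub>C\<^esub> farr G k"
      using homD(1)[OF k] homD(1)[OF l] homD(1)[OF kl] by (simp add: G_def)
  next
    fix k x y assume k: "k \<in> hom D x y"
    then show "farr G k \<in> hom C (fobj G x) (fobj G y)"
      using g(1)[OF k] homD(1)[OF k] hom_obj[OF D k] by (simp add: G_def)
  qed (auto simp: G_def r)
  have GF: "is_functor C C (comp_functor C G F)" using is_functor_comp[OF C F G] .
  have FG: "is_functor D D (comp_functor D F G)" using is_functor_comp[OF D G F] .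
  have idf: "is_functor A A (id_functor A)" if "category A" for A :: "('x, 'y) cat"
    by (rule functorI) (use that in \<open>auto simp: id_functor_def homD(1) hom_obj[OF that] homD(1)[OF comp_hom[OF that]] homD(1)[OF id_hom]\<close>)
  have "\<lparr>ntdom = comp_functor D F G, ntcod = id_functor D, ntmap = restrict \<epsilon> (Obj D)\<rparr>
      \<in> hom (functor_cat D D) (comp_functor D F G) (id_functor D)"
  proof (rule ntransI[OF FG idf[OF D]])
    fix k x y assume k: "k \<in> hom D x y"
    show "ntmap \<lparr>ntdom = comp_functor D F G, ntcod = id_functor D, ntmap = restrict \<epsilon> (Obj D)\<rparr> y \<cdot>\<^bsub>D\<^esub> farr (comp_functor D F G) k =
      farr (id_functor D) k \<cdot>\<^bsub>D\<^esub> ntmap \<lparr>ntdom = comp_functor D F G, ntcod = id_functor D, ntmap = restrict \<epsilon> (Obj D)\<rparr> x"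
      using hom_obj[OF D k] homD(1)[OF k] g(2)[OF k] by (simp add: comp_functor_def id_functor_def G_def)
  qed (use e in \<open>auto simp: comp_functor_def id_functor_def G_def\<close>)
  then have nD: "naturally_isomorphic D D (comp_functor D F G) (id_functor D)"
    unfolding naturally_isomorphic_def hom_functor_cat using ei by fastforce
  have "\<exists>u. u \<in> hom C (r (fobj F x)) x \<and> farr F u = \<epsilon> (fobj F x)" if x: "x \<in> Obj C" for x
    using fully_faithful_surj[OF ff r x e] functor_obj[OF F x] by metis
  then obtain \<eta> where h: "\<And>x. x \<in> Obj C \<Longrightarrow> \<eta> x \<in> hom C (r (fobj F x)) x"
      "\<And>x. x \<in> Obj C \<Longrightarrow> farr F (\<eta> x) = \<epsilon> (fobj F x)"
    by metis
  have hi: "iso C (\<eta> x)" if "x \<in> Obj C" for x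
    using fully_faithful_reflects_iso[OF C F ff h(1)[OF that]] h(2)[OF that] ei functor_obj[OF F that] by simp
  have "\<lparr>ntdom = comp_functor C G F, ntcod = id_functor C, ntmap = restrict \<eta> (Obj C)\<rparr>
      \<in> hom (functor_cat C C) (comp_functor C G F) (id_functor C)"
  proof (rule ntransI[OF GF idf[OF C]])
    fix k x y assume k: "k \<in> hom C x y"
    note xy = hom_obj[OF C k] and Fk = functor_hom[OF F k]
    have "farr F (\<eta> y \<cdot>\<^bsub>C\<^esub> g (farr F k)) = farr F (k \<cdot>\<^bsub>C\<^esub> \<eta> x)"
      using functor_comp[OF F g(1)[OF Fk] h(1)[OF xy(2)]] functor_comp[OF F h(1)[OF xy(1)] k]
        h(2)[OF xy(1)] h(2)[OF xy(2)] g(2)[OF Fk] by simp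
    then have "\<eta> y \<cdot>\<^bsub>C\<^esub> g (farr F k) = k \<cdot>\<^bsub>C\<^esub> \<eta> x"
      using fully_faithful_inj[OF ff C comp_hom[OF C g(1)[OF Fk] h(1)[OF xy(2)]] comp_hom[OF C h(1)[OF xy(1)] k]]
      by blast
    then show "ntmap \<lparr>ntdom = comp_functor C G F, ntcod = id_functor C, ntmap = restrict \<eta> (Obj C)\<rparr> y \<cdot>\<^bsub>C\<^esub> farr (comp_functor C G F) k =
      farr (id_functor C) k \<cdot>\<^bsub>C\<^esub> ntmap \<lparr>ntdom = comp_functor C G F, ntcod = id_functor C, ntmap = restrict \<eta> (Obj C)\<rparr> x"
      using xy homD(1)[OF k] homD(1)[OF Fk] by (simp add: comp_functor_def id_functor_def G_def)
  qed (use h functor_obj[OF F] in \<open>auto simp: comp_functor_def id_functor_def G_def\<close>)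
  then have nC: "naturally_isomorphic C C (comp_functor C G F) (id_functor C)"
    unfolding naturally_isomorphic_def hom_functor_cat using hi by fastforce
  show ?thesis unfolding equivalence_def using C D F G nC nD by blast
qed

lemma equivalence_comp:
  assumes F: "equivalence C D F" and G: "equivalence D E G"
  shows "equivalence C E (comp_functor C G F)"
proof (rule equivalenceI)
  have f: "category C" "is_functor C D F" and g: "category D" "category E" "is_functor D E G"
    using F G by (auto simp: equivalence_def)
  show "category C" "category E" by fact+
  show "is_functor C E (comp_functor C G F)" using is_functor_comp f g by metis
  note F' = equivalence_imp_fully_faithful[OF F] and G' = equivalence_imp_fully_faithful[OF G]
  show "fully_faithful C E (comp_functor C G F)"
    unfolding fully_faithful_def
  proof (intro ballI)
    fix x y assume xy: "x \<in> Obj C" "y \<in> Obj C"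
    have "bij_betw (farr G \<circ> farr F) (hom C x y) (hom E (fobj G (fobj F x)) (fobj G (fobj F y)))"
      using F'(1) G'(1) xy functor_obj[OF f(2)] unfolding fully_faithful_def
      by (intro bij_betw_trans) auto
    then show "bij_betw (farr (comp_functor C G F)) (hom C x y)
        (hom E (fobj (comp_functor C G F) x) (fobj (comp_functor C G F) y))"
      using xy by (subst bij_betw_cong[of _ _ "farr G \<circ> farr F"]) (auto simp: comp_functor_def homD(1))
  qed
  show "essentially_surjective C E (comp_functor C G F)"
    unfolding essentially_surjective_def
  proof
    fix z assume "z \<in> Obj E"
    then obtain y l where y: "y \<in> Obj D" and l: "l \<in> hom E (fobj G y) z" "iso E l"
      using G'(2) unfolding essentially_surjective_def by blast
    obtain x k where x: "x \<in> Obj C" and k: "k \<in> hom D (fobj F x) y" "iso D k"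
      using F'(2) y unfolding essentially_surjective_def by blast
    note Gk = functor_hom[OF g(3) k(1)]
    show "\<exists>x\<in>Obj C. \<exists>f\<in>hom E (fobj (comp_functor C G F) x) z. iso E f"
      using x comp_hom[OF g(2) Gk l(1)] iso_comp[OF g(2) functor_iso[OF g(1,3) k(2,1)] Gk l(2,1)]
      by (auto simp: comp_functor_def)
  qed
qed

lemma iso_full_subcat:
  assumes "P (Dom C f)" "P (Cod C f)"
  shows "iso (full_subcat C P) f \<longleftrightarrow> iso C f"
  using assms by (auto simp: iso_def hom_full_subcat)

text \<open>Essential surjectivity is where closure under isomorphism enters: an object with \<open>Q\<close> is isomorphic
  to some \<open>F x\<close>, which then has \<open>Q\<close> too, so that \<open>x\<close> has \<open>P\<close>.\<close>

lemma equivalence_restrict: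
  assumes F: "equivalence C D F"
    and PQ: "\<And>x. x \<in> Obj C \<Longrightarrow> P x \<longleftrightarrow> Q (fobj F x)"
    and iso_closed: "\<And>x y f. x \<in> Obj C \<Longrightarrow> f \<in> hom D (fobj F x) y \<Longrightarrow> iso D f \<Longrightarrow> Q y \<Longrightarrow> Q (fobj F x)"
  shows "equivalence (full_subcat C P) (full_subcat D Q) (restrict_functor (full_subcat C P) F)"
proof -
  have C: "category C" and D: "category D" and f: "is_functor C D F" using F by (auto simp: equivalence_def)
  note F' = equivalence_imp_fully_faithful[OF F]
  let ?C = "full_subcat C P" and ?D = "full_subcat D Q" and ?F = "restrict_functor (full_subcat C P) F"
  have o: "fobj ?F x = fobj F x" if "x \<in> Obj ?C" for x
    using that by (simp add: restrict_functor_def)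
  have a: "farr ?F u = farr F u" if "u \<in> hom ?C x y" for u x y
    using homD(1)[OF that] by (simp add: restrict_functor_def)
  show ?thesis
  proof (rule equivalenceI)
    show C': "category ?C" and "category ?D" using C D by (auto intro: category_full_subcat)
    show "is_functor ?C ?D ?F"
    proof (rule functorI)
      fix u x y assume u: "u \<in> hom ?C x y"
      have "u \<in> hom C x y" using u by (auto simp: hom_full_subcat split: if_splits)
      then show "farr ?F u \<in> hom ?D (fobj ?F x) (fobj ?F y)"
        using a[OF u] o hom_obj[OF C' u] functor_hom[OF f] PQ by (auto simp: hom_full_subcat)
    next
      fix u v x y z assume u: "u \<in> hom ?C x y" and v: "v \<in> hom ?C y z"
      have "u \<in> hom C x y" "v \<in> hom C y z" using u v by (auto simp: hom_full_subcat split: if_splits)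
      then show "farr ?F (v \<cdot>\<^bsub>?C\<^esub> u) = farr ?F v \<cdot>\<^bsub>?D\<^esub> farr ?F u"
        using a[OF u] a[OF v] a[OF comp_hom[OF C' u v]] functor_comp[OF f] by simp
    next
      fix x assume x: "x \<in> Obj ?C"
      then show "farr ?F (Id ?C x) = Id ?D (fobj ?F x)"
        using a[OF id_hom[OF C' x]] o[OF x] functor_id[OF f] by simp
    qed (use PQ functor_obj[OF f] in \<open>auto simp: restrict_functor_def\<close>)
    show "fully_faithful ?C ?D ?F"
      unfolding fully_faithful_def
    proof (intro ballI)
      fix x y assume x: "x \<in> Obj ?C" and y: "y \<in> Obj ?C"
      have "bij_betw (farr F) (hom C x y) (hom D (fobj F x) (fobj F y))"
        using F'(1) x y unfolding fully_faithful_def by simp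
      then have "bij_betw (farr F) (hom ?C x y) (hom ?D (fobj F x) (fobj F y))"
        using x y PQ[of x] PQ[of y] by (simp add: hom_full_subcat)
      then show "bij_betw (farr ?F) (hom ?C x y) (hom ?D (fobj ?F x) (fobj ?F y))"
        using o[OF x] o[OF y] a by (subst bij_betw_cong[of _ _ "farr F"]) auto
    qed
    show "essentially_surjective ?C ?D ?F"
      unfolding essentially_surjective_def
    proof
      fix y assume y: "y \<in> Obj ?D"
      then obtain x k where x: "x \<in> Obj C" and k: "k \<in> hom D (fobj F x) y" "iso D k"
        using F'(2) unfolding essentially_surjective_def by auto
      have q: "Q (fobj F x)" "Q y" using iso_closed[OF x k] y by auto
      then have "x \<in> Obj ?C" using PQ x by simp
      moreover have "k \<in> hom ?D (fobj ?F x) y"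
        using k(1) q o[OF \<open>x \<in> Obj ?C\<close>] by (simp add: hom_full_subcat)
      moreover have "iso ?D k" using k q homD[OF k(1)] by (simp add: iso_full_subcat)
      ultimately show "\<exists>x\<in>Obj ?C. \<exists>f\<in>hom ?D (fobj ?F x) y. iso ?D f" by blast
    qed
  qed
qed

section \<open>Adjunctions as pointwise representability\<close>

text \<open>The common core of all constructions of right adjoints below. If the sets \<open>W a p\<close>, on which the arrows
  of \<open>A\<close> act contravariantly and those of \<open>P\<close> covariantly, are representable for each \<open>p\<close> separately,
  then uniqueness of the representing arrows forces the representing objects to be functorial in \<open>p\<close>.
  The case \<open>P = D\<close> gives right adjoints of functors to \<open>D\<close>, the case \<open>P = B\<^sup>o\<^sup>p \<times> D\<close> gives right
  adjoints with a parameter in \<open>B\<close>.\<close>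

lemma representing_functor:
  fixes A :: "('o, 'a) cat" and P :: "('p, 'b) cat"
    and W :: "'o \<Rightarrow> 'p \<Rightarrow> 'w set" and act :: "'a \<Rightarrow> 'b \<Rightarrow> 'w \<Rightarrow> 'w"
  assumes A: "category A" and P: "category P"
    and act: "\<And>f k a a' p p' w. f \<in> hom A a' a \<Longrightarrow> k \<in> hom P p p' \<Longrightarrow> w \<in> W a p \<Longrightarrow> act f k w \<in> W a' p'"
    and act_comp: "\<And>f f' k k' a a' a'' p p' p'' w. f \<in> hom A a' a \<Longrightarrow> f' \<in> hom A a'' a' \<Longrightarrow>
        k \<in> hom P p p' \<Longrightarrow> k' \<in> hom P p' p'' \<Longrightarrow> w \<in> W a p \<Longrightarrow>
        act (f \<cdot>\<^bsub>A\<^esub> f') (k' \<cdot>\<^bsub>P\<^esub> k) w = act f' k' (act f k w)"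
    and rep: "\<And>p. p \<in> Obj P \<Longrightarrow> \<exists>r \<in> Obj A. \<exists>e \<in> W r p. \<forall>a \<in> Obj A. \<forall>w \<in> W a p.
        \<exists>!u. u \<in> hom A a r \<and> act u (Id P p) e = w"
  shows "\<exists>G \<phi>. is_functor P A G \<and>
     (\<forall>a \<in> Obj A. \<forall>p \<in> Obj P. bij_betw (\<phi> a p) (W a p) (hom A a (fobj G p))) \<and>
     (\<forall>f \<in> Arr A. \<forall>k \<in> Arr P. \<forall>w \<in> W (Cod A f) (Dom P k).
        \<phi> (Dom A f) (Cod P k) (act f k w) = farr G k \<cdot>\<^bsub>A\<^esub> \<phi> (Cod A f) (Dom P k) w \<cdot>\<^bsub>A\<^esub> f)"
proof -
  obtain r e where r: "\<And>p. p \<in> Obj P \<Longrightarrow> r p \<in> Obj A" and e: "\<And>p. p \<in> Obj P \<Longrightarrow> e p \<in> W (r p) p"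
    and univ: "\<And>p a w. p \<in> Obj P \<Longrightarrow> a \<in> Obj A \<Longrightarrow> w \<in> W a p \<Longrightarrow>
      \<exists>!u. u \<in> hom A a (r p) \<and> act u (Id P p) (e p) = w"
    using rep by metis
  define \<phi> where "\<phi> a p w = (THE u. u \<in> hom A a (r p) \<and> act u (Id P p) (e p) = w)" for a p w
  have phi: "\<phi> a p w \<in> hom A a (r p)" "act (\<phi> a p w) (Id P p) (e p) = w"
    if "p \<in> Obj P" "a \<in> Obj A" "w \<in> W a p" for a p w
    using theI'[OF univ[OF that]] unfolding \<phi>_def by blast+
  have unique: "u = v" if "p \<in> Obj P" "u \<in> hom A a (r p)" "v \<in> hom A a (r p)"
      "act u (Id P p) (e p) = act v (Id P p) (e p)" for a p u v
    using univ[OF that(1) hom_obj(1)[OF A that(2)] act[OF that(2) id_hom[OF P that(1)] e[OF that(1)]]]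
      that by metis
  define g where "g k = \<phi> (r (Dom P k)) (Cod P k) (act (Id A (r (Dom P k))) k (e (Dom P k)))" for k
  have g: "g k \<in> hom A (r p) (r q)" "act (g k) (Id P q) (e q) = act (Id A (r p)) k (e p)"
    if k: "k \<in> hom P p q" for k p q
  proof -
    note pq = hom_obj[OF P k]
    have "act (Id A (r p)) k (e p) \<in> W (r p) q"
      using act[OF id_hom[OF A r[OF pq(1)]] k e[OF pq(1)]] .
    from phi[OF pq(2) r[OF pq(1)] this]
    show "g k \<in> hom A (r p) (r q)" "act (g k) (Id P q) (e q) = act (Id A (r p)) k (e p)"
      using homD(2,3)[OF k] by (simp_all add: g_def)
  qed
  \<comment> \<open>Both actions of \<open>k\<close> on an arrow into \<open>r p\<close>, through \<open>g k\<close> and directly, agree.\<close>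
  have shift: "act (g k \<cdot>\<^bsub>A\<^esub> u) (Id P q) (e q) = act u k (e p)"
    if u: "u \<in> hom A a (r p)" and k: "k \<in> hom P p q" for u k a p q
  proof -
    note pq = hom_obj[OF P k]
    have "act (g k \<cdot>\<^bsub>A\<^esub> u) (Id P q) (e q) = act u (Id P q) (act (g k) (Id P q) (e q))"
      using act_comp[OF g(1)[OF k] u id_hom[OF P pq(2)] id_hom[OF P pq(2)] e[OF pq(2)]]
        comp_id_left[OF P id_hom[OF P pq(2)]] by simp
    also have "\<dots> = act (Id A (r p) \<cdot>\<^bsub>A\<^esub> u) (Id P q \<cdot>\<^bsub>P\<^esub> k) (e p)"
      using act_comp[OF id_hom[OF A r[OF pq(1)]] u k id_hom[OF P pq(2)] e[OF pq(1)]] g(2)[OF k] by simp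
    finally show ?thesis using comp_id_left[OF A u] comp_id_left[OF P k] by simp
  qed
  define G where "G = \<lparr>fobj = restrict r (Obj P), farr = restrict g (Arr P)\<rparr>"
  have "is_functor P A G"
  proof (rule functorI)
    fix p assume p: "p \<in> Obj P"
    note i = id_hom[OF P p]
    have "g (Id P p) = Id A (r p)"
      using unique[OF p g(1)[OF i] id_hom[OF A r[OF p]]] g(2)[OF i] by simp
    then show "farr G (Id P p) = Id A (fobj G p)" using homD(1)[OF i] p by (simp add: G_def)
  next
    fix k l p q s assume k: "k \<in> hom P p q" and l: "l \<in> hom P q s"
    note kl = comp_hom[OF P k l] and p = hom_obj[OF P k] and s = hom_obj[OF P l]
    note ir = id_hom[OF A r[OF p(1)]]
    have "act (g l \<cdot>\<^bsub>A\<^esub> g k) (Id P s) (e s) = act (g k) (l \<cdot>\<^bsub>P\<^esub> Id P q) (e q)"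
      using shift[OF g(1)[OF k] l] comp_id_right[OF P l] by simp
    also have "\<dots> = act (g k \<cdot>\<^bsub>A\<^esub> Id A (r p)) (l \<cdot>\<^bsub>P\<^esub> Id P q) (e q)"
      using comp_id_right[OF A g(1)[OF k]] by simp
    also have "\<dots> = act (Id A (r p)) l (act (Id A (r p)) k (e p))"
      using act_comp[OF g(1)[OF k] ir id_hom[OF P p(2)] l e[OF p(2)]] g(2)[OF k] by simp
    also have "\<dots> = act (g (l \<cdot>\<^bsub>P\<^esub> k)) (Id P s) (e s)"
      using act_comp[OF ir ir k l e[OF p(1)]] comp_id_left[OF A ir] g(2)[OF kl] by simp
    finally have "g (l \<cdot>\<^bsub>P\<^esub> k) = g l \<cdot>\<^bsub>A\<^esub> g k"
      using unique[OF s(2) g(1)[OF kl] comp_hom[OF A g(1)[OF k] g(1)[OF l]]] by simp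
    then show "farr G (l \<cdot>\<^bsub>P\<^esub> k) = farr G l \<cdot>\<^bsub>A\<^esub> farr G k"
      using homD(1)[OF k] homD(1)[OF l] homD(1)[OF kl] by (simp add: G_def)
  next
    fix k p q assume k: "k \<in> hom P p q"
    then show "farr G k \<in> hom A (fobj G p) (fobj G q)"
      using g(1)[OF k] homD(1)[OF k] hom_obj[OF P k] by (simp add: G_def)
  qed (auto simp: G_def r)
  moreover have "bij_betw (\<phi> a p) (W a p) (hom A a (fobj G p))" if a: "a \<in> Obj A" and p: "p \<in> Obj P" for a p
  proof (rule bij_betw_byWitness[of _ "\<lambda>u. act u (Id P p) (e p)"])
    show "\<forall>w\<in>W a p. act (\<phi> a p w) (Id P p) (e p) = w" using phi(2)[OF p a] by blast
    show "\<forall>u\<in>hom A a (fobj G p). \<phi> a p (act u (Id P p) (e p)) = u"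
    proof
      fix u assume "u \<in> hom A a (fobj G p)"
      then have u: "u \<in> hom A a (r p)" using p by (simp add: G_def)
      show "\<phi> a p (act u (Id P p) (e p)) = u"
        using unique[OF p _ u] phi[OF p a act[OF u id_hom[OF P p] e[OF p]]] by blast
    qed
    show "\<phi> a p ` W a p \<subseteq> hom A a (fobj G p)" using phi(1)[OF p a] p by (auto simp: G_def)
    show "(\<lambda>u. act u (Id P p) (e p)) ` hom A a (fobj G p) \<subseteq> W a p"
      using act[OF _ id_hom[OF P p] e[OF p]] p by (auto simp: G_def)
  qed
  moreover have "\<phi> (Dom A f) (Cod P k) (act f k w) = farr G k \<cdot>\<^bsub>A\<^esub> \<phi> (Cod A f) (Dom P k) w \<cdot>\<^bsub>A\<^esub> f"
    if f': "f \<in> Arr A" and k': "k \<in> Arr P" and w: "w \<in> W (Cod A f) (Dom P k)" for f k w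
  proof -
    note f = arr_hom[OF f'] and k = arr_hom[OF k']
    note a = hom_obj[OF A f] and p = hom_obj[OF P k]
    note u = phi[OF p(1) a(2) w]
    let ?u = "\<phi> (Cod A f) (Dom P k) w"
    have uf: "?u \<cdot>\<^bsub>A\<^esub> f \<in> hom A (Dom A f) (r (Dom P k))" using comp_hom[OF A f u(1)] .
    have "act (g k \<cdot>\<^bsub>A\<^esub> (?u \<cdot>\<^bsub>A\<^esub> f)) (Id P (Cod P k)) (e (Cod P k)) = act (?u \<cdot>\<^bsub>A\<^esub> f) (k \<cdot>\<^bsub>P\<^esub> Id P (Dom P k)) (e (Dom P k))"
      using shift[OF uf k] comp_id_right[OF P k] by simp
    also have "\<dots> = act f k w"
      using act_comp[OF u(1) f id_hom[OF P p(1)] k e[OF p(1)]] u(2) by simp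
    finally have "g k \<cdot>\<^bsub>A\<^esub> (?u \<cdot>\<^bsub>A\<^esub> f) = \<phi> (Dom A f) (Cod P k) (act f k w)"
      using unique[OF p(2) comp_hom[OF A uf g(1)[OF k]] phi(1)[OF p(2) a(1) act[OF f k w]]]
        phi(2)[OF p(2) a(1) act[OF f k w]] by simp
    then show ?thesis using comp_assoc[OF A f u(1) g(1)[OF k]] k' by (simp add: G_def)
  qed
  ultimately show ?thesis by blast
qed

text \<open>A terminal object of the comma category of \<open>F\<close> over \<open>y\<close>.\<close>

definition universal_arrow ::
    "('o, 'a) cat \<Rightarrow> ('p, 'b) cat \<Rightarrow> ('o, 'a, 'p, 'b) fctr \<Rightarrow> 'p \<Rightarrow> 'o \<Rightarrow> 'b \<Rightarrow> bool" where
  "universal_arrow C D F y r e \<longleftrightarrow> r \<in> Obj C \<and> e \<in> hom D (fobj F r) y \<and>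
     (\<forall>x \<in> Obj C. \<forall>h \<in> hom D (fobj F x) y. \<exists>!u. u \<in> hom C x r \<and> e \<cdot>\<^bsub>D\<^esub> farr F u = h)"

lemma left_adjoint_if_universal_arrows:
  assumes C: "category C" and D: "category D" and F: "is_functor C D F"
    and univ: "\<And>y. y \<in> Obj D \<Longrightarrow> \<exists>r e. universal_arrow C D F y r e"
  shows "left_adjoint C D F"
proof -
  let ?W = "\<lambda>x y. hom D (fobj F x) y" and ?act = "\<lambda>f g h. g \<cdot>\<^bsub>D\<^esub> h \<cdot>\<^bsub>D\<^esub> farr F f"
  have "\<exists>G \<phi>. is_functor D C G \<and>
     (\<forall>a \<in> Obj C. \<forall>p \<in> Obj D. bij_betw (\<phi> a p) (?W a p) (hom C a (fobj G p))) \<and>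
     (\<forall>f \<in> Arr C. \<forall>k \<in> Arr D. \<forall>w \<in> ?W (Cod C f) (Dom D k).
        \<phi> (Dom C f) (Cod D k) (?act f k w) = farr G k \<cdot>\<^bsub>C\<^esub> \<phi> (Cod C f) (Dom D k) w \<cdot>\<^bsub>C\<^esub> f)"
  proof (rule representing_functor[OF C D])
    fix f k a a' p p' w assume "f \<in> hom C a' a" "k \<in> hom D p p'" "w \<in> ?W a p"
    then show "?act f k w \<in> ?W a' p'" using comp_hom[OF D functor_hom[OF F] comp_hom[OF D]] by blast
  next
    fix f f' k k' a a' a'' p p' p'' w
    assume f: "f \<in> hom C a' a" and f': "f' \<in> hom C a'' a'" and k: "k \<in> hom D p p'"
      and k': "k' \<in> hom D p' p''" and w: "w \<in> ?W a p"
    note Ff = functor_hom[OF F f] and Ff' = functor_hom[OF F f']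
    note kw = comp_hom[OF D w k]
    show "?act (f \<cdot>\<^bsub>C\<^esub> f') (k' \<cdot>\<^bsub>D\<^esub> k) w = ?act f' k' (?act f k w)"
      using functor_comp[OF F f' f] comp_assoc[OF D Ff' Ff comp_hom[OF D kw k']]
        comp_assoc[OF D w k k'] comp_assoc[OF D Ff kw k'] by simp
  next
    fix p assume p: "p \<in> Obj D"
    obtain r e where u: "universal_arrow C D F p r e" using univ[OF p] by blast
    have e: "e \<in> hom D (fobj F r) p" using u by (simp add: universal_arrow_def)
    have "Id D p \<cdot>\<^bsub>D\<^esub> e = e" using comp_id_left[OF D e] .
    then show "\<exists>r\<in>Obj C. \<exists>e\<in>?W r p. \<forall>a\<in>Obj C. \<forall>w\<in>?W a p. \<exists>!u. u \<in> hom C a r \<and> ?act u (Id D p) e = w"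
      using u unfolding universal_arrow_def by (intro bexI[of _ r] bexI[of _ e]) auto
  qed
  then show ?thesis unfolding left_adjoint_def using F by auto
qed

text \<open>The universal arrow is the counit: the arrow that corresponds to the identity of \<open>G y\<close>.\<close>

lemma left_adjoint_universal_arrow:
  assumes C: "category C" and D: "category D" and F: "left_adjoint C D F" and y: "y \<in> Obj D"
  obtains r e where "universal_arrow C D F y r e"
proof -
  obtain G \<phi> where G: "is_functor D C G"
    and bij: "\<And>x y. x \<in> Obj C \<Longrightarrow> y \<in> Obj D \<Longrightarrow> bij_betw (\<phi> x y) (hom D (fobj F x) y) (hom C x (fobj G y))"
    and nat: "\<And>f g h. f \<in> Arr C \<Longrightarrow> g \<in> Arr D \<Longrightarrow> h \<in> hom D (fobj F (Cod C f)) (Dom D g) \<Longrightarrow>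
           \<phi> (Dom C f) (Cod D g) (g \<cdot>\<^bsub>D\<^esub> h \<cdot>\<^bsub>D\<^esub> farr F f) =
           farr G g \<cdot>\<^bsub>C\<^esub> \<phi> (Cod C f) (Dom D g) h \<cdot>\<^bsub>C\<^esub> f"
    using F unfolding left_adjoint_def by blast
  note fF = left_adjoint_functor[OF F]
  let ?r = "fobj G y"
  have r: "?r \<in> Obj C" using functor_obj[OF G y] .
  have "Id C ?r \<in> \<phi> ?r y ` hom D (fobj F ?r) y"
    using bij[OF r y] id_hom[OF C r] by (simp add: bij_betw_def)
  then obtain e where e: "e \<in> hom D (fobj F ?r) y" "\<phi> ?r y e = Id C ?r" by auto
  have phi: "\<phi> x y (e \<cdot>\<^bsub>D\<^esub> farr F u) = u" if u: "u \<in> hom C x ?r" for x u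
  proof -
    note i = id_hom[OF D y]
    have "\<phi> x y (Id D y \<cdot>\<^bsub>D\<^esub> e \<cdot>\<^bsub>D\<^esub> farr F u) = farr G (Id D y) \<cdot>\<^bsub>C\<^esub> \<phi> ?r y e \<cdot>\<^bsub>C\<^esub> u"
      using nat[of u "Id D y" e] homD[OF u] homD[OF i] e(1) by simp
    then show ?thesis
      using comp_id_left[OF D e(1)] e(2) functor_id[OF G y] comp_id_left[OF C id_hom[OF C r]]
        comp_id_left[OF C u] by simp
  qed
  have "\<exists>!u. u \<in> hom C x ?r \<and> e \<cdot>\<^bsub>D\<^esub> farr F u = h" if x: "x \<in> Obj C" and h: "h \<in> hom D (fobj F x) y" for x h
  proof (rule ex1I)
    have 1: "\<phi> x y h \<in> hom C x ?r" using bij[OF x y] h by (auto simp: bij_betw_def)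
    have "e \<cdot>\<^bsub>D\<^esub> farr F (\<phi> x y h) = h"
      using phi[OF 1] bij[OF x y] h comp_hom[OF D functor_hom[OF fF 1] e(1)]
      by (auto simp: bij_betw_def inj_on_def)
    then show "\<phi> x y h \<in> hom C x ?r \<and> e \<cdot>\<^bsub>D\<^esub> farr F (\<phi> x y h) = h" using 1 by blast
  qed (use phi in auto)
  then show thesis using that r e(1) unfolding universal_arrow_def by blast
qed

definition swap_functor :: "('o \<times> 'p, 'a \<times> 'b, 'q, 'c) fctr \<Rightarrow> ('p \<times> 'o, 'b \<times> 'a, 'q, 'c) fctr" where
  "swap_functor F = \<lparr>fobj = (\<lambda>p. fobj F (prod.swap p)), farr = (\<lambda>f. farr F (prod.swap f))\<rparr>"

lemma swap_functor_simps [simp]: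
  "fobj (swap_functor F) (b, a) = fobj F (a, b)" "farr (swap_functor F) (g, f) = farr F (f, g)"
  "swap_functor (swap_functor F) = F"
  by (simp_all add: swap_functor_def)

lemma is_functor_swap:
  assumes "is_functor (prod_cat A B) D F"
  shows "is_functor (prod_cat B A) D (swap_functor F)"
proof (rule functorI)
  show "fobj (swap_functor F) \<in> extensional (Obj (prod_cat B A))"
    "farr (swap_functor F) \<in> extensional (Arr (prod_cat B A))"
    using assms by (auto simp: is_functor_def PiE_def extensional_def swap_functor_def)
  fix f g x y z assume "f \<in> hom (prod_cat B A) x y" "g \<in> hom (prod_cat B A) y z"
  then show "farr (swap_functor F) (g \<cdot>\<^bsub>prod_cat B A\<^esub> f) = farr (swap_functor F) g \<cdot>\<^bsub>D\<^esub> farr (swap_functor F) f"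
    using functor_comp[OF assms, of "prod.swap f" "prod.swap x" "prod.swap y" "prod.swap g" "prod.swap z"]
    by (cases f, cases g, cases x, cases y, cases z) (simp add: hom_prod)
next
  fix f x y assume "f \<in> hom (prod_cat B A) x y"
  then show "farr (swap_functor F) f \<in> hom D (fobj (swap_functor F) x) (fobj (swap_functor F) y)"
    using functor_hom[OF assms, of "prod.swap f" "prod.swap x" "prod.swap y"]
    by (cases f, cases x, cases y) (simp add: hom_prod)
qed (use functor_obj[OF assms] functor_id[OF assms] in \<open>auto\<close>)

lemma partial_functor_simps [simp]:
  "b \<in> Obj B \<Longrightarrow> fobj (partial_functor A B F a) b = fobj F (a, b)"
  "g \<in> Arr B \<Longrightarrow> farr (partial_functor A B F a) g = farr F (Id A a, g)"
  by (simp_all add: partial_functor_def)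

lemma is_functor_partial:
  assumes A: "category A" and B: "category B" and F: "is_functor (prod_cat A B) D F" and a: "a \<in> Obj A"
  shows "is_functor B D (partial_functor A B F a)"
proof (rule functorI)
  note i = id_hom[OF A a]
  show "fobj (partial_functor A B F a) \<in> extensional (Obj B)"
    "farr (partial_functor A B F a) \<in> extensional (Arr B)"
    by (simp_all add: partial_functor_def)
  fix f x y assume f: "f \<in> hom B x y"
  show "farr (partial_functor A B F a) f \<in> hom D (fobj (partial_functor A B F a) x) (fobj (partial_functor A B F a) y)"
    using functor_hom[OF F, of "(Id A a, f)" "(a, x)" "(a, y)"] f i homD(1)[OF f] hom_obj[OF B f]
    by (simp add: hom_prod)
  fix g z assume g: "g \<in> hom B y z"
  show "farr (partial_functor A B F a) (g \<cdot>\<^bsub>B\<^esub> f) = farr (partial_functor A B F a) g \<cdot>\<^bsub>D\<^esub> farr (partial_functor A B F a) f"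
    using functor_comp[OF F, of "(Id A a, f)" "(a, x)" "(a, y)" "(Id A a, g)" "(a, z)"] f g i
      homD(1)[OF f] homD(1)[OF g] homD(1)[OF comp_hom[OF B f g]] comp_id_left[OF A i]
    by (simp add: hom_prod)
next
  fix x assume x: "x \<in> Obj B"
  then show "farr (partial_functor A B F a) (Id B x) = Id D (fobj (partial_functor A B F a) x)"
    using functor_id[OF F, of "(a, x)"] a homD(1)[OF id_hom[OF B x]] by simp
qed (use functor_obj[OF F] a in auto)

text \<open>Right adjoints of the functors \<open>F(-, b)\<close>, chosen separately for each \<open>b\<close>, assemble to a bifunctor.
  This is what makes being an adjunction of two variables a property of the one-variable functors.\<close>

lemma right_adjoint_in_parameter_iff:
  assumes A: "category A" and B: "category B" and D: "category D" and F: "is_functor (prod_cat A B) D F"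
  shows "(\<exists>G1 \<phi>. is_functor (prod_cat (op_cat B) D) A G1 \<and>
        (\<forall>a \<in> Obj A. \<forall>b \<in> Obj B. \<forall>y \<in> Obj D.
           bij_betw (\<phi> a b y) (hom D (fobj F (a, b)) y) (hom A a (fobj G1 (b, y)))) \<and>
        (\<forall>f \<in> Arr A. \<forall>g \<in> Arr B. \<forall>k \<in> Arr D. \<forall>h \<in> hom D (fobj F (Cod A f, Cod B g)) (Dom D k).
           \<phi> (Dom A f) (Dom B g) (Cod D k) (k \<cdot>\<^bsub>D\<^esub> h \<cdot>\<^bsub>D\<^esub> farr F (f, g)) =
           farr G1 (g, k) \<cdot>\<^bsub>A\<^esub> \<phi> (Cod A f) (Cod B g) (Dom D k) h \<cdot>\<^bsub>A\<^esub> f)) \<longleftrightarrow>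
     (\<forall>b \<in> Obj B. left_adjoint A D (partial_functor B A (swap_functor F) b))"
    (is "?G \<longleftrightarrow> ?L")
proof
  assume ?G
  then obtain G1 \<phi> where G: "is_functor (prod_cat (op_cat B) D) A G1"
    and bij: "\<And>a b y. a \<in> Obj A \<Longrightarrow> b \<in> Obj B \<Longrightarrow> y \<in> Obj D \<Longrightarrow>
           bij_betw (\<phi> a b y) (hom D (fobj F (a, b)) y) (hom A a (fobj G1 (b, y)))"
    and nat: "\<And>f g k h. f \<in> Arr A \<Longrightarrow> g \<in> Arr B \<Longrightarrow> k \<in> Arr D \<Longrightarrow>
           h \<in> hom D (fobj F (Cod A f, Cod B g)) (Dom D k) \<Longrightarrow>
           \<phi> (Dom A f) (Dom B g) (Cod D k) (k \<cdot>\<^bsub>D\<^esub> h \<cdot>\<^bsub>D\<^esub> farr F (f, g)) =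
           farr G1 (g, k) \<cdot>\<^bsub>A\<^esub> \<phi> (Cod A f) (Cod B g) (Dom D k) h \<cdot>\<^bsub>A\<^esub> f"
    by blast
  show ?L
  proof
    fix b assume b: "b \<in> Obj B"
    note i = id_hom[OF B b]
    let ?F = "partial_functor B A (swap_functor F) b" and ?G = "partial_functor (op_cat B) D G1 b"
    have "is_functor A D ?F" using is_functor_partial[OF B A is_functor_swap[OF F] b] .
    moreover have "is_functor D A ?G" using is_functor_partial[OF category_op[OF B] D G] b by simp
    moreover have "\<forall>x\<in>Obj A. \<forall>y\<in>Obj D. bij_betw (\<phi> x b y) (hom D (fobj ?F x) y) (hom A x (fobj ?G y))"
      using bij b by simp
    moreover have "\<phi> (Dom A f) b (Cod D g) (g \<cdot>\<^bsub>D\<^esub> h \<cdot>\<^bsub>D\<^esub> farr ?F f) = farr ?G g \<cdot>\<^bsub>A\<^esub> \<phi> (Cod A f) b (Dom D g) h \<cdot>\<^bsub>A\<^esub> f"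
      if "f \<in> Arr A" "g \<in> Arr D" "h \<in> hom D (fobj ?F (Cod A f)) (Dom D g)" for f g h
      using nat[of f "Id B b" g h] homD[OF i] that arr_obj[OF A that(1)] by simp
    ultimately show "left_adjoint A D ?F"
      unfolding left_adjoint_def by (intro conjI exI[of _ ?G] exI[of _ "\<lambda>x y. \<phi> x b y"]) auto
  qed
next
  assume L: ?L
  let ?P = "prod_cat (op_cat B) D"
  let ?W = "\<lambda>a p. hom D (fobj F (a, fst p)) (snd p)"
  let ?act = "\<lambda>f p h. snd p \<cdot>\<^bsub>D\<^esub> h \<cdot>\<^bsub>D\<^esub> farr F (f, fst p)"
  have Fh: "farr F (f, g) \<in> hom D (fobj F (a, b)) (fobj F (a', b'))" if "f \<in> hom A a a'" "g \<in> hom B b b'" for f g a a' b b'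
    using functor_hom[OF F, of "(f, g)" "(a, b)" "(a', b')"] that by (simp add: hom_prod)
  have "\<exists>G \<phi>. is_functor ?P A G \<and>
     (\<forall>a \<in> Obj A. \<forall>p \<in> Obj ?P. bij_betw (\<phi> a p) (?W a p) (hom A a (fobj G p))) \<and>
     (\<forall>f \<in> Arr A. \<forall>k \<in> Arr ?P. \<forall>w \<in> ?W (Cod A f) (Dom ?P k).
        \<phi> (Dom A f) (Cod ?P k) (?act f k w) = farr G k \<cdot>\<^bsub>A\<^esub> \<phi> (Cod A f) (Dom ?P k) w \<cdot>\<^bsub>A\<^esub> f)"
  proof (rule representing_functor[OF A category_prod[OF category_op[OF B] D]])
    fix f k a a' p p' w assume f: "f \<in> hom A a' a" and k: "k \<in> hom ?P p p'" and w: "w \<in> ?W a p"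
    obtain g l b y b' y' where e: "k = (g, l)" "p = (b, y)" "p' = (b', y')" by (metis prod.exhaust)
    have g: "g \<in> hom B b' b" and l: "l \<in> hom D y y'" using k by (auto simp: e hom_prod hom_op)
    show "?act f k w \<in> ?W a' p'"
      using comp_hom[OF D Fh[OF f g] comp_hom[OF D _ l]] w by (simp add: e)
  next
    fix f f' k k' a a' a'' p p' p'' w
    assume f: "f \<in> hom A a' a" and f': "f' \<in> hom A a'' a'" and k: "k \<in> hom ?P p p'"
      and k': "k' \<in> hom ?P p' p''" and w: "w \<in> ?W a p"
    obtain g l b y b' y' where e: "k = (g, l)" "p = (b, y)" "p' = (b', y')" by (metis prod.exhaust)
    obtain g' l' b'' y'' where e': "k' = (g', l')" "p'' = (b'', y'')" by (metis prod.exhaust)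
    have g: "g \<in> hom B b' b" "g' \<in> hom B b'' b'" and l: "l \<in> hom D y y'" "l' \<in> hom D y' y''"
      using k k' by (auto simp: e e' hom_prod hom_op)
    have w: "w \<in> hom D (fobj F (a, b)) y" using w by (simp add: e)
    note Ff = Fh[OF f g(1)] and Ff' = Fh[OF f' g(2)] and kw = comp_hom[OF D w l(1)]
    have "farr F (f \<cdot>\<^bsub>A\<^esub> f', g \<cdot>\<^bsub>B\<^esub> g') = farr F (f, g) \<cdot>\<^bsub>D\<^esub> farr F (f', g')"
      using functor_comp[OF F, of "(f', g')" "(a'', b'')" "(a', b')" "(f, g)" "(a, b)"] f f' g
      by (simp add: hom_prod)
    then show "?act (f \<cdot>\<^bsub>A\<^esub> f') (k' \<cdot>\<^bsub>?P\<^esub> k) w = ?act f' k' (?act f k w)"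
      using comp_assoc[OF D Ff' Ff comp_hom[OF D kw l(2)]]
        comp_assoc[OF D w l(1) l(2)] comp_assoc[OF D Ff kw l(2)] by (simp add: e e')
  next
    fix p assume "p \<in> Obj ?P"
    then obtain b y where e: "p = (b, y)" and b: "b \<in> Obj B" and y: "y \<in> Obj D" by auto
    let ?F = "partial_functor B A (swap_functor F) b"
    obtain r e where u: "universal_arrow A D ?F y r e"
      using left_adjoint_universal_arrow[OF A D _ y] L b by blast
    then have r: "r \<in> Obj A" and e': "e \<in> hom D (fobj F (r, b)) y"
      by (auto simp: universal_arrow_def)
    have "\<exists>!u. u \<in> hom A a r \<and> ?act u (Id ?P p) e = w" if "a \<in> Obj A" "w \<in> ?W a p" for a w
    proof -
      have "\<exists>!u. u \<in> hom A a r \<and> e \<cdot>\<^bsub>D\<^esub> farr ?F u = w"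
        using u that by (simp add: universal_arrow_def e)
      moreover have "u \<in> hom A a r \<and> ?act u (Id ?P p) e = w \<longleftrightarrow> u \<in> hom A a r \<and> e \<cdot>\<^bsub>D\<^esub> farr ?F u = w" for u
        using comp_id_left[OF D e'] by (auto simp: e homD(1))
      ultimately show ?thesis by simp
    qed
    then show "\<exists>r\<in>Obj A. \<exists>e\<in>?W r p. \<forall>a\<in>Obj A. \<forall>w\<in>?W a p. \<exists>!u. u \<in> hom A a r \<and> ?act u (Id ?P p) e = w"
      using r e' e by (intro bexI[of _ r] bexI[of _ e]) auto
  qed
  then obtain G \<phi> where G: "is_functor ?P A G"
     "\<And>a p. a \<in> Obj A \<Longrightarrow> p \<in> Obj ?P \<Longrightarrow> bij_betw (\<phi> a p) (?W a p) (hom A a (fobj G p))"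
     "\<And>f k w. f \<in> Arr A \<Longrightarrow> k \<in> Arr ?P \<Longrightarrow> w \<in> ?W (Cod A f) (Dom ?P k) \<Longrightarrow>
        \<phi> (Dom A f) (Cod ?P k) (?act f k w) = farr G k \<cdot>\<^bsub>A\<^esub> \<phi> (Cod A f) (Dom ?P k) w \<cdot>\<^bsub>A\<^esub> f"
    by blast
  show ?G
  proof (rule exI[of _ G], rule exI[of _ "\<lambda>a b y. \<phi> a (b, y)"], intro conjI ballI)
    fix f g k h assume "f \<in> Arr A" "g \<in> Arr B" "k \<in> Arr D" "h \<in> hom D (fobj F (Cod A f, Cod B g)) (Dom D k)"
    then show "\<phi> (Dom A f) (Dom B g, Cod D k) (k \<cdot>\<^bsub>D\<^esub> h \<cdot>\<^bsub>D\<^esub> farr F (f, g)) =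
       farr G (g, k) \<cdot>\<^bsub>A\<^esub> \<phi> (Cod A f) (Cod B g, Dom D k) h \<cdot>\<^bsub>A\<^esub> f"
      using G(3)[of f "(g, k)" h] by simp
  qed (use G(1) G(2)[of _ "(_, _)"] in auto)
qed

text \<open>Exchanging the two variables reduces the second half of the definition to the first.\<close>

lemma two_var_left_adjoint_iff:
  assumes A: "category A" and B: "category B" and D: "category D"
  shows "two_var_left_adjoint A B D F \<longleftrightarrow> is_functor (prod_cat A B) D F \<and>
     (\<forall>a \<in> Obj A. left_adjoint B D (partial_functor A B F a)) \<and>
     (\<forall>b \<in> Obj B. left_adjoint A D (partial_functor B A (swap_functor F) b))"
proof (cases "is_functor (prod_cat A B) D F")
  case F: True
  note 1 = right_adjoint_in_parameter_iff[OF A B D F]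
  note 2 = right_adjoint_in_parameter_iff[OF B A D is_functor_swap[OF F]]
  have 3: "(\<exists>G2 \<psi>. is_functor (prod_cat (op_cat A) D) B G2 \<and>
        (\<forall>a \<in> Obj A. \<forall>b \<in> Obj B. \<forall>y \<in> Obj D.
           bij_betw (\<psi> a b y) (hom D (fobj F (a, b)) y) (hom B b (fobj G2 (a, y)))) \<and>
        (\<forall>f \<in> Arr A. \<forall>g \<in> Arr B. \<forall>k \<in> Arr D. \<forall>h \<in> hom D (fobj F (Cod A f, Cod B g)) (Dom D k).
           \<psi> (Dom A f) (Dom B g) (Cod D k) (k \<cdot>\<^bsub>D\<^esub> h \<cdot>\<^bsub>D\<^esub> farr F (f, g)) =
           farr G2 (f, k) \<cdot>\<^bsub>B\<^esub> \<psi> (Cod A f) (Cod B g) (Dom D k) h \<cdot>\<^bsub>B\<^esub> g)) \<longleftrightarrow>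
     (\<exists>G1 \<phi>. is_functor (prod_cat (op_cat A) D) B G1 \<and>
        (\<forall>a \<in> Obj B. \<forall>b \<in> Obj A. \<forall>y \<in> Obj D.
           bij_betw (\<phi> a b y) (hom D (fobj (swap_functor F) (a, b)) y) (hom B a (fobj G1 (b, y)))) \<and>
        (\<forall>f \<in> Arr B. \<forall>g \<in> Arr A. \<forall>k \<in> Arr D. \<forall>h \<in> hom D (fobj (swap_functor F) (Cod B f, Cod A g)) (Dom D k).
           \<phi> (Dom B f) (Dom A g) (Cod D k) (k \<cdot>\<^bsub>D\<^esub> h \<cdot>\<^bsub>D\<^esub> farr (swap_functor F) (f, g)) =
           farr G1 (g, k) \<cdot>\<^bsub>B\<^esub> \<phi> (Cod B f) (Cod A g) (Dom D k) h \<cdot>\<^bsub>B\<^esub> f))"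
    (is "(\<exists>G2 \<psi>. ?X G2 \<psi>) \<longleftrightarrow> (\<exists>G1 \<phi>. ?Y G1 \<phi>)")
  proof -
    have XY: "?X G2 \<psi> \<Longrightarrow> ?Y G2 (\<lambda>b a. \<psi> a b)" for G2 \<psi> by simp
    have YX: "?Y G1 \<phi> \<Longrightarrow> ?X G1 (\<lambda>a b. \<phi> b a)" for G1 \<phi> by simp
    show ?thesis
    proof (intro iffI; elim exE)
      fix G \<psi> assume "?X G \<psi>"
      from XY[OF this] show "\<exists>G1 \<phi>. ?Y G1 \<phi>" by (intro exI)
    next
      fix G \<phi> assume "?Y G \<phi>"
      from YX[OF this] show "\<exists>G2 \<psi>. ?X G2 \<psi>" by (intro exI)
    qed
  qed
  show ?thesis
    unfolding two_var_left_adjoint_def 1 3 2 swap_functor_simps(3) by blast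
qed (simp add: two_var_left_adjoint_def)

section \<open>Small colimits\<close>

lemma small_sum:
  assumes "regular_cardinal \<kappa>" "|X| <o \<kappa>" "|Y| <o \<kappa>"
  shows "|X <+> Y| <o \<kappa>"
  using assms card_of_Plus_ordLess_infinite_Field[of \<kappa> X Y]
  by (auto simp: regular_cardinal_def cinfinite_def)

lemma small_finite:
  assumes "regular_cardinal \<kappa>" "finite X"
  shows "|X| <o \<kappa>"
proof -
  have "\<not> |Field \<kappa>| \<le>o |X|"
    using assms card_of_ordLeq_finite by (auto simp: regular_cardinal_def cinfinite_def)
  then have "|X| <o |Field \<kappa>|" using not_ordLeq_iff_ordLess[OF card_of_Well_order card_of_Well_order] by blast
  then show ?thesis
    using assms(1) card_of_Field_ordIso ordLess_ordIso_trans by (auto simp: regular_cardinal_def)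
qed

lemma small_Sigma:
  assumes "regular_cardinal \<kappa>" "|X| <o \<kappa>" "\<And>x. x \<in> X \<Longrightarrow> |F x| <o \<kappa>"
  shows "|SIGMA x : X. F x| <o \<kappa>"
  using assms by (auto simp: regular_cardinal_def cinfinite_def intro!: stable_elim regularCard_stable)

lemma small_subset: "|X| <o \<kappa> \<Longrightarrow> Y \<subseteq> X \<Longrightarrow> |Y| <o \<kappa>"
  using card_of_mono1 ordLeq_ordLess_trans by blast

lemma small_image: "|X| <o \<kappa> \<Longrightarrow> |f ` X| <o \<kappa>"
  using card_of_image ordLeq_ordLess_trans by blast

lemma small_injection:
  fixes \<kappa> :: "'k rel" and X :: "'x set"
  assumes "regular_cardinal \<kappa>" "|X| <o \<kappa>"
  obtains f :: "'x \<Rightarrow> 'k" where "inj_on f X"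
proof -
  have "|X| \<le>o |Field \<kappa>|"
    using assms by (auto simp: regular_cardinal_def intro: ordLess_imp_ordLeq ordLess_ordIso_trans
      ordIso_symmetric card_of_Field_ordIso)
  then show thesis using that by (auto simp: card_of_ordLeq[symmetric])
qed

text \<open>Cocompleteness speaks of index categories with objects and arrows of type \<open>'k\<close> only. A small category
  of any type has an isomorphic copy of that kind, along injections of its objects and arrows.\<close>

lemma small_colimit_exists:
  fixes \<kappa> :: "'k rel" and J :: "('i, 'j) cat"
  assumes k: "regular_cardinal \<kappa>" and C: "category C" and cc: "cocomplete \<kappa> C"
    and J: "category J" "|Obj J| <o \<kappa>" "|Arr J| <o \<kappa>" and D: "is_functor J C D"
  shows "\<exists>c \<iota>. is_colimit J C D c \<iota>"
proof -
  obtain f :: "'i \<Rightarrow> 'k" where f: "inj_on f (Obj J)" using small_injection[OF k J(2)] .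
  obtain g :: "'j \<Rightarrow> 'k" where g: "inj_on g (Arr J)" using small_injection[OF k J(3)] .
  let ?f = "inv_into (Obj J) f" and ?g = "inv_into (Arr J) g"
  define K where "K = \<lparr>Obj = f ` Obj J, Arr = g ` Arr J, Dom = (\<lambda>a. f (Dom J (?g a))),
    Cod = (\<lambda>a. f (Cod J (?g a))), Id = (\<lambda>x. g (Id J (?f x))), Comp = (\<lambda>a b. g (?g a \<cdot>\<^bsub>J\<^esub> ?g b))\<rparr>"
  have Ks: "Obj K = f ` Obj J" "Arr K = g ` Arr J" "\<And>a. Dom K a = f (Dom J (?g a))"
    "\<And>a. Cod K a = f (Cod J (?g a))" "\<And>x. Id K x = g (Id J (?f x))"
    "\<And>a b. a \<cdot>\<^bsub>K\<^esub> b = g (?g a \<cdot>\<^bsub>J\<^esub> ?g b)"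
    by (simp_all add: K_def)
  have ff: "?f (f x) = x" if "x \<in> Obj J" for x using f that by simp
  have gg: "?g (g a) = a" if "a \<in> Arr J" for a using g that by simp
  have homK: "a \<in> hom K x y \<longleftrightarrow> (\<exists>a' x' y'. a' \<in> hom J x' y' \<and> a = g a' \<and> x = f x' \<and> y = f y')" for a x y
    unfolding hom_def Ks using gg by auto
  have fe: "f x = f y \<longleftrightarrow> x = y" if "x \<in> Obj J" "y \<in> Obj J" for x y
    using f that by (auto simp: inj_on_def)
  have cK: "category K"
  proof (rule categoryI)
    fix a assume "a \<in> Arr K"
    then show "Dom K a \<in> Obj K \<and> Cod K a \<in> Obj K" using arr_obj[OF J(1)] by (auto simp: Ks gg)
  next
    fix x assume "x \<in> Obj K"
    then obtain x' where x: "x' \<in> Obj J" "x = f x'" by (auto simp: Ks)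
    then show "Id K x \<in> hom K x x"
      using id_hom[OF J(1) x(1)] unfolding homK by (auto simp: Ks ff)
  next
    fix a b x y z assume "a \<in> hom K x y" "b \<in> hom K y z"
    then obtain a' x' y' b' y'' z' where 1: "a' \<in> hom J x' y'" "a = g a'" "x = f x'" "y = f y'"
      and 2: "b' \<in> hom J y'' z'" "b = g b'" "y = f y''" "z = f z'" unfolding homK by blast
    then have "y' = y''" using fe hom_obj[OF J(1)] by metis
    then have "b' \<cdot>\<^bsub>J\<^esub> a' \<in> hom J x' z'" using comp_hom[OF J(1)] 1 2 by blast
    then show "b \<cdot>\<^bsub>K\<^esub> a \<in> hom K x z"
      unfolding homK using 1 2 homD(1)[OF 1(1)] homD(1)[OF 2(1)] gg by (auto simp: Ks)
  next
    fix a x y assume "a \<in> hom K x y"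
    then obtain a' x' y' where 1: "a' \<in> hom J x' y'" "a = g a'" "x = f x'" "y = f y'"
      unfolding homK by blast
    note o = hom_obj[OF J(1) 1(1)]
    show "a \<cdot>\<^bsub>K\<^esub> Id K x = a \<and> Id K y \<cdot>\<^bsub>K\<^esub> a = a"
      using 1 o homD(1)[OF 1(1)] homD(1)[OF id_hom[OF J(1) o(1)]] homD(1)[OF id_hom[OF J(1) o(2)]]
        comp_id_left[OF J(1) 1(1)] comp_id_right[OF J(1) 1(1)] by (simp add: Ks ff gg)
  next
    fix a b c w x y z assume "a \<in> hom K w x" "b \<in> hom K x y" "c \<in> hom K y z"
    then obtain a' w' x' b' xx y' c' yy z' where 1: "a' \<in> hom J w' x'" "a = g a'" "x = f x'"
      and 2: "b' \<in> hom J xx y'" "b = g b'" "x = f xx" "y = f y'"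
      and 3: "c' \<in> hom J yy z'" "c = g c'" "y = f yy" unfolding homK by blast
    have e: "xx = x'" "yy = y'"
      using fe hom_obj[OF J(1) 1(1)] hom_obj[OF J(1) 2(1)] hom_obj[OF J(1) 3(1)] 1(3) 2(3,4) 3(3) by metis+
    note bh = 2(1)[unfolded e] and ch = 3(1)[unfolded e]
    note ab = comp_hom[OF J(1) 1(1) bh] and bc = comp_hom[OF J(1) bh ch]
    show "c \<cdot>\<^bsub>K\<^esub> (b \<cdot>\<^bsub>K\<^esub> a) = c \<cdot>\<^bsub>K\<^esub> b \<cdot>\<^bsub>K\<^esub> a"
      using comp_assoc[OF J(1) 1(1) bh ch] homD(1)[OF ab] homD(1)[OF bc]
        homD(1)[OF 1(1)] homD(1)[OF bh] homD(1)[OF ch] 1(2) 2(2) 3(2) by (simp add: Ks gg)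
  qed
  define E where "E = \<lparr>fobj = (\<lambda>x \<in> Obj K. fobj D (?f x)), farr = (\<lambda>a \<in> Arr K. farr D (?g a))\<rparr>"
  have E: "fobj E (f x) = fobj D x" if "x \<in> Obj J" for x
    using that by (simp add: E_def Ks ff)
  have E': "farr E (g a) = farr D a" if "a \<in> Arr J" for a
    using that by (simp add: E_def Ks gg)
  have "is_functor K C E"
  proof (rule functorI)
    fix a b x y z assume "a \<in> hom K x y" "b \<in> hom K y z"
    then obtain a' x' y' b' y'' z' where 1: "a' \<in> hom J x' y'" "a = g a'" "x = f x'" "y = f y'"
      and 2: "b' \<in> hom J y'' z'" "b = g b'" "y = f y''" "z = f z'" unfolding homK by blast
    have "y' = y''" using fe hom_obj[OF J(1) 1(1)] hom_obj[OF J(1) 2(1)] 1(4) 2(3) by metis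
    with 2 have bh: "b' \<in> hom J y' z'" by simp
    show "farr E (b \<cdot>\<^bsub>K\<^esub> a) = farr E b \<cdot>\<^bsub>C\<^esub> farr E a"
      using functor_comp[OF D 1(1) bh] homD(1)[OF comp_hom[OF J(1) 1(1) bh]]
        homD(1)[OF 1(1)] homD(1)[OF bh] 1(2) 2(2) E' by (simp add: Ks gg)
  next
    fix a x y assume "a \<in> hom K x y"
    then obtain a' x' y' where 1: "a' \<in> hom J x' y'" "a = g a'" "x = f x'" "y = f y'"
      unfolding homK by blast
    show "farr E a \<in> hom C (fobj E x) (fobj E y)"
      using functor_hom[OF D 1(1)] hom_obj[OF J(1) 1(1)] homD(1)[OF 1(1)] E E' 1 by simp
  next
    fix x assume "x \<in> Obj K"
    then obtain x' where x: "x' \<in> Obj J" "x = f x'" by (auto simp: Ks)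
    show "farr E (Id K x) = Id C (fobj E x)"
      using functor_id[OF D x(1)] homD(1)[OF id_hom[OF J(1) x(1)]] E E' x by (simp add: Ks ff)
  qed (use functor_obj[OF D] in \<open>auto simp: E_def Ks ff\<close>)
  moreover have "category_below \<kappa> K"
    unfolding category_below_def using cK small_image[OF J(2), of f] small_image[OF J(3), of g] by (simp add: Ks)
  ultimately obtain c \<iota> where colim: "is_colimit K C E c \<iota>" using cc unfolding cocomplete_def by blast
  have cocone: "is_cocone K C E d \<theta> \<longleftrightarrow> is_cocone J C D d (\<theta> \<circ> f)" for d \<theta>
    unfolding is_cocone_def using arr_obj[OF J(1)] by (auto simp: Ks E E' gg)
  have "is_colimit J C D c (\<iota> \<circ> f)"
    unfolding is_colimit_def
  proof (intro conjI allI impI)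
    show "is_cocone J C D c (\<iota> \<circ> f)" using colim cocone by (simp add: is_colimit_def)
    fix d \<theta> assume t: "is_cocone J C D d \<theta>"
    have "is_cocone J C D d ((\<theta> \<circ> ?f) \<circ> f)"
      using t arr_obj[OF J(1)] unfolding is_cocone_def by (simp add: ff)
    then have "\<exists>!h. h \<in> hom C c d \<and> (\<forall>j\<in>Obj K. h \<cdot>\<^bsub>C\<^esub> \<iota> j = (\<theta> \<circ> ?f) j)"
      using colim unfolding cocone[symmetric] is_colimit_def by blast
    then show "\<exists>!h. h \<in> hom C c d \<and> (\<forall>j\<in>Obj J. h \<cdot>\<^bsub>C\<^esub> (\<iota> \<circ> f) j = \<theta> j)"
      by (simp add: Ks ff)
  qed
  then show ?thesis by blast
qed

text \<open>A family of objects \<open>X i\<close> with spans \<open>X (src e) \<leftarrow> Y e \<rightarrow> X (tgt e)\<close>. A cocone has to equalize the two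
  composites for each span. All colimits have this form, and the ones needed below (coequalizers,
  colimits over comma categories, and ends in the opposite category) have it without the need
  to compose index arrows.\<close>

record ('i, 'e, 'o, 'a) spans =
  Vert :: "'i set"
  Edge :: "'e set"
  vobj :: "'i \<Rightarrow> 'o"
  apex :: "'e \<Rightarrow> 'o"
  src :: "'e \<Rightarrow> 'i"
  tgt :: "'e \<Rightarrow> 'i"
  lft :: "'e \<Rightarrow> 'a"
  rgt :: "'e \<Rightarrow> 'a"

definition spans_in :: "('o, 'a) cat \<Rightarrow> ('i, 'e, 'o, 'a) spans \<Rightarrow> bool" where
  "spans_in C G \<longleftrightarrow> (\<forall>i \<in> Vert G. vobj G i \<in> Obj C) \<and>
     (\<forall>e \<in> Edge G. src G e \<in> Vert G \<and> tgt G e \<in> Vert G \<and>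
        lft G e \<in> hom C (apex G e) (vobj G (src G e)) \<and> rgt G e \<in> hom C (apex G e) (vobj G (tgt G e)))"

definition small_spans :: "'k rel \<Rightarrow> ('i, 'e, 'o, 'a) spans \<Rightarrow> bool" where
  "small_spans \<kappa> G \<longleftrightarrow> |Vert G| <o \<kappa> \<and> |Edge G| <o \<kappa>"

definition span_cocone :: "('o, 'a) cat \<Rightarrow> ('i, 'e, 'o, 'a) spans \<Rightarrow> 'o \<Rightarrow> ('i \<Rightarrow> 'a) \<Rightarrow> bool" where
  "span_cocone C G c l \<longleftrightarrow> c \<in> Obj C \<and> (\<forall>i \<in> Vert G. l i \<in> hom C (vobj G i) c) \<and>
     (\<forall>e \<in> Edge G. l (src G e) \<cdot>\<^bsub>C\<^esub> lft G e = l (tgt G e) \<cdot>\<^bsub>C\<^esub> rgt G e)"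

definition span_colimit :: "('o, 'a) cat \<Rightarrow> ('i, 'e, 'o, 'a) spans \<Rightarrow> 'o \<Rightarrow> ('i \<Rightarrow> 'a) \<Rightarrow> bool" where
  "span_colimit C G c l \<longleftrightarrow> span_cocone C G c l \<and>
     (\<forall>d m. span_cocone C G d m \<longrightarrow> (\<exists>!h. h \<in> hom C c d \<and> (\<forall>i \<in> Vert G. h \<cdot>\<^bsub>C\<^esub> l i = m i)))"

definition map_spans :: "('o, 'a, 'p, 'b) fctr \<Rightarrow> ('i, 'e, 'o, 'a) spans \<Rightarrow> ('i, 'e, 'p, 'b) spans" where
  "map_spans F G = \<lparr>Vert = Vert G, Edge = Edge G, vobj = (\<lambda>i. fobj F (vobj G i)),
     apex = (\<lambda>e. fobj F (apex G e)), src = src G, tgt = tgt G,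
     lft = (\<lambda>e. farr F (lft G e)), rgt = (\<lambda>e. farr F (rgt G e))\<rparr>"

lemma map_spans_simps [simp]:
  "Vert (map_spans F G) = Vert G" "Edge (map_spans F G) = Edge G"
  "vobj (map_spans F G) i = fobj F (vobj G i)" "apex (map_spans F G) e = fobj F (apex G e)"
  "src (map_spans F G) = src G" "tgt (map_spans F G) = tgt G"
  "lft (map_spans F G) e = farr F (lft G e)" "rgt (map_spans F G) e = farr F (rgt G e)"
  by (simp_all add: map_spans_def)

lemma spans_inD:
  assumes "spans_in C G"
  shows "i \<in> Vert G \<Longrightarrow> vobj G i \<in> Obj C"
    "e \<in> Edge G \<Longrightarrow> src G e \<in> Vert G" "e \<in> Edge G \<Longrightarrow> tgt G e \<in> Vert G"
    "e \<in> Edge G \<Longrightarrow> lft G e \<in> hom C (apex G e) (vobj G (src G e))"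
    "e \<in> Edge G \<Longrightarrow> rgt G e \<in> hom C (apex G e) (vobj G (tgt G e))"
  using assms by (auto simp: spans_in_def)

lemma span_coconeD:
  assumes "span_cocone C G c l"
  shows "c \<in> Obj C" "i \<in> Vert G \<Longrightarrow> l i \<in> hom C (vobj G i) c"
    "e \<in> Edge G \<Longrightarrow> l (src G e) \<cdot>\<^bsub>C\<^esub> lft G e = l (tgt G e) \<cdot>\<^bsub>C\<^esub> rgt G e"
  using assms by (auto simp: span_cocone_def)

lemma span_colimitD:
  assumes "span_colimit C G c l"
  shows "span_cocone C G c l"
    "span_cocone C G d m \<Longrightarrow> \<exists>!h. h \<in> hom C c d \<and> (\<forall>i \<in> Vert G. h \<cdot>\<^bsub>C\<^esub> l i = m i)"
  using assms by (auto simp: span_colimit_def)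

lemma spans_in_map:
  assumes F: "is_functor C D F" and G: "spans_in C G"
  shows "spans_in D (map_spans F G)"
  using functor_obj[OF F] functor_hom[OF F] spans_inD[OF G] unfolding spans_in_def by auto

lemma span_cocone_comp:
  assumes C: "category C" and G: "spans_in C G" and l: "span_cocone C G c l" and h: "h \<in> hom C c d"
  shows "span_cocone C G d (\<lambda>i. h \<cdot>\<^bsub>C\<^esub> l i)"
  unfolding span_cocone_def
proof (intro conjI ballI)
  show "d \<in> Obj C" using hom_obj[OF C h] by simp
  show "h \<cdot>\<^bsub>C\<^esub> l i \<in> hom C (vobj G i) d" if "i \<in> Vert G" for i
    using comp_hom[OF C span_coconeD(2)[OF l that] h] .
  fix e assume e: "e \<in> Edge G"
  note G' = spans_inD[OF G]
  show "h \<cdot>\<^bsub>C\<^esub> l (src G e) \<cdot>\<^bsub>C\<^esub> lft G e = h \<cdot>\<^bsub>C\<^esub> l (tgt G e) \<cdot>\<^bsub>C\<^esub> rgt G e"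
    using comp_assoc[OF C G'(4)[OF e] span_coconeD(2)[OF l G'(2)[OF e]] h]
      comp_assoc[OF C G'(5)[OF e] span_coconeD(2)[OF l G'(3)[OF e]] h] span_coconeD(3)[OF l e] by simp
qed

lemma span_colimit_jointly_epi:
  assumes C: "category C" and G: "spans_in C G" and l: "span_colimit C G c l"
    and u: "u \<in> hom C c d" and v: "v \<in> hom C c d"
    and eq: "\<And>i. i \<in> Vert G \<Longrightarrow> u \<cdot>\<^bsub>C\<^esub> l i = v \<cdot>\<^bsub>C\<^esub> l i"
  shows "u = v"
  using span_colimitD(2)[OF l span_cocone_comp[OF C G span_colimitD(1)[OF l] v]] u v eq by blast

lemma span_cocone_map:
  assumes F: "is_functor C D F" and G: "spans_in C G" and l: "span_cocone C G c l"
  shows "span_cocone D (map_spans F G) (fobj F c) (\<lambda>i. farr F (l i))"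
  unfolding span_cocone_def
proof (intro conjI ballI)
  show "fobj F c \<in> Obj D" using functor_obj[OF F span_coconeD(1)[OF l]] .
  show "farr F (l i) \<in> hom D (vobj (map_spans F G) i) (fobj F c)" if "i \<in> Vert (map_spans F G)" for i
    using functor_hom[OF F span_coconeD(2)[OF l]] that by simp
  fix e assume "e \<in> Edge (map_spans F G)"
  then have e: "e \<in> Edge G" by simp
  note G' = spans_inD[OF G]
  show "farr F (l (src (map_spans F G) e)) \<cdot>\<^bsub>D\<^esub> lft (map_spans F G) e =
      farr F (l (tgt (map_spans F G) e)) \<cdot>\<^bsub>D\<^esub> rgt (map_spans F G) e"
    using functor_comp[OF F G'(4)[OF e] span_coconeD(2)[OF l G'(2)[OF e]]]
      functor_comp[OF F G'(5)[OF e] span_coconeD(2)[OF l G'(3)[OF e]]] span_coconeD(3)[OF l e] by simp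
qed

lemma left_adjoint_preserves_colimit:
  assumes C: "category C" and D: "category D" and F: "left_adjoint C D F"
    and G: "spans_in C G" and l: "span_colimit C G c l"
  shows "span_colimit D (map_spans F G) (fobj F c) (\<lambda>i. farr F (l i))"
  unfolding span_colimit_def
proof (intro conjI allI impI)
  note fF = left_adjoint_functor[OF F] and l' = span_colimitD(1)[OF l]
  show "span_cocone D (map_spans F G) (fobj F c) (\<lambda>i. farr F (l i))"
    using span_cocone_map[OF fF G l'] .
  fix y m assume m: "span_cocone D (map_spans F G) y m"
  obtain r e where "universal_arrow C D F y r e"
    using left_adjoint_universal_arrow[OF C D F span_coconeD(1)[OF m]] .
  then have r: "r \<in> Obj C" and e: "e \<in> hom D (fobj F r) y"
    and univ: "\<And>x h. x \<in> Obj C \<Longrightarrow> h \<in> hom D (fobj F x) y \<Longrightarrow> \<exists>!u. u \<in> hom C x r \<and> e \<cdot>\<^bsub>D\<^esub> farr F u = h"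
    by (auto simp: universal_arrow_def)
  have unique: "u = v" if "u \<in> hom C x r" "v \<in> hom C x r" "e \<cdot>\<^bsub>D\<^esub> farr F u = e \<cdot>\<^bsub>D\<^esub> farr F v" for u v x
    using univ[OF hom_obj(1)[OF C that(1)] comp_hom[OF D functor_hom[OF fF that(1)] e]] that by metis
  have "\<exists>u. u \<in> hom C (vobj G i) r \<and> e \<cdot>\<^bsub>D\<^esub> farr F u = m i" if "i \<in> Vert G" for i
    using univ[OF spans_inD(1)[OF G that]] span_coconeD(2)[OF m] that by (metis map_spans_simps(1,3))
  then obtain u where u: "\<And>i. i \<in> Vert G \<Longrightarrow> u i \<in> hom C (vobj G i) r"
      "\<And>i. i \<in> Vert G \<Longrightarrow> e \<cdot>\<^bsub>D\<^esub> farr F (u i) = m i"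
    by metis
  have Fcomp: "e \<cdot>\<^bsub>D\<^esub> farr F (v \<cdot>\<^bsub>C\<^esub> w) = e \<cdot>\<^bsub>D\<^esub> farr F v \<cdot>\<^bsub>D\<^esub> farr F w" if "w \<in> hom C x x'" "v \<in> hom C x' r" for v w x x'
    using functor_comp[OF fF that] comp_assoc[OF D functor_hom[OF fF that(1)] functor_hom[OF fF that(2)] e] by simp
  have uc: "span_cocone C G r u"
    unfolding span_cocone_def
  proof (intro conjI ballI)
    fix d assume d: "d \<in> Edge G"
    note G' = spans_inD[OF G]
    have "e \<cdot>\<^bsub>D\<^esub> farr F (u (src G d) \<cdot>\<^bsub>C\<^esub> lft G d) = e \<cdot>\<^bsub>D\<^esub> farr F (u (tgt G d) \<cdot>\<^bsub>C\<^esub> rgt G d)"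
      using Fcomp[OF G'(4)[OF d] u(1)] Fcomp[OF G'(5)[OF d] u(1)] u(2) G'(2,3)[OF d]
        span_coconeD(3)[OF m, of d] d by simp
    then show "u (src G d) \<cdot>\<^bsub>C\<^esub> lft G d = u (tgt G d) \<cdot>\<^bsub>C\<^esub> rgt G d"
      using unique[OF comp_hom[OF C G'(4)[OF d] u(1)[OF G'(2)[OF d]]]
        comp_hom[OF C G'(5)[OF d] u(1)[OF G'(3)[OF d]]]] by blast
  qed (use r u in auto)
  obtain h where h: "h \<in> hom C c r" "\<And>i. i \<in> Vert G \<Longrightarrow> h \<cdot>\<^bsub>C\<^esub> l i = u i"
    using span_colimitD(2)[OF l uc] by blast
  show "\<exists>!k. k \<in> hom D (fobj F c) y \<and> (\<forall>i\<in>Vert (map_spans F G). k \<cdot>\<^bsub>D\<^esub> farr F (l i) = m i)"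
  proof (rule ex1I[of _ "e \<cdot>\<^bsub>D\<^esub> farr F h"])
    show "e \<cdot>\<^bsub>D\<^esub> farr F h \<in> hom D (fobj F c) y \<and>
        (\<forall>i\<in>Vert (map_spans F G). e \<cdot>\<^bsub>D\<^esub> farr F h \<cdot>\<^bsub>D\<^esub> farr F (l i) = m i)"
      using comp_hom[OF D functor_hom[OF fF h(1)] e] Fcomp[OF span_coconeD(2)[OF l'] h(1)] h(2) u(2)
      by (metis map_spans_simps(1))
    fix k assume k: "k \<in> hom D (fobj F c) y \<and> (\<forall>i\<in>Vert (map_spans F G). k \<cdot>\<^bsub>D\<^esub> farr F (l i) = m i)"
    obtain h' where h': "h' \<in> hom C c r" "e \<cdot>\<^bsub>D\<^esub> farr F h' = k"
      using univ[OF span_coconeD(1)[OF l'], of k] k by blast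
    have "h' \<cdot>\<^bsub>C\<^esub> l i = u i" if i: "i \<in> Vert G" for i
      using unique[OF comp_hom[OF C span_coconeD(2)[OF l' i] h'(1)] u(1)[OF i]]
        Fcomp[OF span_coconeD(2)[OF l' i] h'(1)] h'(2) k u(2)[OF i] i by simp
    then have "h' = h" using span_colimitD(2)[OF l uc] h h'(1) by blast
    then show "k = e \<cdot>\<^bsub>D\<^esub> farr F h" using h'(2) by simp
  qed
qed

text \<open>The index types are fixed to \<open>'k\<close> because a definition cannot quantify over types. By reindexing, all
  small index sets are covered (\<open>preserves_small_colimit\<close>).\<close>

definition preserves_small_colimits ::
    "'k rel \<Rightarrow> ('o, 'a) cat \<Rightarrow> ('p, 'b) cat \<Rightarrow> ('o, 'a, 'p, 'b) fctr \<Rightarrow> bool" where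
  "preserves_small_colimits \<kappa> C D F \<longleftrightarrow> (\<forall>(G :: ('k, 'k, 'o, 'a) spans) c l.
     spans_in C G \<and> small_spans \<kappa> G \<and> span_colimit C G c l \<longrightarrow>
     span_colimit D (map_spans F G) (fobj F c) (\<lambda>i. farr F (l i)))"

lemma left_adjoint_preserves_small_colimits:
  "category C \<Longrightarrow> category D \<Longrightarrow> left_adjoint C D F \<Longrightarrow> preserves_small_colimits \<kappa> C D F"
  unfolding preserves_small_colimits_def by (intro allI impI, elim conjE) (rule left_adjoint_preserves_colimit)

lemma preserves_small_colimit:
  fixes \<kappa> :: "'k rel" and G :: "('i, 'e, 'o, 'a) spans"
  assumes k: "regular_cardinal \<kappa>" and F: "preserves_small_colimits \<kappa> C D F"
    and G: "spans_in C G" "small_spans \<kappa> G" and l: "span_colimit C G c l"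
  shows "span_colimit D (map_spans F G) (fobj F c) (\<lambda>i. farr F (l i))"
proof -
  obtain f :: "'i \<Rightarrow> 'k" where f: "inj_on f (Vert G)"
    using small_injection[OF k] G(2) unfolding small_spans_def by metis
  obtain g :: "'e \<Rightarrow> 'k" where g: "inj_on g (Edge G)"
    using small_injection[OF k] G(2) unfolding small_spans_def by metis
  let ?f = "inv_into (Vert G) f" and ?g = "inv_into (Edge G) g"
  define R where "R = \<lparr>Vert = f ` Vert G, Edge = g ` Edge G, vobj = (\<lambda>i. vobj G (?f i)),
    apex = (\<lambda>e. apex G (?g e)), src = (\<lambda>e. f (src G (?g e))), tgt = (\<lambda>e. f (tgt G (?g e))),
    lft = (\<lambda>e. lft G (?g e)), rgt = (\<lambda>e. rgt G (?g e))\<rparr>"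
  have Rs: "Vert R = f ` Vert G" "Edge R = g ` Edge G" "\<And>i. vobj R i = vobj G (?f i)"
    "\<And>e. apex R e = apex G (?g e)" "\<And>e. src R e = f (src G (?g e))" "\<And>e. tgt R e = f (tgt G (?g e))"
    "\<And>e. lft R e = lft G (?g e)" "\<And>e. rgt R e = rgt G (?g e)"
    by (simp_all add: R_def)
  have ff: "?f (f x) = x" if "x \<in> Vert G" for x using f that by simp
  have gg: "?g (g a) = a" if "a \<in> Edge G" for a using g that by simp
  note G' = spans_inD[OF G(1)]
  have R: "spans_in C R" "small_spans \<kappa> R"
    using G(2) G' small_image[of "Vert G" \<kappa> f] small_image[of "Edge G" \<kappa> g]
    unfolding spans_in_def small_spans_def by (auto simp: Rs ff gg)
  have cocone: "span_cocone C R d m \<longleftrightarrow> span_cocone C G d (m \<circ> f)" for d m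
    using G' unfolding span_cocone_def by (auto simp: Rs ff gg)
  have cocone': "span_cocone D (map_spans F R) d m \<longleftrightarrow> span_cocone D (map_spans F G) d (m \<circ> f)" for d m
    using G' unfolding span_cocone_def by (auto simp: Rs ff gg)
  have "span_colimit C R c (l \<circ> ?f)"
    unfolding span_colimit_def
  proof (intro conjI allI impI)
    show "span_cocone C R c (l \<circ> ?f)"
      using span_colimitD(1)[OF l] G' unfolding cocone by (simp add: span_cocone_def ff)
    fix d m assume m: "span_cocone C R d m"
    show "\<exists>!h. h \<in> hom C c d \<and> (\<forall>i\<in>Vert R. h \<cdot>\<^bsub>C\<^esub> (l \<circ> ?f) i = m i)"
      using span_colimitD(2)[OF l m[unfolded cocone]] by (simp add: Rs ff)
  qed
  then have c: "span_colimit D (map_spans F R) (fobj F c) (\<lambda>i. farr F ((l \<circ> ?f) i))"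
    using F R unfolding preserves_small_colimits_def by blast
  show ?thesis
    unfolding span_colimit_def
  proof (intro conjI allI impI)
    show "span_cocone D (map_spans F G) (fobj F c) (\<lambda>i. farr F (l i))"
      using span_colimitD(1)[OF c] G' unfolding cocone' by (simp add: span_cocone_def ff)
    fix d m assume "span_cocone D (map_spans F G) d m"
    then have "span_cocone D (map_spans F R) d (m \<circ> ?f)"
      using G' unfolding cocone' by (simp add: span_cocone_def ff)
    from span_colimitD(2)[OF c this]
    show "\<exists>!h. h \<in> hom D (fobj F c) d \<and> (\<forall>i\<in>Vert (map_spans F G). h \<cdot>\<^bsub>D\<^esub> farr F (l i) = m i)"
      by (simp add: Rs ff)
  qed
qed

text \<open>The arrow \<open>u\<close> becomes the span with legs the identity and \<open>D u\<close>. A cocone then satisfies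
  \<open>l (Dom u) = l (Cod u) \<cdot> D u\<close>.\<close>

definition diagram_spans :: "('i, 'j) cat \<Rightarrow> ('o, 'a) cat \<Rightarrow> ('i, 'j, 'o, 'a) fctr \<Rightarrow> ('i, 'j, 'o, 'a) spans" where
  "diagram_spans J C D = \<lparr>Vert = Obj J, Edge = Arr J, vobj = fobj D, apex = (\<lambda>u. fobj D (Dom J u)),
     src = Dom J, tgt = Cod J, lft = (\<lambda>u. Id C (fobj D (Dom J u))), rgt = farr D\<rparr>"

lemma spans_in_diagram:
  "category C \<Longrightarrow> category J \<Longrightarrow> is_functor J C D \<Longrightarrow> spans_in C (diagram_spans J C D)"
  unfolding spans_in_def diagram_spans_def
  by (simp add: arr_obj functor_obj id_hom functor_hom[OF _ arr_hom])

lemma is_colimit_iff_span_colimit: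
  assumes C: "category C" and J: "category J" and D: "is_functor J C D"
  shows "is_colimit J C D c \<iota> \<longleftrightarrow> span_colimit C (diagram_spans J C D) c \<iota>"
proof -
  have "is_cocone J C D c \<iota> \<longleftrightarrow> span_cocone C (diagram_spans J C D) c \<iota>" for c \<iota>
    unfolding is_cocone_def span_cocone_def diagram_spans_def
    using comp_id_right[OF C] arr_obj[OF J] by (auto; metis)
  then show ?thesis
    unfolding is_colimit_def span_colimit_def by (simp add: diagram_spans_def)
qed

text \<open>The index category has the vertices and the edges as objects and two arrows out of each edge, to its
  two ends. Only identities are composable with these, so composition is trivial.\<close>

lemma span_colimit_exists:
  fixes \<kappa> :: "'k rel" and G :: "('i, 'e, 'o, 'a) spans"
  assumes k: "regular_cardinal \<kappa>" and C: "category C" and cc: "cocomplete \<kappa> C"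
    and G: "spans_in C G" "small_spans \<kappa> G"
  obtains c l where "span_colimit C G c l"
proof -
  note G' = spans_inD[OF G(1)]
  define J :: "('i + 'e, ('i + 'e) + ('e \<times> bool)) cat" where
    "J = \<lparr>Obj = Vert G <+> Edge G, Arr = (Vert G <+> Edge G) <+> (Edge G \<times> UNIV),
      Dom = case_sum id (\<lambda>(e, b). Inr e),
      Cod = case_sum id (\<lambda>(e, b). Inl (if b then src G e else tgt G e)),
      Id = Inl, Comp = (\<lambda>g f. case f of Inl _ \<Rightarrow> g | Inr _ \<Rightarrow> f)\<rparr>"
  have Js: "Obj J = Vert G <+> Edge G" "Arr J = (Vert G <+> Edge G) <+> (Edge G \<times> UNIV)"
    "\<And>x. Dom J (Inl x) = x" "\<And>x. Cod J (Inl x) = x" "\<And>e b. Dom J (Inr (e, b)) = Inr e"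
    "\<And>e b. Cod J (Inr (e, b)) = Inl (if b then src G e else tgt G e)" "\<And>x. Id J x = Inl x"
    "\<And>g x. g \<cdot>\<^bsub>J\<^esub> Inl x = g" "\<And>g y. g \<cdot>\<^bsub>J\<^esub> Inr y = Inr y"
    by (simp_all add: J_def)
  have J: "category J"
    unfolding category_def hom_def using G'(2,3) by (auto simp: Js)
  define D where "D = \<lparr>fobj = (\<lambda>x \<in> Obj J. case_sum (vobj G) (apex G) x),
    farr = (\<lambda>f \<in> Arr J. case f of Inl x \<Rightarrow> Id C (case_sum (vobj G) (apex G) x)
      | Inr (e, b) \<Rightarrow> if b then lft G e else rgt G e)\<rparr>"
  have Ds: "\<And>i. i \<in> Vert G \<Longrightarrow> fobj D (Inl i) = vobj G i" "\<And>e. e \<in> Edge G \<Longrightarrow> fobj D (Inr e) = apex G e"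
    "\<And>i. i \<in> Vert G \<Longrightarrow> farr D (Inl (Inl i)) = Id C (vobj G i)"
    "\<And>e. e \<in> Edge G \<Longrightarrow> farr D (Inl (Inr e)) = Id C (apex G e)"
    "\<And>e. e \<in> Edge G \<Longrightarrow> farr D (Inr (e, True)) = lft G e"
    "\<And>e. e \<in> Edge G \<Longrightarrow> farr D (Inr (e, False)) = rgt G e"
    by (simp_all add: D_def Js Plus_def)
  have ap: "apex G e \<in> Obj C" if "e \<in> Edge G" for e using hom_obj(1)[OF C G'(4)[OF that]] .
  have ids: "lft G e \<cdot>\<^bsub>C\<^esub> Id C (apex G e) = lft G e" "rgt G e \<cdot>\<^bsub>C\<^esub> Id C (apex G e) = rgt G e"
    "Id C (vobj G (src G e)) \<cdot>\<^bsub>C\<^esub> lft G e = lft G e" "Id C (vobj G (tgt G e)) \<cdot>\<^bsub>C\<^esub> rgt G e = rgt G e"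
    "Id C (apex G e) \<cdot>\<^bsub>C\<^esub> Id C (apex G e) = Id C (apex G e)" if "e \<in> Edge G" for e
    using comp_id_right[OF C G'(4)[OF that]] comp_id_right[OF C G'(5)[OF that]]
      comp_id_left[OF C G'(4)[OF that]] comp_id_left[OF C G'(5)[OF that]]
      comp_id_left[OF C id_hom[OF C ap[OF that]]] by simp_all
  have idv: "Id C (vobj G i) \<cdot>\<^bsub>C\<^esub> Id C (vobj G i) = Id C (vobj G i)" if "i \<in> Vert G" for i
    using comp_id_left[OF C id_hom[OF C G'(1)[OF that]]] .
  have D: "is_functor J C D"
  proof (rule functorI)
    fix f x y assume "f \<in> hom J x y"
    then show "farr D f \<in> hom C (fobj D x) (fobj D y)"
      using G' ap id_hom[OF C] by (auto simp: hom_def[of J] Js Ds)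
  next
    fix f g x y z assume "f \<in> hom J x y" "g \<in> hom J y z"
    then show "farr D (g \<cdot>\<^bsub>J\<^esub> f) = farr D g \<cdot>\<^bsub>C\<^esub> farr D f"
      using G'(2,3) by (auto simp: hom_def[of J] Js Ds ids idv split: if_splits)
  qed (use G' ap in \<open>auto simp: Js Ds, auto simp: D_def Js\<close>)
  have "|Edge G \<times> (UNIV :: bool set)| <o \<kappa>"
    using small_Sigma[OF k, of "Edge G" "\<lambda>_. UNIV :: bool set"] small_finite[OF k, of "UNIV :: bool set"] G(2)
    by (simp add: small_spans_def)
  then have "|Obj J| <o \<kappa>" "|Arr J| <o \<kappa>"
    using G(2) small_sum[OF k, of "Vert G" "Edge G"]
      small_sum[OF k, of "Vert G <+> Edge G" "Edge G \<times> (UNIV :: bool set)"]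
    by (simp_all add: Js small_spans_def)
  then obtain c \<iota> where colim: "is_colimit J C D c \<iota>"
    using small_colimit_exists[OF k C cc J _ _ D] by blast
  have cocone: "is_cocone J C D d m \<longleftrightarrow> span_cocone C G d (m \<circ> Inl) \<and>
      (\<forall>e \<in> Edge G. m (Inr e) \<in> hom C (apex G e) d \<and> m (Inl (src G e)) \<cdot>\<^bsub>C\<^esub> lft G e = m (Inr e))" for d m
  proof -
    have "m (Inl i) \<cdot>\<^bsub>C\<^esub> Id C (vobj G i) = m (Inl i)"
      if "\<forall>i\<in>Vert G. m (Inl i) \<in> hom C (vobj G i) d" "i \<in> Vert G" for i
      using that comp_id_right[OF C] by blast
    moreover have "m (Inr e) \<cdot>\<^bsub>C\<^esub> Id C (apex G e) = m (Inr e)"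
      if "\<forall>e\<in>Edge G. m (Inr e) \<in> hom C (apex G e) d" "e \<in> Edge G" for e
      using that comp_id_right[OF C] by blast
    ultimately show ?thesis
      unfolding is_cocone_def span_cocone_def
      by (auto simp: Js Ds ball_Un Plus_def split_paired_Ball_Sigma all_bool_eq)
  qed
  have "span_colimit C G c (\<iota> \<circ> Inl)"
    unfolding span_colimit_def
  proof (intro conjI allI impI)
    have i: "span_cocone C G c (\<iota> \<circ> Inl)" "\<And>e. e \<in> Edge G \<Longrightarrow> \<iota> (Inl (src G e)) \<cdot>\<^bsub>C\<^esub> lft G e = \<iota> (Inr e)"
      using colim cocone by (auto simp: is_colimit_def)
    show "span_cocone C G c (\<iota> \<circ> Inl)" by fact
    fix d m assume m: "span_cocone C G d m"
    define m' where "m' = case_sum m (\<lambda>e. m (src G e) \<cdot>\<^bsub>C\<^esub> lft G e)"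
    have "m' \<circ> Inl = m" by (auto simp: m'_def)
    then have "is_cocone J C D d m'"
      unfolding cocone using m G'(2) comp_hom[OF C G'(4) span_coconeD(2)[OF m G'(2)]]
      by (simp add: m'_def)
    then have ex: "\<exists>!h. h \<in> hom C c d \<and> (\<forall>j\<in>Obj J. h \<cdot>\<^bsub>C\<^esub> \<iota> j = m' j)"
      using colim by (simp add: is_colimit_def)
    have "(\<forall>j\<in>Obj J. h \<cdot>\<^bsub>C\<^esub> \<iota> j = m' j) \<longleftrightarrow> (\<forall>i\<in>Vert G. h \<cdot>\<^bsub>C\<^esub> (\<iota> \<circ> Inl) i = m i)"
      if h: "h \<in> hom C c d" for h
    proof -
      have "h \<cdot>\<^bsub>C\<^esub> \<iota> (Inr e) = h \<cdot>\<^bsub>C\<^esub> \<iota> (Inl (src G e)) \<cdot>\<^bsub>C\<^esub> lft G e" if "e \<in> Edge G" for e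
        using comp_assoc[OF C G'(4)[OF that] _ h, of "\<iota> (Inl (src G e))"] i(2)[OF that]
          span_coconeD(2)[OF i(1) G'(2)[OF that]] by simp
      then show ?thesis using G'(2) by (auto simp: Js m'_def Plus_def ball_Un)
    qed
    then show "\<exists>!h. h \<in> hom C c d \<and> (\<forall>i\<in>Vert G. h \<cdot>\<^bsub>C\<^esub> (\<iota> \<circ> Inl) i = m i)"
      using ex by (metis (no_types, lifting))
  qed
  then show thesis using that by blast
qed

section \<open>Colimit-preserving functors on locally presentable categories\<close>

text \<open>The consequence of local presentability that is used: every \<open>x\<close> is a small colimit of members of \<open>S\<close>
  such that each arrow from a member to \<open>x\<close> factors through the diagram. The factorization is what
  makes a family that is natural on \<open>S\<close> extend to a natural transformation.\<close>

definition generating_set :: "'k rel \<Rightarrow> ('o, 'a) cat \<Rightarrow> 'o set \<Rightarrow> bool" where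
  "generating_set \<kappa> B S \<longleftrightarrow> S \<subseteq> Obj B \<and> |S| <o \<kappa> \<and>
     (\<forall>x \<in> Obj B. \<exists>(J :: ('k, 'k) cat) D \<iota>.
        category_below \<kappa> J \<and> is_functor J B D \<and> (\<forall>j \<in> Obj J. fobj D j \<in> S) \<and> is_colimit J B D x \<iota> \<and>
        (\<forall>s \<in> S. \<forall>f \<in> hom B s x. \<exists>j \<in> Obj J. \<exists>u \<in> hom B s (fobj D j). \<iota> j \<cdot>\<^bsub>B\<^esub> u = f))"

lemma locally_presentableD:
  assumes "locally_presentable \<kappa> B"
  shows "category B" "cocomplete \<kappa> B" "x \<in> Obj B \<Longrightarrow> y \<in> Obj B \<Longrightarrow> |hom B x y| <o \<kappa>"
    "\<exists>S. generating_set \<kappa> B S"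
proof -
  show "category B" "cocomplete \<kappa> B" "x \<in> Obj B \<Longrightarrow> y \<in> Obj B \<Longrightarrow> |hom B x y| <o \<kappa>"
    using assms by (simp_all add: locally_presentable_def)
  obtain \<mu> :: "'a rel" and S where S: "|S| <o \<kappa>" "\<forall>s \<in> S. presentable \<kappa> \<mu> B s"
    and gen: "\<forall>x \<in> Obj B. \<exists>(J :: ('a, 'a) cat) D \<iota>. category_below \<kappa> J \<and> filtered \<mu> J \<and> is_functor J B D \<and>
           (\<forall>j \<in> Obj J. fobj D j \<in> S) \<and> is_colimit J B D x \<iota>"
    using assms unfolding locally_presentable_def by auto
  have "generating_set \<kappa> B S"
    unfolding generating_set_def
  proof (intro conjI ballI)
    show "S \<subseteq> Obj B" using S(2) by (auto simp: presentable_def)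
    show "|S| <o \<kappa>" by fact
    fix x assume "x \<in> Obj B"
    then obtain J :: "('a, 'a) cat" and D \<iota> where J: "category_below \<kappa> J" "filtered \<mu> J" "is_functor J B D"
      "\<forall>j \<in> Obj J. fobj D j \<in> S" "is_colimit J B D x \<iota>"
      using gen by blast
    have "\<exists>j \<in> Obj J. \<exists>u \<in> hom B s (fobj D j). \<iota> j \<cdot>\<^bsub>B\<^esub> u = f" if "s \<in> S" "f \<in> hom B s x" for s f
    proof -
      have "presentable \<kappa> \<mu> B s" using S(2) that(1) by blast
      then have "\<forall>f \<in> hom B s x. \<exists>j \<in> Obj J. \<exists>u \<in> hom B s (fobj D j). \<iota> j \<cdot>\<^bsub>B\<^esub> u = f"
        unfolding presentable_def using J(1,2,3,5) by blast
      then show ?thesis using that(2) by blast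
    qed
    then show "\<exists>(J :: ('a, 'a) cat) D \<iota>.
        category_below \<kappa> J \<and> is_functor J B D \<and> (\<forall>j \<in> Obj J. fobj D j \<in> S) \<and> is_colimit J B D x \<iota> \<and>
        (\<forall>s \<in> S. \<forall>f \<in> hom B s x. \<exists>j \<in> Obj J. \<exists>u \<in> hom B s (fobj D j). \<iota> j \<cdot>\<^bsub>B\<^esub> u = f)"
      using J by (intro exI[of _ J] exI[of _ D] exI[of _ \<iota>]) auto
  qed
  then show "\<exists>S. generating_set \<kappa> B S" by blast
qed

lemma generating_set_spans:
  fixes \<kappa> :: "'k rel"
  assumes B: "category B" and S: "generating_set \<kappa> B S" and x: "x \<in> Obj B"
  obtains G :: "('k, 'k, 'o, 'a) spans" and \<iota> where "spans_in B G" "small_spans \<kappa> G"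
    "span_colimit B G x \<iota>" "\<And>j. j \<in> Vert G \<Longrightarrow> vobj G j \<in> S"
    "\<And>e. e \<in> Edge G \<Longrightarrow> apex G e \<in> S"
    "\<And>s f. s \<in> S \<Longrightarrow> f \<in> hom B s x \<Longrightarrow> \<exists>j \<in> Vert G. \<exists>u \<in> hom B s (vobj G j). \<iota> j \<cdot>\<^bsub>B\<^esub> u = f"
proof -
  have "\<exists>(J :: ('k, 'k) cat) D \<iota>.
        category_below \<kappa> J \<and> is_functor J B D \<and> (\<forall>j \<in> Obj J. fobj D j \<in> S) \<and> is_colimit J B D x \<iota> \<and>
        (\<forall>s \<in> S. \<forall>f \<in> hom B s x. \<exists>j \<in> Obj J. \<exists>u \<in> hom B s (fobj D j). \<iota> j \<cdot>\<^bsub>B\<^esub> u = f)"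
    using S x unfolding generating_set_def by simp
  then obtain J :: "('k, 'k) cat" and D \<iota> where J: "category_below \<kappa> J" "is_functor J B D"
    "\<forall>j \<in> Obj J. fobj D j \<in> S" "is_colimit J B D x \<iota>"
    "\<forall>s \<in> S. \<forall>f \<in> hom B s x. \<exists>j \<in> Obj J. \<exists>u \<in> hom B s (fobj D j). \<iota> j \<cdot>\<^bsub>B\<^esub> u = f"
    by blast
  have cJ: "category J" using J(1) by (simp add: category_below_def)
  show thesis
  proof (rule that[of "diagram_spans J B D" \<iota>])
    show "spans_in B (diagram_spans J B D)" using spans_in_diagram[OF B cJ J(2)] .
    show "small_spans \<kappa> (diagram_spans J B D)"
      using J(1) by (simp add: small_spans_def category_below_def diagram_spans_def)
    show "span_colimit B (diagram_spans J B D) x \<iota>"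
      using J(4) is_colimit_iff_span_colimit[OF B cJ J(2)] by simp
  qed (use J(3,5) arr_obj[OF cJ] in \<open>auto simp: diagram_spans_def\<close>)
qed

text \<open>A weakly terminal object \<open>(w, e)\<close> of the comma category becomes terminal when all its endomorphisms
  are identified. Let \<open>q : w \<rightarrow> c\<close> be their joint coequalizer. Since \<open>P\<close> preserves it, \<open>c\<close> lies over
  \<open>d\<close> again. If \<open>r : c \<rightarrow> b\<close> is the coequalizer of two arrows into \<open>c\<close> over \<open>d\<close>, then \<open>b\<close> lies over
  \<open>d\<close> too and has an arrow \<open>s\<close> back to \<open>w\<close>. Now \<open>s \<cdot> r \<cdot> q\<close> is an endomorphism of \<open>w\<close>, so
  \<open>q \<cdot> s \<cdot> r \<cdot> q = q\<close>, hence \<open>r\<close> is split mono and the two arrows are equal.\<close>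

lemma universal_arrow_if_weakly_universal:
  fixes \<kappa> :: "'k rel"
  assumes k: "regular_cardinal \<kappa>" and A: "category A" and D: "category D"
    and cc: "cocomplete \<kappa> A" and P: "is_functor A D P" and pres: "preserves_small_colimits \<kappa> A D P"
    and w: "w \<in> Obj A" "|hom A w w| <o \<kappa>" and e: "e \<in> hom D (fobj P w) d"
    and weak: "\<And>a h. a \<in> Obj A \<Longrightarrow> h \<in> hom D (fobj P a) d \<Longrightarrow> \<exists>u \<in> hom A a w. e \<cdot>\<^bsub>D\<^esub> farr P u = h"
  shows "\<exists>r e'. universal_arrow A D P d r e'"
proof -
  note Ph = functor_hom[OF P] and Pc = functor_comp[OF P]
  \<comment> \<open>The endomorphisms of \<open>(w, e)\<close> over \<open>d\<close>, and the spans whose colimit identifies them with the identity.\<close>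
  define E where "E = {u \<in> hom A w w. e \<cdot>\<^bsub>D\<^esub> farr P u = e}"
  define G where "G = \<lparr>Vert = {()}, Edge = E, vobj = (\<lambda>_. w), apex = (\<lambda>_. w), src = (\<lambda>_. ()), tgt = (\<lambda>_. ()),
    lft = (\<lambda>u. u), rgt = (\<lambda>_. Id A w)\<rparr>"
  have Gs: "Vert G = {()}" "Edge G = E" "\<And>i. vobj G i = w" "\<And>i. apex G i = w" "\<And>u. src G u = ()" "\<And>u. tgt G u = ()"
    "\<And>u. lft G u = u" "\<And>u. rgt G u = Id A w" by (simp_all add: G_def)
  have G: "spans_in A G" using w id_hom[OF A] by (auto simp: spans_in_def Gs E_def)
  have sG: "small_spans \<kappa> G"
    using small_subset[OF w(2), of E] small_finite[OF k, of "{()}"] by (auto simp: small_spans_def Gs E_def)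
  obtain c l where l: "span_colimit A G c l" using span_colimit_exists[OF k A cc G sG] .
  define q where "q = l ()"
  have q: "q \<in> hom A w c" using span_coconeD(2)[OF span_colimitD(1)[OF l], of "()"] by (simp add: Gs q_def)
  have qu: "q \<cdot>\<^bsub>A\<^esub> u = q" if "u \<in> E" for u
    using span_coconeD(3)[OF span_colimitD(1)[OF l], of u] that comp_id_right[OF A q] by (simp add: Gs q_def)
  have q_epi: "u = v" if "u \<in> hom A c x" "v \<in> hom A c x" "u \<cdot>\<^bsub>A\<^esub> q = v \<cdot>\<^bsub>A\<^esub> q" for u v x
    using span_colimit_jointly_epi[OF A G l that(1,2)] that(3) by (simp add: Gs q_def)
  have c: "c \<in> Obj A" using hom_obj[OF A q] by simp
  have "span_cocone D (map_spans P G) d (\<lambda>_. e)"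
    using e w hom_obj[OF D e] functor_id[OF P] comp_id_right[OF D e]
    by (auto simp: span_cocone_def Gs E_def)
  from span_colimitD(2)[OF preserves_small_colimit[OF k pres G sG l] this]
  obtain e' where e': "e' \<in> hom D (fobj P c) d" "e' \<cdot>\<^bsub>D\<^esub> farr P q = e" by (auto simp: Gs q_def)
  have "f = g" if f: "f \<in> hom A a c" and g: "g \<in> hom A a c" and fg: "e' \<cdot>\<^bsub>D\<^esub> farr P f = e' \<cdot>\<^bsub>D\<^esub> farr P g" for f g a
  proof -
    define H where "H = \<lparr>Vert = {()}, Edge = {()}, vobj = (\<lambda>_. c), apex = (\<lambda>_. a), src = (\<lambda>_. ()), tgt = (\<lambda>_. ()),
      lft = (\<lambda>_. f), rgt = (\<lambda>_. g)\<rparr>"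
    have Hs: "Vert H = {()}" "Edge H = {()}" "\<And>i. vobj H i = c" "\<And>i. apex H i = a" "\<And>u. src H u = ()" "\<And>u. tgt H u = ()"
      "\<And>u. lft H u = f" "\<And>u. rgt H u = g" by (simp_all add: H_def)
    have H: "spans_in A H" using c f g by (auto simp: spans_in_def Hs)
    have sH: "small_spans \<kappa> H" using small_finite[OF k, of "{()}"] by (auto simp: small_spans_def Hs)
    obtain b m where m: "span_colimit A H b m" using span_colimit_exists[OF k A cc H sH] .
    define r where "r = m ()"
    have r: "r \<in> hom A c b" using span_coconeD(2)[OF span_colimitD(1)[OF m], of "()"] by (simp add: Hs r_def)
    have rfg: "r \<cdot>\<^bsub>A\<^esub> f = r \<cdot>\<^bsub>A\<^esub> g"
      using span_coconeD(3)[OF span_colimitD(1)[OF m], of "()"] by (simp add: Hs r_def)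
    have "span_cocone D (map_spans P H) d (\<lambda>_. e')"
      using e' hom_obj[OF D e] fg by (auto simp: span_cocone_def Hs)
    from span_colimitD(2)[OF preserves_small_colimit[OF k pres H sH m] this]
    obtain e'' where e'': "e'' \<in> hom D (fobj P b) d" "e'' \<cdot>\<^bsub>D\<^esub> farr P r = e'" by (auto simp: Hs r_def)
    obtain s where s: "s \<in> hom A b w" "e \<cdot>\<^bsub>D\<^esub> farr P s = e''"
      using weak[OF hom_obj(2)[OF A r] e''(1)] by blast
    note rq = comp_hom[OF A q r]
    note srq = comp_hom[OF A rq s(1)]
    have "e \<cdot>\<^bsub>D\<^esub> farr P (s \<cdot>\<^bsub>A\<^esub> (r \<cdot>\<^bsub>A\<^esub> q)) = e"
      using Pc[OF rq s(1)] Pc[OF q r] comp_assoc[OF D Ph[OF rq] Ph[OF s(1)] e]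
        comp_assoc[OF D Ph[OF q] Ph[OF r] e''(1)] s(2) e''(2) e'(2) by simp
    then have "q \<cdot>\<^bsub>A\<^esub> (s \<cdot>\<^bsub>A\<^esub> (r \<cdot>\<^bsub>A\<^esub> q)) = Id A c \<cdot>\<^bsub>A\<^esub> q"
      using qu srq comp_id_left[OF A q] by (simp add: E_def)
    then have "q \<cdot>\<^bsub>A\<^esub> s \<cdot>\<^bsub>A\<^esub> r \<cdot>\<^bsub>A\<^esub> q = Id A c \<cdot>\<^bsub>A\<^esub> q"
      using comp_assoc[OF A rq s(1) q] comp_assoc[OF A q r comp_hom[OF A s(1) q]] by simp
    then have split: "q \<cdot>\<^bsub>A\<^esub> s \<cdot>\<^bsub>A\<^esub> r = Id A c"
      using q_epi[OF comp_hom[OF A r comp_hom[OF A s(1) q]] id_hom[OF A c]] by blast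
    have "f = q \<cdot>\<^bsub>A\<^esub> s \<cdot>\<^bsub>A\<^esub> (r \<cdot>\<^bsub>A\<^esub> f)"
      using comp_assoc[OF A f r comp_hom[OF A s(1) q]] split comp_id_left[OF A f] by simp
    also have "\<dots> = g"
      using comp_assoc[OF A g r comp_hom[OF A s(1) q]] split comp_id_left[OF A g] rfg by simp
    finally show "f = g" .
  qed
  moreover have "\<exists>u. u \<in> hom A a c \<and> e' \<cdot>\<^bsub>D\<^esub> farr P u = h" if ah: "a \<in> Obj A" "h \<in> hom D (fobj P a) d" for a h
  proof -
    obtain u where u: "u \<in> hom A a w" "e \<cdot>\<^bsub>D\<^esub> farr P u = h" using weak[OF ah] by blast
    have "e' \<cdot>\<^bsub>D\<^esub> farr P (q \<cdot>\<^bsub>A\<^esub> u) = h"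
      using Pc[OF u(1) q] comp_assoc[OF D Ph[OF u(1)] Ph[OF q] e'(1)] e'(2) u(2) by simp
    then show ?thesis using comp_hom[OF A u(1) q] by blast
  qed
  ultimately have "universal_arrow A D P d c e'"
    unfolding universal_arrow_def using c e'(1) by (intro conjI ballI ex_ex1I) blast+
  then show ?thesis by blast
qed

text \<open>The colimit \<open>w\<close> of all generators \<open>s\<close> with an arrow \<open>h : P s \<rightarrow> d\<close> is weakly terminal over \<open>d\<close>: an
  object \<open>a\<close> over \<open>d\<close> is a colimit of generators, all of which lie over \<open>d\<close>, and the legs of \<open>w\<close>
  that belong to them form a cocone.\<close>

lemma adjoint_functor_theorem:
  fixes \<kappa> :: "'k rel" and A :: "('o, 'a) cat" and D :: "('p, 'b) cat"
  assumes k: "regular_cardinal \<kappa>" and lpA: "locally_presentable \<kappa> A" and D: "category D"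
    and homs: "\<And>x y. x \<in> Obj D \<Longrightarrow> y \<in> Obj D \<Longrightarrow> |hom D x y| <o \<kappa>"
    and P: "is_functor A D P" and pres: "preserves_small_colimits \<kappa> A D P"
  shows "left_adjoint A D P"
proof (rule left_adjoint_if_universal_arrows[OF _ D P])
  note A = locally_presentableD(1)[OF lpA] and cc = locally_presentableD(2)[OF lpA]
  show "category A" by fact
  note Ph = functor_hom[OF P] and Pc = functor_comp[OF P]
  obtain S where S: "generating_set \<kappa> A S" using locally_presentableD(4)[OF lpA] by blast
  have S': "S \<subseteq> Obj A" "|S| <o \<kappa>" using S by (simp_all add: generating_set_def)
  fix d assume d: "d \<in> Obj D"
  \<comment> \<open>The comma category of \<open>P\<close>, restricted to the generators, over \<open>d\<close>: pairs \<open>(s, h)\<close> with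
    \<open>h : P s \<rightarrow> d\<close>. An arrow \<open>f\<close> with target \<open>(s, h)\<close> has source \<open>(Dom f, h \<cdot> P f)\<close>.\<close>
  define V where "V = (SIGMA s : S. hom D (fobj P s) d)"
  define E where "E = (\<Union>s \<in> S. \<Union>s' \<in> S. hom A s s' \<times> hom D (fobj P s') d)"
  define G where "G = \<lparr>Vert = V, Edge = E, vobj = fst, apex = (\<lambda>(f, h). Dom A f),
    src = (\<lambda>(f, h). (Dom A f, h \<cdot>\<^bsub>D\<^esub> farr P f)), tgt = (\<lambda>(f, h). (Cod A f, h)),
    lft = (\<lambda>(f, h). Id A (Dom A f)), rgt = fst\<rparr>"
  have Gs: "Vert G = V" "Edge G = E" "\<And>s h. vobj G (s, h) = s" "\<And>f h. apex G (f, h) = Dom A f"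
    "\<And>f h. src G (f, h) = (Dom A f, h \<cdot>\<^bsub>D\<^esub> farr P f)" "\<And>f h. tgt G (f, h) = (Cod A f, h)"
    "\<And>f h. lft G (f, h) = Id A (Dom A f)" "\<And>f h. rgt G (f, h) = f"
    by (simp_all add: G_def)
  have VI: "(s, h) \<in> V \<longleftrightarrow> s \<in> S \<and> h \<in> hom D (fobj P s) d" for s h by (simp add: V_def)
  have EI: "(f, h) \<in> E \<longleftrightarrow> Dom A f \<in> S \<and> Cod A f \<in> S \<and> f \<in> Arr A \<and> h \<in> hom D (fobj P (Cod A f)) d" for f h
    by (auto simp: E_def hom_def)
  have G: "spans_in A G"
    unfolding spans_in_def Gs(1,2)
  proof (intro conjI ballI)
    fix e assume "e \<in> E"
    then obtain f h where e: "e = (f, h)" and f: "Dom A f \<in> S" "Cod A f \<in> S" "f \<in> Arr A"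
      and h: "h \<in> hom D (fobj P (Cod A f)) d" by (cases e) (simp add: EI)
    show "src G e \<in> V" using comp_hom[OF D Ph[OF arr_hom[OF f(3)]] h] f by (simp add: e Gs VI)
    show "tgt G e \<in> V" using f h by (simp add: e Gs VI)
    show "lft G e \<in> hom A (apex G e) (vobj G (src G e))" using f S' id_hom[OF A] by (auto simp: e Gs)
    show "rgt G e \<in> hom A (apex G e) (vobj G (tgt G e))" using f arr_hom by (auto simp: e Gs)
  qed (use S' in \<open>auto simp: V_def Gs\<close>)
  have "|V| <o \<kappa>"
    unfolding V_def
  proof (rule small_Sigma[OF k S'(2)])
    fix s assume "s \<in> S"
    then have "s \<in> Obj A" using S'(1) by blast
    then show "|hom D (fobj P s) d| <o \<kappa>" using homs[OF functor_obj[OF P] d] by simp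
  qed
  moreover have "|E| <o \<kappa>"
  proof -
    have "|SIGMA p : S \<times> S. hom A (fst p) (snd p) \<times> hom D (fobj P (snd p)) d| <o \<kappa>"
    proof (rule small_Sigma[OF k small_Sigma[OF k S'(2)]])
      fix p assume "p \<in> S \<times> S"
      then have p: "fst p \<in> Obj A" "snd p \<in> Obj A" using S'(1) by auto
      show "|hom A (fst p) (snd p) \<times> hom D (fobj P (snd p)) d| <o \<kappa>"
        by (rule small_Sigma[OF k locally_presentableD(3)[OF lpA p] homs[OF functor_obj[OF P p(2)] d]])
    qed (rule S'(2))
    then have "|snd ` (SIGMA p : S \<times> S. hom A (fst p) (snd p) \<times> hom D (fobj P (snd p)) d)| <o \<kappa>"
      by (rule small_image)
    moreover have "E = snd ` (SIGMA p : S \<times> S. hom A (fst p) (snd p) \<times> hom D (fobj P (snd p)) d)"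
      by (auto simp: E_def image_def)
    ultimately show ?thesis by simp
  qed
  ultimately have sG: "small_spans \<kappa> G" by (simp add: small_spans_def Gs)
  obtain w l where l: "span_colimit A G w l" using span_colimit_exists[OF k A cc G sG] .
  note l' = span_colimitD(1)[OF l]
  have w: "w \<in> Obj A" using span_coconeD(1)[OF l'] .
  have lh: "l (s, h) \<in> hom A s w" if "s \<in> S" "h \<in> hom D (fobj P s) d" for s h
    using span_coconeD(2)[OF l', of "(s, h)"] that by (simp add: Gs VI)
  have le: "l (s', h) \<cdot>\<^bsub>A\<^esub> f = l (s, h \<cdot>\<^bsub>D\<^esub> farr P f)"
    if "s \<in> S" "s' \<in> S" "f \<in> hom A s s'" "h \<in> hom D (fobj P s') d" for s s' f h
    using span_coconeD(3)[OF l', of "(f, h)"] that homD[OF that(3)]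
      comp_id_right[OF A lh[OF that(1) comp_hom[OF D Ph[OF that(3)] that(4)]]] by (simp add: Gs EI)
  have "span_cocone D (map_spans P G) d snd"
    unfolding span_cocone_def
  proof (intro conjI ballI)
    fix e assume "e \<in> Edge (map_spans P G)"
    then obtain f h where e: "e = (f, h)" and f: "Dom A f \<in> S" "Cod A f \<in> S" "f \<in> Arr A"
      and h: "h \<in> hom D (fobj P (Cod A f)) d" by (cases e) (simp add: EI Gs)
    have "h \<cdot>\<^bsub>D\<^esub> farr P f \<in> hom D (fobj P (Dom A f)) d" using comp_hom[OF D Ph[OF arr_hom[OF f(3)]] h] .
    then show "snd (src (map_spans P G) e) \<cdot>\<^bsub>D\<^esub> lft (map_spans P G) e =
        snd (tgt (map_spans P G) e) \<cdot>\<^bsub>D\<^esub> rgt (map_spans P G) e"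
      using functor_id[OF P, of "Dom A f"] f S'(1) comp_id_right[OF D] by (auto simp: e Gs)
  qed (use d in \<open>auto simp: Gs VI\<close>)
  from span_colimitD(2)[OF preserves_small_colimit[OF k pres G sG l] this]
  obtain \<epsilon> where e: "\<epsilon> \<in> hom D (fobj P w) d" and el: "\<forall>i \<in> V. \<epsilon> \<cdot>\<^bsub>D\<^esub> farr P (l i) = snd i"
    by (auto simp: Gs)
  show "\<exists>r e. universal_arrow A D P d r e"
  proof (rule universal_arrow_if_weakly_universal[OF k A D cc P pres w locally_presentableD(3)[OF lpA w w] e])
    fix a h assume a: "a \<in> Obj A" and h: "h \<in> hom D (fobj P a) d"
    obtain H :: "('k, 'k, 'o, 'a) spans" and \<iota> where H: "spans_in A H" "small_spans \<kappa> H" "span_colimit A H a \<iota>"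
      and HS: "\<And>j. j \<in> Vert H \<Longrightarrow> vobj H j \<in> S" "\<And>e. e \<in> Edge H \<Longrightarrow> apex H e \<in> S"
      using generating_set_spans[OF A S a] by metis
    note H' = spans_inD[OF H(1)] and i = span_coconeD[OF span_colimitD(1)[OF H(3)]]
    define m where "m j = l (vobj H j, h \<cdot>\<^bsub>D\<^esub> farr P (\<iota> j))" for j
    have hi: "h \<cdot>\<^bsub>D\<^esub> farr P (\<iota> j) \<in> hom D (fobj P (vobj H j)) d" if "j \<in> Vert H" for j
      using comp_hom[OF D Ph[OF i(2)[OF that]] h] .
    have m: "m j \<in> hom A (vobj H j) w" if "j \<in> Vert H" for j
      unfolding m_def using lh[OF HS(1)[OF that] hi[OF that]] .
    have "m (src H v) \<cdot>\<^bsub>A\<^esub> lft H v = m (tgt H v) \<cdot>\<^bsub>A\<^esub> rgt H v" if v: "v \<in> Edge H" for v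
    proof -
      note s = H'(2)[OF v] and t = H'(3)[OF v]
      have "h \<cdot>\<^bsub>D\<^esub> farr P (\<iota> (src H v)) \<cdot>\<^bsub>D\<^esub> farr P (lft H v) = h \<cdot>\<^bsub>D\<^esub> farr P (\<iota> (tgt H v)) \<cdot>\<^bsub>D\<^esub> farr P (rgt H v)"
        using comp_assoc[OF D Ph[OF H'(4)[OF v]] Ph[OF i(2)[OF s]] h]
          comp_assoc[OF D Ph[OF H'(5)[OF v]] Ph[OF i(2)[OF t]] h]
          Pc[OF H'(4)[OF v] i(2)[OF s]] Pc[OF H'(5)[OF v] i(2)[OF t]] i(3)[OF v] by simp
      then show ?thesis
        unfolding m_def using le[OF HS(2)[OF v] HS(1)[OF s] H'(4)[OF v] hi[OF s]]
          le[OF HS(2)[OF v] HS(1)[OF t] H'(5)[OF v] hi[OF t]] by simp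
    qed
    then have "span_cocone A H w m" using w m by (simp add: span_cocone_def)
    from span_colimitD(2)[OF H(3) this] obtain u where u: "u \<in> hom A a w" "\<And>j. j \<in> Vert H \<Longrightarrow> u \<cdot>\<^bsub>A\<^esub> \<iota> j = m j"
      by blast
    have "\<epsilon> \<cdot>\<^bsub>D\<^esub> farr P u = h"
    proof (rule span_colimit_jointly_epi[OF D spans_in_map[OF P H(1)] preserves_small_colimit[OF k pres H]])
      show "\<epsilon> \<cdot>\<^bsub>D\<^esub> farr P u \<in> hom D (fobj P a) d" using comp_hom[OF D Ph[OF u(1)] e] .
      fix j assume "j \<in> Vert (map_spans P H)"
      then have j: "j \<in> Vert H" by simp
      have "\<epsilon> \<cdot>\<^bsub>D\<^esub> farr P u \<cdot>\<^bsub>D\<^esub> farr P (\<iota> j) = \<epsilon> \<cdot>\<^bsub>D\<^esub> farr P (m j)"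
        using comp_assoc[OF D Ph[OF i(2)[OF j]] Ph[OF u(1)] e] Pc[OF i(2)[OF j] u(1)] u(2)[OF j] by simp
      also have "\<dots> = h \<cdot>\<^bsub>D\<^esub> farr P (\<iota> j)"
        unfolding m_def using el HS(1)[OF j] hi[OF j] by (simp add: V_def)
      finally show "\<epsilon> \<cdot>\<^bsub>D\<^esub> farr P u \<cdot>\<^bsub>D\<^esub> farr P (\<iota> j) = h \<cdot>\<^bsub>D\<^esub> farr P (\<iota> j)" .
    qed (rule h)
    then show "\<exists>u \<in> hom A a w. \<epsilon> \<cdot>\<^bsub>D\<^esub> farr P u = h" using u(1) by blast
  qed
qed

lemma ntrans_eq_if_eq_on_generators:
  fixes \<kappa> :: "'k rel" and B :: "('o, 'a) cat"
  assumes k: "regular_cardinal \<kappa>" and B: "category B" and D: "category D" and S: "generating_set \<kappa> B S"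
    and pres: "preserves_small_colimits \<kappa> B D P"
    and t: "\<tau> \<in> hom (functor_cat B D) P H" and s: "\<sigma> \<in> hom (functor_cat B D) P H"
    and eq: "\<And>s. s \<in> S \<Longrightarrow> ntmap \<tau> s = ntmap \<sigma> s"
  shows "\<tau> = \<sigma>"
proof (rule ntrans_eqI[OF t s])
  fix x assume x: "x \<in> Obj B"
  obtain G :: "('k, 'k, 'o, 'a) spans" and \<iota> where G: "spans_in B G" "small_spans \<kappa> G" "span_colimit B G x \<iota>"
    and GS: "\<And>j. j \<in> Vert G \<Longrightarrow> vobj G j \<in> S"
    using generating_set_spans[OF B S x] by metis
  note i = span_coconeD(2)[OF span_colimitD(1)[OF G(3)]]
  show "ntmap \<tau> x = ntmap \<sigma> x"
  proof (rule span_colimit_jointly_epi[OF D spans_in_map[OF ntrans_functor(1)[OF t] G(1)]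
      preserves_small_colimit[OF k pres G] ntrans_hom[OF t x] ntrans_hom[OF s x]])
    fix j assume "j \<in> Vert (map_spans P G)"
    then have j: "j \<in> Vert G" by simp
    show "ntmap \<tau> x \<cdot>\<^bsub>D\<^esub> farr P (\<iota> j) = ntmap \<sigma> x \<cdot>\<^bsub>D\<^esub> farr P (\<iota> j)"
      using ntrans_nat[OF t i[OF j]] ntrans_nat[OF s i[OF j]] eq[OF GS[OF j]] by simp
  qed
qed

text \<open>At an object \<open>x\<close>, the colimit of generators with legs \<open>\<iota> j\<close>, the component must be the arrow induced by
  the arrows \<open>H (\<iota> j) \<cdot> \<theta> j\<close>. Compatibility with all arrows from generators to \<open>x\<close>, not only with
  the legs, follows by factoring them through the diagram. It gives naturality.\<close>

lemma ntrans_extends_from_generators: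
  fixes \<kappa> :: "'k rel" and B :: "('o, 'a) cat"
  assumes k: "regular_cardinal \<kappa>" and B: "category B" and D: "category D" and S: "generating_set \<kappa> B S"
    and P: "is_functor B D P" and H: "is_functor B D H" and pres: "preserves_small_colimits \<kappa> B D P"
    and t: "\<And>s. s \<in> S \<Longrightarrow> \<theta> s \<in> hom D (fobj P s) (fobj H s)"
    and nat: "\<And>s s' f. s \<in> S \<Longrightarrow> s' \<in> S \<Longrightarrow> f \<in> hom B s s' \<Longrightarrow> \<theta> s' \<cdot>\<^bsub>D\<^esub> farr P f = farr H f \<cdot>\<^bsub>D\<^esub> \<theta> s"
  obtains \<tau> where "\<tau> \<in> hom (functor_cat B D) P H" "\<And>s. s \<in> S \<Longrightarrow> ntmap \<tau> s = \<theta> s"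
proof -
  note Ph = functor_hom[OF P] and Pc = functor_comp[OF P] and Hh = functor_hom[OF H] and Hc = functor_comp[OF H]
  have SO: "s \<in> Obj B" if "s \<in> S" for s using S that by (auto simp: generating_set_def)
  \<comment> \<open>The component at \<open>x\<close> is the one map that is compatible with all maps from generators to \<open>x\<close>.\<close>
  have comp: "\<exists>h. h \<in> hom D (fobj P x) (fobj H x) \<and>
      (\<forall>s \<in> S. \<forall>f \<in> hom B s x. h \<cdot>\<^bsub>D\<^esub> farr P f = farr H f \<cdot>\<^bsub>D\<^esub> \<theta> s)" if x: "x \<in> Obj B" for x
  proof -
    obtain G :: "('k, 'k, 'o, 'a) spans" and \<iota> where G: "spans_in B G" "small_spans \<kappa> G" "span_colimit B G x \<iota>"
      and GS: "\<And>j. j \<in> Vert G \<Longrightarrow> vobj G j \<in> S" "\<And>e. e \<in> Edge G \<Longrightarrow> apex G e \<in> S"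
      and fac: "\<And>s f. s \<in> S \<Longrightarrow> f \<in> hom B s x \<Longrightarrow> \<exists>j \<in> Vert G. \<exists>u \<in> hom B s (vobj G j). \<iota> j \<cdot>\<^bsub>B\<^esub> u = f"
      using generating_set_spans[OF B S x] by metis
    note G' = spans_inD[OF G(1)] and i = span_coconeD[OF span_colimitD(1)[OF G(3)]]
    have natH: "farr H (\<iota> j) \<cdot>\<^bsub>D\<^esub> \<theta> (vobj G j) \<cdot>\<^bsub>D\<^esub> farr P u = farr H (\<iota> j \<cdot>\<^bsub>B\<^esub> u) \<cdot>\<^bsub>D\<^esub> \<theta> s"
      if j: "j \<in> Vert G" and s: "s \<in> S" and u: "u \<in> hom B s (vobj G j)" for j s u
      using comp_assoc[OF D Ph[OF u] t[OF GS(1)[OF j]] Hh[OF i(2)[OF j]]] nat[OF s GS(1)[OF j] u]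
        comp_assoc[OF D t[OF s] Hh[OF u] Hh[OF i(2)[OF j]]] Hc[OF u i(2)[OF j]] by simp
    have "span_cocone D (map_spans P G) (fobj H x) (\<lambda>j. farr H (\<iota> j) \<cdot>\<^bsub>D\<^esub> \<theta> (vobj G j))"
      unfolding span_cocone_def
    proof (intro conjI ballI)
      show "fobj H x \<in> Obj D" using functor_obj[OF H x] .
      fix j assume "j \<in> Vert (map_spans P G)"
      then show "farr H (\<iota> j) \<cdot>\<^bsub>D\<^esub> \<theta> (vobj G j) \<in> hom D (vobj (map_spans P G) j) (fobj H x)"
        using comp_hom[OF D t[OF GS(1)] Hh[OF i(2)]] by simp
    next
      fix e assume "e \<in> Edge (map_spans P G)"
      then have e: "e \<in> Edge G" by simp
      show "farr H (\<iota> (src (map_spans P G) e)) \<cdot>\<^bsub>D\<^esub> \<theta> (vobj G (src (map_spans P G) e)) \<cdot>\<^bsub>D\<^esub> lft (map_spans P G) e =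
          farr H (\<iota> (tgt (map_spans P G) e)) \<cdot>\<^bsub>D\<^esub> \<theta> (vobj G (tgt (map_spans P G) e)) \<cdot>\<^bsub>D\<^esub> rgt (map_spans P G) e"
        using natH[OF G'(2)[OF e] GS(2)[OF e] G'(4)[OF e]] natH[OF G'(3)[OF e] GS(2)[OF e] G'(5)[OF e]]
          i(3)[OF e] by simp
    qed
    from span_colimitD(2)[OF preserves_small_colimit[OF k pres G] this]
    obtain h where h: "h \<in> hom D (fobj P x) (fobj H x)"
      "\<And>j. j \<in> Vert G \<Longrightarrow> h \<cdot>\<^bsub>D\<^esub> farr P (\<iota> j) = farr H (\<iota> j) \<cdot>\<^bsub>D\<^esub> \<theta> (vobj G j)" by auto
    have "h \<cdot>\<^bsub>D\<^esub> farr P f = farr H f \<cdot>\<^bsub>D\<^esub> \<theta> s" if s: "s \<in> S" and f: "f \<in> hom B s x" for s f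
    proof -
      obtain j u where j: "j \<in> Vert G" and u: "u \<in> hom B s (vobj G j)" and ju: "\<iota> j \<cdot>\<^bsub>B\<^esub> u = f"
        using fac[OF s f] by blast
      have "h \<cdot>\<^bsub>D\<^esub> farr P f = h \<cdot>\<^bsub>D\<^esub> farr P (\<iota> j) \<cdot>\<^bsub>D\<^esub> farr P u"
        using Pc[OF u i(2)[OF j]] comp_assoc[OF D Ph[OF u] Ph[OF i(2)[OF j]] h(1)] ju by simp
      then show ?thesis using h(2)[OF j] natH[OF j s u] ju by simp
    qed
    then show ?thesis using h(1) by blast
  qed
  define c where "c x = (SOME h. h \<in> hom D (fobj P x) (fobj H x) \<and>
      (\<forall>s \<in> S. \<forall>f \<in> hom B s x. h \<cdot>\<^bsub>D\<^esub> farr P f = farr H f \<cdot>\<^bsub>D\<^esub> \<theta> s))" for x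
  have c: "c x \<in> hom D (fobj P x) (fobj H x)" and
    cf: "\<And>s f. s \<in> S \<Longrightarrow> f \<in> hom B s x \<Longrightarrow> c x \<cdot>\<^bsub>D\<^esub> farr P f = farr H f \<cdot>\<^bsub>D\<^esub> \<theta> s" if "x \<in> Obj B" for x
    using someI_ex[OF comp[OF that]] unfolding c_def by blast+
  have "\<lparr>ntdom = P, ntcod = H, ntmap = restrict c (Obj B)\<rparr> \<in> hom (functor_cat B D) P H"
  proof (rule ntransI[OF P H])
    fix f x y assume f: "f \<in> hom B x y"
    note x = hom_obj(1)[OF B f] and y = hom_obj(2)[OF B f]
    obtain G :: "('k, 'k, 'o, 'a) spans" and \<iota> where G: "spans_in B G" "small_spans \<kappa> G" "span_colimit B G x \<iota>"
      and GS: "\<And>j. j \<in> Vert G \<Longrightarrow> vobj G j \<in> S"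
      using generating_set_spans[OF B S x] by metis
    note i = span_coconeD(2)[OF span_colimitD(1)[OF G(3)]]
    have "c y \<cdot>\<^bsub>D\<^esub> farr P f = farr H f \<cdot>\<^bsub>D\<^esub> c x"
    proof (rule span_colimit_jointly_epi[OF D spans_in_map[OF P G(1)] preserves_small_colimit[OF k pres G]
        comp_hom[OF D Ph[OF f] c[OF y]] comp_hom[OF D c[OF x] Hh[OF f]]])
      fix j assume "j \<in> Vert (map_spans P G)"
      then have j: "j \<in> Vert G" by simp
      have "c y \<cdot>\<^bsub>D\<^esub> farr P f \<cdot>\<^bsub>D\<^esub> farr P (\<iota> j) = farr H (f \<cdot>\<^bsub>B\<^esub> \<iota> j) \<cdot>\<^bsub>D\<^esub> \<theta> (vobj G j)"
        using comp_assoc[OF D Ph[OF i[OF j]] Ph[OF f] c[OF y]] Pc[OF i[OF j] f]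
          cf[OF y GS[OF j] comp_hom[OF B i[OF j] f]] by simp
      also have "\<dots> = farr H f \<cdot>\<^bsub>D\<^esub> c x \<cdot>\<^bsub>D\<^esub> farr P (\<iota> j)"
        using Hc[OF i[OF j] f] comp_assoc[OF D t[OF GS[OF j]] Hh[OF i[OF j]] Hh[OF f]]
          comp_assoc[OF D Ph[OF i[OF j]] c[OF x] Hh[OF f]] cf[OF x GS[OF j] i[OF j]] by simp
      finally show "c y \<cdot>\<^bsub>D\<^esub> farr P f \<cdot>\<^bsub>D\<^esub> farr P (\<iota> j) = farr H f \<cdot>\<^bsub>D\<^esub> c x \<cdot>\<^bsub>D\<^esub> farr P (\<iota> j)" .
    qed
    then show "ntmap \<lparr>ntdom = P, ntcod = H, ntmap = restrict c (Obj B)\<rparr> y \<cdot>\<^bsub>D\<^esub> farr P f =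
        farr H f \<cdot>\<^bsub>D\<^esub> ntmap \<lparr>ntdom = P, ntcod = H, ntmap = restrict c (Obj B)\<rparr> x" using x y by simp
  qed (use c in auto)
  moreover have "c s = \<theta> s" if s: "s \<in> S" for s
    using cf[OF SO[OF s] s id_hom[OF B SO[OF s]]] functor_id[OF P SO[OF s]] functor_id[OF H SO[OF s]]
      comp_id_right[OF D c[OF SO[OF s]]] comp_id_left[OF D t[OF s]] by simp
  ultimately show thesis using SO by (intro that) auto
qed

section \<open>Currying an adjunction of two variables\<close>

lemma bifunctor_hom:
  "is_functor (prod_cat A B) D F \<Longrightarrow> f \<in> hom A a a' \<Longrightarrow> g \<in> hom B b b' \<Longrightarrow>
     farr F (f, g) \<in> hom D (fobj F (a, b)) (fobj F (a', b'))"
  by (rule functor_hom[of "prod_cat A B"]) (simp_all add: hom_prod)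

lemma bifunctor_comp:
  "is_functor (prod_cat A B) D F \<Longrightarrow> f \<in> hom A a a' \<Longrightarrow> f' \<in> hom A a' a'' \<Longrightarrow>
     g \<in> hom B b b' \<Longrightarrow> g' \<in> hom B b' b'' \<Longrightarrow>
     farr F (f' \<cdot>\<^bsub>A\<^esub> f, g' \<cdot>\<^bsub>B\<^esub> g) = farr F (f', g') \<cdot>\<^bsub>D\<^esub> farr F (f, g)"
  using functor_comp[of "prod_cat A B" D F "(f, g)" "(a, b)" "(a', b')" "(f', g')" "(a'', b'')"]
  by (simp add: hom_prod)

lemma bifunctor_split:
  assumes A: "category A" and B: "category B" and F: "is_functor (prod_cat A B) D F"
    and f: "f \<in> hom A a a'" and g: "g \<in> hom B b b'"
  shows "farr F (f, Id B b') \<cdot>\<^bsub>D\<^esub> farr F (Id A a, g) = farr F (f, g)"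
    "farr F (Id A a', g) \<cdot>\<^bsub>D\<^esub> farr F (f, Id B b) = farr F (f, g)"
  using bifunctor_comp[OF F id_hom[OF A] f g id_hom[OF B]] bifunctor_comp[OF F f id_hom[OF A] id_hom[OF B] g]
    hom_obj[OF A f] hom_obj[OF B g] comp_id_left[OF A f] comp_id_right[OF A f]
    comp_id_left[OF B g] comp_id_right[OF B g] by simp_all

lemma curry_obj_simps [simp]:
  "a \<in> Obj A \<Longrightarrow> fobj (curry_obj A B F) a = partial_functor A B F a"
  "f \<in> Arr A \<Longrightarrow> ntdom (farr (curry_obj A B F) f) = partial_functor A B F (Dom A f)"
  "f \<in> Arr A \<Longrightarrow> ntcod (farr (curry_obj A B F) f) = partial_functor A B F (Cod A f)"
  "f \<in> Arr A \<Longrightarrow> b \<in> Obj B \<Longrightarrow> ntmap (farr (curry_obj A B F) f) b = farr F (f, Id B b)"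
  by (simp_all add: curry_obj_def)

lemma curry_obj_hom:
  assumes A: "category A" and B: "category B" and F: "is_functor (prod_cat A B) D F"
    and f: "f \<in> hom A a a'"
  shows "farr (curry_obj A B F) f \<in> hom (functor_cat B D) (partial_functor A B F a) (partial_functor A B F a')"
proof (rule ntransI[OF is_functor_partial[OF A B F hom_obj(1)[OF A f]] is_functor_partial[OF A B F hom_obj(2)[OF A f]]])
  show "ntmap (farr (curry_obj A B F) f) \<in> extensional (Obj B)"
    using homD(1)[OF f] by (simp add: curry_obj_def)
  fix b assume b: "b \<in> Obj B"
  show "ntmap (farr (curry_obj A B F) f) b \<in> hom D (fobj (partial_functor A B F a) b) (fobj (partial_functor A B F a') b)"
    using bifunctor_hom[OF F f id_hom[OF B b]] b homD(1)[OF f] by simp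
next
  fix g b b' assume g: "g \<in> hom B b b'"
  show "ntmap (farr (curry_obj A B F) f) b' \<cdot>\<^bsub>D\<^esub> farr (partial_functor A B F a) g =
      farr (partial_functor A B F a') g \<cdot>\<^bsub>D\<^esub> ntmap (farr (curry_obj A B F) f) b"
    using bifunctor_split[OF A B F f g] hom_obj[OF B g] homD(1)[OF f] homD(1)[OF g] by simp
qed (use homD[OF f] in simp_all)

lemma is_functor_curry_obj:
  assumes A: "category A" and B: "category B" and D: "category D" and F: "is_functor (prod_cat A B) D F"
    and adj: "\<And>a. a \<in> Obj A \<Longrightarrow> left_adjoint B D (partial_functor A B F a)"
  shows "is_functor A (LPr B D) (curry_obj A B F)"
proof (rule functorI)
  have h: "farr (curry_obj A B F) f \<in> hom (LPr B D) (partial_functor A B F a) (partial_functor A B F a')"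
    if "f \<in> hom A a a'" for f a a'
    using curry_obj_hom[OF A B F that] adj hom_obj[OF A that] by (simp add: hom_LPr)
  show "fobj (curry_obj A B F) \<in> extensional (Obj A)" "farr (curry_obj A B F) \<in> extensional (Arr A)"
    by (simp_all add: curry_obj_def)
  show "fobj (curry_obj A B F) a \<in> Obj (LPr B D)" if "a \<in> Obj A" for a using adj that by simp
  show "farr (curry_obj A B F) f \<in> hom (LPr B D) (fobj (curry_obj A B F) a) (fobj (curry_obj A B F) a')"
    if "f \<in> hom A a a'" for f a a'
    using h[OF that] hom_obj[OF A that] by simp
  show "farr (curry_obj A B F) (Id A a) = Id (LPr B D) (fobj (curry_obj A B F) a)" if a: "a \<in> Obj A" for a
  proof (rule ntrans_eqI[OF curry_obj_hom[OF A B F id_hom[OF A a]]])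
    show "Id (LPr B D) (fobj (curry_obj A B F) a) \<in> hom (functor_cat B D) (partial_functor A B F a) (partial_functor A B F a)"
      using functor_cat_id[OF B D is_functor_partial[OF A B F a]] a by (simp del: functor_cat_simps)
    show "ntmap (farr (curry_obj A B F) (Id A a)) b = ntmap (Id (LPr B D) (fobj (curry_obj A B F) a)) b"
      if "b \<in> Obj B" for b
      using functor_id[OF F, of "(a, b)"] a that homD(1)[OF id_hom[OF A a]] by simp
  qed
  fix f g a a' a'' assume f: "f \<in> hom A a a'" and g: "g \<in> hom A a' a''"
  note gf = comp_hom[OF A f g]
  show "farr (curry_obj A B F) (g \<cdot>\<^bsub>A\<^esub> f) = farr (curry_obj A B F) g \<cdot>\<^bsub>LPr B D\<^esub> farr (curry_obj A B F) f"
  proof (rule ntrans_eqI[OF curry_obj_hom[OF A B F gf]])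
    show "farr (curry_obj A B F) g \<cdot>\<^bsub>LPr B D\<^esub> farr (curry_obj A B F) f
        \<in> hom (functor_cat B D) (partial_functor A B F a) (partial_functor A B F a'')"
      using functor_cat_comp[OF B D curry_obj_hom[OF A B F f] curry_obj_hom[OF A B F g]] by simp
    fix b assume b: "b \<in> Obj B"
    show "ntmap (farr (curry_obj A B F) (g \<cdot>\<^bsub>A\<^esub> f)) b =
        ntmap (farr (curry_obj A B F) g \<cdot>\<^bsub>LPr B D\<^esub> farr (curry_obj A B F) f) b"
      using bifunctor_comp[OF F f g id_hom[OF B b] id_hom[OF B b]] comp_id_left[OF B id_hom[OF B b]]
        b homD(1)[OF f] homD(1)[OF g] homD(1)[OF gf] by simp
  qed
qed

lemma cocomplete_op:
  assumes "complete_cat \<kappa> C"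
  shows "cocomplete \<kappa> (op_cat C)"
  unfolding cocomplete_def
proof (intro allI impI, elim conjE)
  fix J :: "('a, 'a) cat" and D
  assume J: "category_below \<kappa> J" and D: "is_functor J (op_cat C) D"
  have "category_below \<kappa> (op_cat J)" using J category_op by (auto simp: category_below_def)
  moreover have "is_functor (op_cat J) C D" using D unfolding is_functor_def by (auto simp: hom_op)
  ultimately obtain c \<pi> where "is_limit (op_cat J) C D c \<pi>" using assms unfolding complete_cat_def by blast
  then have "is_colimit J (op_cat C) D c \<pi>"
    unfolding is_limit_def is_colimit_def is_cone_def is_cocone_def by (simp add: hom_op)
  then show "\<exists>c \<iota>. is_colimit J (op_cat C) D c \<iota>" by blast
qed

text \<open>The right adjoint sends \<open>H\<close> to the limit of \<open>G1(s, H s)\<close> over the generators \<open>s\<close> and the arrows between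
  them. A cone from \<open>a\<close> to this diagram consists of arrows \<open>a \<rightarrow> G1(s, H s)\<close>, that is of arrows
  \<open>F(a, s) \<rightarrow> H s\<close>, and the cone condition is naturality in \<open>s\<close>. So cones are transformations
  \<open>F(a, -) \<rightarrow> H\<close> restricted to the generators, and these extend uniquely to all of \<open>B\<close>.\<close>

lemma curry_obj_left_adjoint:
  fixes \<kappa> :: "'k rel" and A :: "('o1, 'a1) cat" and B :: "('o2, 'a2) cat" and D :: "('o, 'a) cat"
  assumes k: "regular_cardinal \<kappa>" and A: "category A" and cA: "complete_cat \<kappa> A"
    and lpB: "locally_presentable \<kappa> B" and D: "category D" and F: "two_var_left_adjoint A B D F"
  shows "left_adjoint A (LPr B D) (curry_obj A B F)"
proof -
  note B = locally_presentableD(1)[OF lpB]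
  have fF: "is_functor (prod_cat A B) D F" and adj: "\<And>a. a \<in> Obj A \<Longrightarrow> left_adjoint B D (partial_functor A B F a)"
    using F unfolding two_var_left_adjoint_iff[OF A B D] by blast+
  note Fh = bifunctor_hom[OF fF]
  obtain G1 \<phi> where G1_raw: "is_functor (prod_cat (op_cat B) D) A G1 \<and>
        (\<forall>a \<in> Obj A. \<forall>b \<in> Obj B. \<forall>y \<in> Obj D.
           bij_betw (\<phi> a b y) (hom D (fobj F (a, b)) y) (hom A a (fobj G1 (b, y)))) \<and>
        (\<forall>f \<in> Arr A. \<forall>g \<in> Arr B. \<forall>k \<in> Arr D. \<forall>h \<in> hom D (fobj F (Cod A f, Cod B g)) (Dom D k).
           \<phi> (Dom A f) (Dom B g) (Cod D k) (k \<cdot>\<^bsub>D\<^esub> h \<cdot>\<^bsub>D\<^esub> farr F (f, g)) =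
           farr G1 (g, k) \<cdot>\<^bsub>A\<^esub> \<phi> (Cod A f) (Cod B g) (Dom D k) h \<cdot>\<^bsub>A\<^esub> f)"
    using F[unfolded two_var_left_adjoint_def, THEN conjunct2, THEN conjunct1] by (elim exE) (rule that)
  then have G1: "is_functor (prod_cat (op_cat B) D) A G1"
    and bij: "\<And>a b y. a \<in> Obj A \<Longrightarrow> b \<in> Obj B \<Longrightarrow> y \<in> Obj D \<Longrightarrow>
           bij_betw (\<phi> a b y) (hom D (fobj F (a, b)) y) (hom A a (fobj G1 (b, y)))"
    by simp_all
  have nat: "\<And>f g k h. f \<in> Arr A \<Longrightarrow> g \<in> Arr B \<Longrightarrow> k \<in> Arr D \<Longrightarrow>
           h \<in> hom D (fobj F (Cod A f, Cod B g)) (Dom D k) \<Longrightarrow>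
           \<phi> (Dom A f) (Dom B g) (Cod D k) (k \<cdot>\<^bsub>D\<^esub> h \<cdot>\<^bsub>D\<^esub> farr F (f, g)) =
           farr G1 (g, k) \<cdot>\<^bsub>A\<^esub> \<phi> (Cod A f) (Cod B g) (Dom D k) h \<cdot>\<^bsub>A\<^esub> f"
    using G1_raw by simp
  have G1h: "farr G1 (g, k) \<in> hom A (fobj G1 (b', y)) (fobj G1 (b, y'))" if "g \<in> hom B b b'" "k \<in> hom D y y'" for g k b b' y y'
    using bifunctor_hom[OF G1, of g b' b k y y'] that by (simp add: hom_op)
  have G1o: "fobj G1 (b, y) \<in> Obj A" if "b \<in> Obj B" "y \<in> Obj D" for b y
    using functor_obj[OF G1, of "(b, y)"] that by simp
  have phi: "\<phi> a b y h \<in> hom A a (fobj G1 (b, y))" if "a \<in> Obj A" "b \<in> Obj B" "h \<in> hom D (fobj F (a, b)) y" for a b y h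
    using bij[OF that(1,2) hom_obj(2)[OF D that(3)]] that(3) by (auto simp: bij_betw_def)
  have phi_inj: "h = h'" if "a \<in> Obj A" "b \<in> Obj B" "h \<in> hom D (fobj F (a, b)) y" "h' \<in> hom D (fobj F (a, b)) y"
      "\<phi> a b y h = \<phi> a b y h'" for a b y h h'
    using bij[OF that(1,2) hom_obj(2)[OF D that(3)]] that(3-) by (auto simp: bij_betw_def inj_on_def)
  have nat1: "\<phi> a' b y (h \<cdot>\<^bsub>D\<^esub> farr F (u, Id B b)) = \<phi> a b y h \<cdot>\<^bsub>A\<^esub> u"
    if u: "u \<in> hom A a' a" and b: "b \<in> Obj B" and h: "h \<in> hom D (fobj F (a, b)) y" for u a a' b y h
  proof -
    note y = hom_obj(2)[OF D h] and a = hom_obj(2)[OF A u]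
    note p = phi[OF a b h]
    have "\<phi> a' b y (Id D y \<cdot>\<^bsub>D\<^esub> h \<cdot>\<^bsub>D\<^esub> farr F (u, Id B b)) = farr G1 (Id B b, Id D y) \<cdot>\<^bsub>A\<^esub> \<phi> a b y h \<cdot>\<^bsub>A\<^esub> u"
      using nat[of u "Id B b" "Id D y" h] homD[OF u] homD[OF id_hom[OF B b]] homD[OF id_hom[OF D y]] h by simp
    then show ?thesis
      using functor_id[OF G1, of "(b, y)"] b y comp_id_left[OF D h] comp_id_left[OF A p] by simp
  qed
  have nat2: "\<phi> a b y' (k \<cdot>\<^bsub>D\<^esub> h) = farr G1 (Id B b, k) \<cdot>\<^bsub>A\<^esub> \<phi> a b y h"
    if a: "a \<in> Obj A" and b: "b \<in> Obj B" and k: "k \<in> hom D y y'" and h: "h \<in> hom D (fobj F (a, b)) y" for a b y y' k h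
    using nat[of "Id A a" "Id B b" k h] homD[OF k] homD[OF id_hom[OF A a]] homD[OF id_hom[OF B b]] h
      functor_id[OF fF, of "(a, b)"] a b comp_id_right[OF D comp_hom[OF D h k]]
      comp_id_right[OF A comp_hom[OF A phi[OF a b h] G1h[OF id_hom[OF B b] k]]] by simp
  have nat3: "\<phi> a b' y (h \<cdot>\<^bsub>D\<^esub> farr F (Id A a, g)) = farr G1 (g, Id D y) \<cdot>\<^bsub>A\<^esub> \<phi> a b y h"
    if a: "a \<in> Obj A" and g: "g \<in> hom B b' b" and h: "h \<in> hom D (fobj F (a, b)) y" for a b b' y g h
    using nat[of "Id A a" g "Id D y" h] homD[OF g] homD[OF id_hom[OF A a]] homD[OF id_hom[OF D hom_obj(2)[OF D h]]] h
      comp_id_left[OF D h]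
      comp_id_right[OF A comp_hom[OF A phi[OF a hom_obj(2)[OF B g] h] G1h[OF g id_hom[OF D hom_obj(2)[OF D h]]]]]
    by simp
  obtain S where S: "generating_set \<kappa> B S" using locally_presentableD(4)[OF lpB] by blast
  have S': "S \<subseteq> Obj B" "|S| <o \<kappa>" using S by (simp_all add: generating_set_def)
  note fC = is_functor_curry_obj[OF A B D fF adj]
  show ?thesis
  proof (rule left_adjoint_if_universal_arrows[OF A category_LPr[OF B D] fC])
    fix H assume "H \<in> Obj (LPr B D)"
    then have H: "left_adjoint B D H" by simp
    note fH = left_adjoint_functor[OF H]
    note Hh = functor_hom[OF fH] and Ho = functor_obj[OF fH]
    \<comment> \<open>The end of \<open>G1(s, H s)\<close> over the generators \<open>s\<close>, as a colimit in the opposite category.\<close>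
    define G where "G = \<lparr>Vert = S, Edge = {f \<in> Arr B. Dom B f \<in> S \<and> Cod B f \<in> S},
      vobj = (\<lambda>s. fobj G1 (s, fobj H s)), apex = (\<lambda>f. fobj G1 (Dom B f, fobj H (Cod B f))),
      src = Dom B, tgt = Cod B,
      lft = (\<lambda>f. farr G1 (Id B (Dom B f), farr H f)), rgt = (\<lambda>f. farr G1 (f, Id D (fobj H (Cod B f))))\<rparr>"
    have Gs: "Vert G = S" "Edge G = {f \<in> Arr B. Dom B f \<in> S \<and> Cod B f \<in> S}"
      "\<And>s. vobj G s = fobj G1 (s, fobj H s)" "\<And>f. apex G f = fobj G1 (Dom B f, fobj H (Cod B f))"
      "\<And>f. src G f = Dom B f" "\<And>f. tgt G f = Cod B f"
      "\<And>f. lft G f = farr G1 (Id B (Dom B f), farr H f)" "\<And>f. rgt G f = farr G1 (f, Id D (fobj H (Cod B f)))"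
      by (simp_all add: G_def)
    have G: "spans_in (op_cat A) G"
      unfolding spans_in_def Gs hom_op
    proof (intro conjI ballI)
      fix f assume "f \<in> {f \<in> Arr B. Dom B f \<in> S \<and> Cod B f \<in> S}"
      then have f: "f \<in> Arr B" "Dom B f \<in> Obj B" "Cod B f \<in> Obj B" using S' by auto
      show "farr G1 (Id B (Dom B f), farr H f) \<in> hom A (fobj G1 (Dom B f, fobj H (Dom B f))) (fobj G1 (Dom B f, fobj H (Cod B f)))"
        using G1h[OF id_hom[OF B f(2)] Hh[OF arr_hom[OF f(1)]]] .
      show "farr G1 (f, Id D (fobj H (Cod B f))) \<in> hom A (fobj G1 (Cod B f, fobj H (Cod B f))) (fobj G1 (Dom B f, fobj H (Cod B f)))"
        using G1h[OF arr_hom[OF f(1)] id_hom[OF D Ho[OF f(3)]]] .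
    qed (use S' G1o Ho in auto)
    have "|\<Union>s \<in> S. \<Union>s' \<in> S. hom B s s'| <o \<kappa>"
    proof -
      have "|SIGMA p : S \<times> S. hom B (fst p) (snd p)| <o \<kappa>"
      proof (rule small_Sigma[OF k small_Sigma[OF k S'(2)]])
        fix p assume "p \<in> S \<times> S"
        then have p: "fst p \<in> Obj B" "snd p \<in> Obj B" using S'(1) by auto
        show "|hom B (fst p) (snd p)| <o \<kappa>" by (rule locally_presentableD(3)[OF lpB p])
      qed (rule S'(2))
      then have "|snd ` (SIGMA p : S \<times> S. hom B (fst p) (snd p))| <o \<kappa>" by (rule small_image)
      moreover have "(\<Union>s \<in> S. \<Union>s' \<in> S. hom B s s') = snd ` (SIGMA p : S \<times> S. hom B (fst p) (snd p))"
        by (auto simp: image_def)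
      ultimately show ?thesis by simp
    qed
    then have "|Edge G| <o \<kappa>" by (rule small_subset) (auto simp: Gs hom_def)
    then have sG: "small_spans \<kappa> G" using S' by (simp add: small_spans_def Gs)
    obtain r \<sigma> where colim: "span_colimit (op_cat A) G r \<sigma>"
      using span_colimit_exists[OF k category_op[OF A] cocomplete_op[OF cA] G sG] .
    note cocone = span_colimitD(1)[OF colim]
    have r: "r \<in> Obj A" using span_coconeD(1)[OF cocone] by simp
    have s: "\<sigma> s \<in> hom A r (fobj G1 (s, fobj H s))" if "s \<in> S" for s
      using span_coconeD(2)[OF cocone, of s] that by (simp add: Gs hom_op)
    \<comment> \<open>The cone condition at \<open>f\<close> is naturality at \<open>f\<close>, transported along the bijection \<open>\<phi>\<close>.\<close>
    have family: "farr G1 (Id B s, farr H f) \<cdot>\<^bsub>A\<^esub> \<phi> a s (fobj H s) h = farr G1 (f, Id D (fobj H s')) \<cdot>\<^bsub>A\<^esub> \<phi> a s' (fobj H s') h' \<longleftrightarrow>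
        farr H f \<cdot>\<^bsub>D\<^esub> h = h' \<cdot>\<^bsub>D\<^esub> farr F (Id A a, f)"
      if a: "a \<in> Obj A" and f: "f \<in> hom B s s'" and h: "h \<in> hom D (fobj F (a, s)) (fobj H s)"
        and h': "h' \<in> hom D (fobj F (a, s')) (fobj H s')" for a f s s' h h'
      using phi_inj[OF a hom_obj(1)[OF B f] comp_hom[OF D h Hh[OF f]] comp_hom[OF D Fh[OF id_hom[OF A a] f] h']]
        nat2[OF a hom_obj(1)[OF B f] Hh[OF f] h] nat3[OF a f h'] by metis
    \<comment> \<open>The limit cone, read as a natural family on the generators. It extends to the counit \<open>\<tau>\<close>.\<close>
    define \<epsilon> where "\<epsilon> s = (SOME h. h \<in> hom D (fobj F (r, s)) (fobj H s) \<and> \<phi> r s (fobj H s) h = \<sigma> s)" for s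
    have "\<exists>h. h \<in> hom D (fobj F (r, s)) (fobj H s) \<and> \<phi> r s (fobj H s) h = \<sigma> s" if "s \<in> S" for s
    proof -
      have "s \<in> Obj B" using that S' by blast
      then have "\<sigma> s \<in> \<phi> r s (fobj H s) ` hom D (fobj F (r, s)) (fobj H s)"
        using s[OF that] bij[OF r _ Ho] by (simp add: bij_betw_def)
      then show ?thesis by auto
    qed
    from someI_ex[OF this] have e: "\<epsilon> s \<in> hom D (fobj F (r, s)) (fobj H s)" "\<phi> r s (fobj H s) (\<epsilon> s) = \<sigma> s"
      if "s \<in> S" for s using that unfolding \<epsilon>_def by blast+
    have pres: "preserves_small_colimits \<kappa> B D (partial_functor A B F a)" if "a \<in> Obj A" for a
      using left_adjoint_preserves_small_colimits[OF B D adj[OF that]] .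
    obtain \<tau> where t: "\<tau> \<in> hom (functor_cat B D) (partial_functor A B F r) H" "\<And>s. s \<in> S \<Longrightarrow> ntmap \<tau> s = \<epsilon> s"
    proof (rule ntrans_extends_from_generators[OF k B D S is_functor_partial[OF A B fF r] fH pres[OF r]])
      show "\<epsilon> s \<in> hom D (fobj (partial_functor A B F r) s) (fobj H s)" if "s \<in> S" for s
        using e(1)[OF that] that S' by auto
      show "\<epsilon> s' \<cdot>\<^bsub>D\<^esub> farr (partial_functor A B F r) f = farr H f \<cdot>\<^bsub>D\<^esub> \<epsilon> s"
        if "s \<in> S" "s' \<in> S" "f \<in> hom B s s'" for s s' f
        using family[OF r that(3) e(1)[OF that(1)] e(1)[OF that(2)]] e(2)[OF that(1)] e(2)[OF that(2)]
          span_coconeD(3)[OF cocone, of f] homD[OF that(3)] that by (simp add: Gs)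
    qed blast
    have "\<exists>!u. u \<in> hom A a r \<and> \<tau> \<cdot>\<^bsub>LPr B D\<^esub> farr (curry_obj A B F) u = \<theta>"
      if a: "a \<in> Obj A" and "\<theta> \<in> hom (LPr B D) (fobj (curry_obj A B F) a) H" for a \<theta>
    proof -
      have th: "\<theta> \<in> hom (functor_cat B D) (partial_functor A B F a) H"
        using that by (simp add: hom_LPr)
      have th_s: "ntmap \<theta> s \<in> hom D (fobj F (a, s)) (fobj H s)" if "s \<in> Obj B" for s
        using ntrans_hom[OF th that] that by simp
      define m where "m s = \<phi> a s (fobj H s) (ntmap \<theta> s)" for s
      have "span_cocone (op_cat A) G a m"
        unfolding span_cocone_def
      proof (intro conjI ballI)
        fix s assume "s \<in> Vert G"
        then have "s \<in> Obj B" using S' by (auto simp: Gs)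
        then show "m s \<in> hom (op_cat A) (vobj G s) a" using phi[OF a _ th_s] by (simp add: m_def Gs hom_op)
      next
        fix f assume "f \<in> Edge G"
        then have f: "f \<in> hom B (Dom B f) (Cod B f)" by (simp add: Gs hom_def)
        note fo = hom_obj[OF B f]
        show "m (src G f) \<cdot>\<^bsub>op_cat A\<^esub> lft G f = m (tgt G f) \<cdot>\<^bsub>op_cat A\<^esub> rgt G f"
          using family[OF a f th_s[OF fo(1)] th_s[OF fo(2)]] ntrans_nat[OF th f] homD(1)[OF f]
          by (simp add: Gs m_def)
      qed (use a in simp)
      from span_colimitD(2)[OF colim this]
      have ex: "\<exists>!u. u \<in> hom A a r \<and> (\<forall>s \<in> S. \<sigma> s \<cdot>\<^bsub>A\<^esub> u = m s)" by (simp add: Gs hom_op)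
      \<comment> \<open>Factoring \<open>\<theta>\<close> through the counit is factoring its cone through the limit.\<close>
      have "\<tau> \<cdot>\<^bsub>LPr B D\<^esub> farr (curry_obj A B F) u = \<theta> \<longleftrightarrow> (\<forall>s \<in> S. \<sigma> s \<cdot>\<^bsub>A\<^esub> u = m s)" if u: "u \<in> hom A a r" for u
      proof -
        have 1: "\<tau> \<cdot>\<^bsub>LPr B D\<^esub> farr (curry_obj A B F) u \<in> hom (functor_cat B D) (partial_functor A B F a) H"
          using functor_cat_comp[OF B D curry_obj_hom[OF A B fF u] t(1)] by simp
        have 2: "ntmap (\<tau> \<cdot>\<^bsub>LPr B D\<^esub> farr (curry_obj A B F) u) s = ntmap \<theta> s \<longleftrightarrow> \<sigma> s \<cdot>\<^bsub>A\<^esub> u = m s" if s: "s \<in> S" for s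
        proof -
          have so: "s \<in> Obj B" using s S' by blast
          have "ntmap (\<tau> \<cdot>\<^bsub>LPr B D\<^esub> farr (curry_obj A B F) u) s = \<epsilon> s \<cdot>\<^bsub>D\<^esub> farr F (u, Id B s)"
            using so t(2)[OF s] homD(1)[OF u] by simp
          moreover have "\<epsilon> s \<cdot>\<^bsub>D\<^esub> farr F (u, Id B s) = ntmap \<theta> s \<longleftrightarrow> \<sigma> s \<cdot>\<^bsub>A\<^esub> u = m s"
            using phi_inj[OF a so comp_hom[OF D Fh[OF u id_hom[OF B so]] e(1)[OF s]] th_s[OF so]]
              nat1[OF u so e(1)[OF s]] e(2)[OF s] unfolding m_def by metis
          ultimately show ?thesis by simp
        qed
        show ?thesis
        proof
          assume "\<tau> \<cdot>\<^bsub>LPr B D\<^esub> farr (curry_obj A B F) u = \<theta>"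
          then show "\<forall>s \<in> S. \<sigma> s \<cdot>\<^bsub>A\<^esub> u = m s" using 2 by blast
        next
          assume "\<forall>s \<in> S. \<sigma> s \<cdot>\<^bsub>A\<^esub> u = m s"
          then show "\<tau> \<cdot>\<^bsub>LPr B D\<^esub> farr (curry_obj A B F) u = \<theta>"
            using ntrans_eq_if_eq_on_generators[OF k B D S pres[OF a] 1 th] 2 by blast
        qed
      qed
      then show ?thesis using ex by (metis (no_types, lifting))
    qed
    then have "universal_arrow A (LPr B D) (curry_obj A B F) H r \<tau>"
      unfolding universal_arrow_def using r t(1) adj[OF r] H by (simp add: hom_LPr)
    then show "\<exists>r e. universal_arrow A (LPr B D) (curry_obj A B F) H r e" by blast
  qed
qed

section \<open>Colimits of left adjoints are computed pointwise\<close>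

definition eval_functor ::
    "('o, 'a) cat \<Rightarrow> ('p, 'b) cat \<Rightarrow> 'o \<Rightarrow> (('o, 'a, 'p, 'b) fctr, ('o, 'a, 'p, 'b) ntrans, 'p, 'b) fctr" where
  "eval_functor B D b = \<lparr>fobj = (\<lambda>F \<in> Obj (LPr B D). fobj F b), farr = (\<lambda>\<tau> \<in> Arr (LPr B D). ntmap \<tau> b)\<rparr>"

lemma eval_functor_simps [simp]:
  "left_adjoint B D F \<Longrightarrow> fobj (eval_functor B D b) F = fobj F b"
  "\<tau> \<in> Arr (LPr B D) \<Longrightarrow> farr (eval_functor B D b) \<tau> = ntmap \<tau> b"
  by (simp_all add: eval_functor_def)

lemma is_functor_eval:
  assumes B: "category B" and D: "category D" and b: "b \<in> Obj B"
  shows "is_functor (LPr B D) D (eval_functor B D b)"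
proof (rule functorI)
  show "fobj (eval_functor B D b) \<in> extensional (Obj (LPr B D))"
    "farr (eval_functor B D b) \<in> extensional (Arr (LPr B D))"
    by (simp_all add: eval_functor_def)
  show "fobj (eval_functor B D b) F \<in> Obj D" if "F \<in> Obj (LPr B D)" for F
    using functor_obj[OF left_adjoint_functor b] that by simp
  show "farr (eval_functor B D b) f \<in> hom D (fobj (eval_functor B D b) x) (fobj (eval_functor B D b) y)"
    if "f \<in> hom (LPr B D) x y" for f x y
  proof -
    have "f \<in> hom (functor_cat B D) x y" "left_adjoint B D x" "left_adjoint B D y"
      using that by (simp_all add: hom_LPr)
    then show ?thesis using ntrans_hom[OF _ b] homD(1)[OF that] by simp
  qed
  show "farr (eval_functor B D b) (Id (LPr B D) F) = Id D (fobj (eval_functor B D b) F)"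
    if "F \<in> Obj (LPr B D)" for F
    using homD(1)[OF id_hom[OF category_LPr[OF B D] that]] that b by simp
  show "farr (eval_functor B D b) (g \<cdot>\<^bsub>LPr B D\<^esub> f) = farr (eval_functor B D b) g \<cdot>\<^bsub>D\<^esub> farr (eval_functor B D b) f"
    if "f \<in> hom (LPr B D) x y" "g \<in> hom (LPr B D) y z" for f g x y z
    using homD(1)[OF comp_hom[OF category_LPr[OF B D] that]] homD(1)[OF that(1)] homD(1)[OF that(2)] b by simp
qed

text \<open>The pointwise colimit \<open>Q\<close> of left adjoints preserves small colimits since colimits commute with
  colimits. Hence \<open>Q\<close> is itself a left adjoint, by the adjoint functor theorem on \<open>B\<close>.\<close>

lemma pointwise_colimit:
  fixes \<kappa> :: "'k rel" and B :: "('o, 'a) cat" and D :: "('p, 'b) cat"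
    and G :: "('k, 'k, ('o, 'a, 'p, 'b) fctr, ('o, 'a, 'p, 'b) ntrans) spans"
  assumes k: "regular_cardinal \<kappa>" and lpB: "locally_presentable \<kappa> B" and lpD: "locally_presentable \<kappa> D"
    and G: "spans_in (LPr B D) G" "small_spans \<kappa> G"
  obtains Q \<mu> where "span_cocone (LPr B D) G Q \<mu>"
    "\<And>b. b \<in> Obj B \<Longrightarrow> span_colimit D (map_spans (eval_functor B D b) G) (fobj Q b) (\<lambda>i. ntmap (\<mu> i) b)"
proof -
  note B = locally_presentableD(1)[OF lpB] and D = locally_presentableD(1)[OF lpD]
  note G' = spans_inD[OF G(1)]
  let ?G = "\<lambda>b. map_spans (eval_functor B D b) G"
  have X: "left_adjoint B D (vobj G i)" if "i \<in> Vert G" for i using G'(1)[OF that] by simp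
  have Y: "left_adjoint B D (apex G e)" if "e \<in> Edge G" for e
    using hom_obj(1)[OF category_LPr[OF B D] G'(4)[OF that]] by simp
  note Xh = functor_hom[OF left_adjoint_functor[OF X]] and Xc = functor_comp[OF left_adjoint_functor[OF X]]
  have lf: "lft G e \<in> hom (functor_cat B D) (apex G e) (vobj G (src G e))"
    and rg: "rgt G e \<in> hom (functor_cat B D) (apex G e) (vobj G (tgt G e))" if "e \<in> Edge G" for e
    using G'(4)[OF that] G'(5)[OF that] by (simp_all add: hom_LPr)
  have Gb: "spans_in D (?G b)" if "b \<in> Obj B" for b
    using spans_in_map[OF is_functor_eval[OF B D that] G(1)] .
  have Gv: "vobj (?G b) i = fobj (vobj G i) b" if "i \<in> Vert G" for b i using X[OF that] by simp
  have Ge: "lft (?G b) e = ntmap (lft G e) b" "rgt (?G b) e = ntmap (rgt G e) b" if "e \<in> Edge G" for b e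
    using homD(1)[OF G'(4)[OF that]] homD(1)[OF G'(5)[OF that]] by simp_all
  have cocone_iff: "span_cocone D (?G b) d m \<longleftrightarrow> d \<in> Obj D \<and> (\<forall>i \<in> Vert G. m i \<in> hom D (fobj (vobj G i) b) d) \<and>
      (\<forall>e \<in> Edge G. m (src G e) \<cdot>\<^bsub>D\<^esub> ntmap (lft G e) b = m (tgt G e) \<cdot>\<^bsub>D\<^esub> ntmap (rgt G e) b)" for b d m
    unfolding span_cocone_def using Gv Ge by simp
  have "\<exists>q m. span_colimit D (?G b) q m" if "b \<in> Obj B" for b
    using span_colimit_exists[OF k D locally_presentableD(2)[OF lpD] Gb[OF that]] G(2)
    by (metis map_spans_simps(1,2) small_spans_def)
  then obtain q m where colim: "\<And>b. b \<in> Obj B \<Longrightarrow> span_colimit D (?G b) (q b) (m b)" by metis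
  have q: "q b \<in> Obj D" and m: "\<And>i. i \<in> Vert G \<Longrightarrow> m b i \<in> hom D (fobj (vobj G i) b) (q b)"
    and me: "\<And>e. e \<in> Edge G \<Longrightarrow> m b (src G e) \<cdot>\<^bsub>D\<^esub> ntmap (lft G e) b = m b (tgt G e) \<cdot>\<^bsub>D\<^esub> ntmap (rgt G e) b"
    if "b \<in> Obj B" for b
    using span_colimitD(1)[OF colim[OF that]] unfolding cocone_iff by blast+
  have q_univ: "\<exists>!h. h \<in> hom D (q b) d \<and> (\<forall>i \<in> Vert G. h \<cdot>\<^bsub>D\<^esub> m b i = \<theta> i)"
    if "b \<in> Obj B" "span_cocone D (?G b) d \<theta>" for b d \<theta>
    using span_colimitD(2)[OF colim[OF that(1)] that(2)] by simp
  have q_unique: "u = v" if "b \<in> Obj B" "u \<in> hom D (q b) d" "v \<in> hom D (q b) d"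
      "\<And>i. i \<in> Vert G \<Longrightarrow> u \<cdot>\<^bsub>D\<^esub> m b i = v \<cdot>\<^bsub>D\<^esub> m b i" for b d u v
    using span_colimit_jointly_epi[OF D Gb colim that(2,3)] that(1,4) by simp
  have "\<exists>h. h \<in> hom D (q b) (q b') \<and> (\<forall>i \<in> Vert G. h \<cdot>\<^bsub>D\<^esub> m b i = m b' i \<cdot>\<^bsub>D\<^esub> farr (vobj G i) g)"
    if g: "g \<in> hom B b b'" for g b b'
  proof -
    note b = hom_obj(1)[OF B g] and b' = hom_obj(2)[OF B g]
    have "span_cocone D (?G b) (q b') (\<lambda>i. m b' i \<cdot>\<^bsub>D\<^esub> farr (vobj G i) g)"
      unfolding cocone_iff
    proof (intro conjI ballI)
      fix e assume e: "e \<in> Edge G"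
      note s = G'(2)[OF e] and t = G'(3)[OF e]
      show "m b' (src G e) \<cdot>\<^bsub>D\<^esub> farr (vobj G (src G e)) g \<cdot>\<^bsub>D\<^esub> ntmap (lft G e) b =
          m b' (tgt G e) \<cdot>\<^bsub>D\<^esub> farr (vobj G (tgt G e)) g \<cdot>\<^bsub>D\<^esub> ntmap (rgt G e) b"
        using comp_assoc[OF D ntrans_hom[OF lf[OF e] b] Xh[OF s g] m[OF b' s]]
          comp_assoc[OF D ntrans_hom[OF rg[OF e] b] Xh[OF t g] m[OF b' t]]
          ntrans_nat[OF lf[OF e] g] ntrans_nat[OF rg[OF e] g] me[OF b' e]
          comp_assoc[OF D functor_hom[OF left_adjoint_functor[OF Y[OF e]] g] ntrans_hom[OF lf[OF e] b'] m[OF b' s]]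
          comp_assoc[OF D functor_hom[OF left_adjoint_functor[OF Y[OF e]] g] ntrans_hom[OF rg[OF e] b'] m[OF b' t]]
        by simp
    qed (use q[OF b'] comp_hom[OF D Xh[OF _ g] m[OF b']] in auto)
    from q_univ[OF b this] show ?thesis by blast
  qed
  then obtain qa where "\<forall>g b b'. g \<in> hom B b b' \<longrightarrow> qa g b b' \<in> hom D (q b) (q b') \<and>
      (\<forall>i \<in> Vert G. qa g b b' \<cdot>\<^bsub>D\<^esub> m b i = m b' i \<cdot>\<^bsub>D\<^esub> farr (vobj G i) g)"
    by metis
  then have qa: "qa g b b' \<in> hom D (q b) (q b')"
      "\<And>i. i \<in> Vert G \<Longrightarrow> qa g b b' \<cdot>\<^bsub>D\<^esub> m b i = m b' i \<cdot>\<^bsub>D\<^esub> farr (vobj G i) g" if "g \<in> hom B b b'" for g b b'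
    using that by blast+
  define Q where "Q = \<lparr>fobj = restrict q (Obj B), farr = (\<lambda>g \<in> Arr B. qa g (Dom B g) (Cod B g))\<rparr>"
  have Qo: "fobj Q b = q b" if "b \<in> Obj B" for b using that by (simp add: Q_def)
  have Qa: "farr Q g = qa g b b'" if "g \<in> hom B b b'" for g b b' using homD[OF that] by (simp add: Q_def)
  have Qh: "farr Q g \<in> hom D (q b) (q b')"
    and Qm: "\<And>i. i \<in> Vert G \<Longrightarrow> farr Q g \<cdot>\<^bsub>D\<^esub> m b i = m b' i \<cdot>\<^bsub>D\<^esub> farr (vobj G i) g" if "g \<in> hom B b b'" for g b b'
    using qa[OF that] Qa[OF that] by simp_all
  have Q: "is_functor B D Q"
  proof (rule functorI)
    fix b assume b: "b \<in> Obj B"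
    have "farr Q (Id B b) = Id D (q b)"
    proof (rule q_unique[OF b Qh[OF id_hom[OF B b]] id_hom[OF D q[OF b]]])
      fix i assume i: "i \<in> Vert G"
      show "farr Q (Id B b) \<cdot>\<^bsub>D\<^esub> m b i = Id D (q b) \<cdot>\<^bsub>D\<^esub> m b i"
        using Qm[OF id_hom[OF B b] i] functor_id[OF left_adjoint_functor[OF X[OF i]] b]
          comp_id_right[OF D m[OF b i]] comp_id_left[OF D m[OF b i]] by simp
    qed
    then show "farr Q (Id B b) = Id D (fobj Q b)" using Qo[OF b] by simp
  next
    fix f g x y z assume f: "f \<in> hom B x y" and g: "g \<in> hom B y z"
    note x = hom_obj(1)[OF B f] and y = hom_obj(2)[OF B f] and z = hom_obj(2)[OF B g]
    note fg = comp_hom[OF B f g]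
    show "farr Q (g \<cdot>\<^bsub>B\<^esub> f) = farr Q g \<cdot>\<^bsub>D\<^esub> farr Q f"
    proof (rule q_unique[OF x Qh[OF fg] comp_hom[OF D Qh[OF f] Qh[OF g]]])
      fix i assume i: "i \<in> Vert G"
      have "farr Q g \<cdot>\<^bsub>D\<^esub> farr Q f \<cdot>\<^bsub>D\<^esub> m x i = m z i \<cdot>\<^bsub>D\<^esub> farr (vobj G i) g \<cdot>\<^bsub>D\<^esub> farr (vobj G i) f"
        using comp_assoc[OF D m[OF x i] Qh[OF f] Qh[OF g]] Qm[OF f i]
          comp_assoc[OF D Xh[OF i f] m[OF y i] Qh[OF g]] Qm[OF g i] by simp
      also have "\<dots> = m z i \<cdot>\<^bsub>D\<^esub> farr (vobj G i) (g \<cdot>\<^bsub>B\<^esub> f)"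
        using comp_assoc[OF D Xh[OF i f] Xh[OF i g] m[OF z i]] Xc[OF i f g] by simp
      finally show "farr Q (g \<cdot>\<^bsub>B\<^esub> f) \<cdot>\<^bsub>D\<^esub> m x i = farr Q g \<cdot>\<^bsub>D\<^esub> farr Q f \<cdot>\<^bsub>D\<^esub> m x i" using Qm[OF fg i] by simp
    qed
  next
    fix g b b' assume g: "g \<in> hom B b b'"
    then show "farr Q g \<in> hom D (fobj Q b) (fobj Q b')" using Qh[OF g] Qo hom_obj[OF B g] by simp
  qed (use q Qo in \<open>auto simp: Q_def\<close>)
  have pres: "preserves_small_colimits \<kappa> B D Q"
    unfolding preserves_small_colimits_def
  proof (intro allI impI, elim conjE)
    fix H :: "('k, 'k, 'o, 'a) spans" and b \<nu>
    assume H: "spans_in B H" and "small_spans \<kappa> H" and nu: "span_colimit B H b \<nu>"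
    note H' = spans_inD[OF H] and nu' = span_coconeD[OF span_colimitD(1)[OF nu]]
    note b = nu'(1)
    have X_colim: "span_colimit D (map_spans (vobj G i) H) (fobj (vobj G i) b) (\<lambda>j. farr (vobj G i) (\<nu> j))"
      if "i \<in> Vert G" for i
      using left_adjoint_preserves_colimit[OF B D X[OF that] H nu] .
    \<comment> \<open>Agreement of arrows out of the \<open>Y e\<close> and \<open>X i\<close> at \<open>b\<close> can be tested on the colimit diagram of \<open>b\<close>,
      because these functors are left adjoints.\<close>
    have Y_epi: "u = v" if e: "e \<in> Edge G" and u: "u \<in> hom D (fobj (apex G e) b) d" and v: "v \<in> hom D (fobj (apex G e) b) d"
        and eq: "\<And>j. j \<in> Vert H \<Longrightarrow> u \<cdot>\<^bsub>D\<^esub> farr (apex G e) (\<nu> j) = v \<cdot>\<^bsub>D\<^esub> farr (apex G e) (\<nu> j)" for e u v d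
      using span_colimit_jointly_epi[OF D spans_in_map[OF left_adjoint_functor[OF Y[OF e]] H]
        left_adjoint_preserves_colimit[OF B D Y[OF e] H nu] u v] eq by simp
    have X_epi: "u = v" if i: "i \<in> Vert G" and u: "u \<in> hom D (fobj (vobj G i) b) d" and v: "v \<in> hom D (fobj (vobj G i) b) d"
        and eq: "\<And>j. j \<in> Vert H \<Longrightarrow> u \<cdot>\<^bsub>D\<^esub> farr (vobj G i) (\<nu> j) = v \<cdot>\<^bsub>D\<^esub> farr (vobj G i) (\<nu> j)" for i u v d
      using span_colimit_jointly_epi[OF D spans_in_map[OF left_adjoint_functor[OF X[OF i]] H]
        X_colim[OF i] u v] eq by simp
    show "span_colimit D (map_spans Q H) (fobj Q b) (\<lambda>j. farr Q (\<nu> j))"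
      unfolding span_colimit_def
    proof (intro conjI allI impI)
      show "span_cocone D (map_spans Q H) (fobj Q b) (\<lambda>j. farr Q (\<nu> j))"
        using span_cocone_map[OF Q H span_colimitD(1)[OF nu]] .
      fix d \<theta> assume th: "span_cocone D (map_spans Q H) d \<theta>"
      have d: "d \<in> Obj D" using span_coconeD(1)[OF th] .
      have th_h: "\<theta> j \<in> hom D (q (vobj H j)) d" if "j \<in> Vert H" for j
        using span_coconeD(2)[OF th, of j] that Qo[OF H'(1)[OF that]] by simp
      have "\<exists>h. h \<in> hom D (fobj (vobj G i) b) d \<and>
          (\<forall>j \<in> Vert H. h \<cdot>\<^bsub>D\<^esub> farr (vobj G i) (\<nu> j) = \<theta> j \<cdot>\<^bsub>D\<^esub> m (vobj H j) i)" if i: "i \<in> Vert G" for i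
      proof -
        have "span_cocone D (map_spans (vobj G i) H) d (\<lambda>j. \<theta> j \<cdot>\<^bsub>D\<^esub> m (vobj H j) i)"
          unfolding span_cocone_def
        proof (intro conjI ballI)
          fix j assume "j \<in> Vert (map_spans (vobj G i) H)"
          then show "\<theta> j \<cdot>\<^bsub>D\<^esub> m (vobj H j) i \<in> hom D (vobj (map_spans (vobj G i) H) j) d"
            using comp_hom[OF D m[OF H'(1) i] th_h] by simp
        next
          fix e assume "e \<in> Edge (map_spans (vobj G i) H)"
          then have e: "e \<in> Edge H" by simp
          note s = H'(2)[OF e] and t = H'(3)[OF e]
          note a = hom_obj(1)[OF B H'(4)[OF e]]
          have "\<theta> (src H e) \<cdot>\<^bsub>D\<^esub> m (vobj H (src H e)) i \<cdot>\<^bsub>D\<^esub> farr (vobj G i) (lft H e) =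
              \<theta> (src H e) \<cdot>\<^bsub>D\<^esub> farr Q (lft H e) \<cdot>\<^bsub>D\<^esub> m (apex H e) i"
            using comp_assoc[OF D Xh[OF i H'(4)[OF e]] m[OF H'(1)[OF s] i] th_h[OF s]] Qm[OF H'(4)[OF e] i]
              comp_assoc[OF D m[OF a i] Qh[OF H'(4)[OF e]] th_h[OF s]] by simp
          also have "\<dots> = \<theta> (tgt H e) \<cdot>\<^bsub>D\<^esub> farr Q (rgt H e) \<cdot>\<^bsub>D\<^esub> m (apex H e) i"
            using span_coconeD(3)[OF th, of e] e by simp
          also have "\<dots> = \<theta> (tgt H e) \<cdot>\<^bsub>D\<^esub> m (vobj H (tgt H e)) i \<cdot>\<^bsub>D\<^esub> farr (vobj G i) (rgt H e)"
            using comp_assoc[OF D Xh[OF i H'(5)[OF e]] m[OF H'(1)[OF t] i] th_h[OF t]] Qm[OF H'(5)[OF e] i]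
              comp_assoc[OF D m[OF a i] Qh[OF H'(5)[OF e]] th_h[OF t]] by simp
          finally show "\<theta> (src (map_spans (vobj G i) H) e) \<cdot>\<^bsub>D\<^esub> m (vobj H (src (map_spans (vobj G i) H) e)) i \<cdot>\<^bsub>D\<^esub> lft (map_spans (vobj G i) H) e =
              \<theta> (tgt (map_spans (vobj G i) H) e) \<cdot>\<^bsub>D\<^esub> m (vobj H (tgt (map_spans (vobj G i) H) e)) i \<cdot>\<^bsub>D\<^esub> rgt (map_spans (vobj G i) H) e"
            by simp
        qed (rule d)
        from span_colimitD(2)[OF X_colim[OF i] this] show ?thesis by auto
      qed
      then obtain h where h: "\<And>i. i \<in> Vert G \<Longrightarrow> h i \<in> hom D (fobj (vobj G i) b) d"
        and h_nu: "\<And>i j. i \<in> Vert G \<Longrightarrow> j \<in> Vert H \<Longrightarrow> h i \<cdot>\<^bsub>D\<^esub> farr (vobj G i) (\<nu> j) = \<theta> j \<cdot>\<^bsub>D\<^esub> m (vobj H j) i"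
        by metis
      have "span_cocone D (?G b) d h"
        unfolding cocone_iff
      proof (intro conjI ballI)
        fix e assume e: "e \<in> Edge G"
        note s = G'(2)[OF e] and t = G'(3)[OF e]
        show "h (src G e) \<cdot>\<^bsub>D\<^esub> ntmap (lft G e) b = h (tgt G e) \<cdot>\<^bsub>D\<^esub> ntmap (rgt G e) b"
        proof (rule Y_epi[OF e comp_hom[OF D ntrans_hom[OF lf[OF e] b] h[OF s]] comp_hom[OF D ntrans_hom[OF rg[OF e] b] h[OF t]]])
          fix j assume j: "j \<in> Vert H"
          note hj = H'(1)[OF j] and nj = nu'(2)[OF j]
          note Yj = functor_hom[OF left_adjoint_functor[OF Y[OF e]] nj]
          have "h (src G e) \<cdot>\<^bsub>D\<^esub> ntmap (lft G e) b \<cdot>\<^bsub>D\<^esub> farr (apex G e) (\<nu> j) =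
              \<theta> j \<cdot>\<^bsub>D\<^esub> (m (vobj H j) (src G e) \<cdot>\<^bsub>D\<^esub> ntmap (lft G e) (vobj H j))"
            using comp_assoc[OF D Yj ntrans_hom[OF lf[OF e] b] h[OF s]] ntrans_nat[OF lf[OF e] nj]
              comp_assoc[OF D ntrans_hom[OF lf[OF e] hj] Xh[OF s nj] h[OF s]] h_nu[OF s j]
              comp_assoc[OF D ntrans_hom[OF lf[OF e] hj] m[OF hj s] th_h[OF j]] by simp
          also have "\<dots> = \<theta> j \<cdot>\<^bsub>D\<^esub> (m (vobj H j) (tgt G e) \<cdot>\<^bsub>D\<^esub> ntmap (rgt G e) (vobj H j))"
            using me[OF hj e] by simp
          also have "\<dots> = h (tgt G e) \<cdot>\<^bsub>D\<^esub> ntmap (rgt G e) b \<cdot>\<^bsub>D\<^esub> farr (apex G e) (\<nu> j)"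
            using comp_assoc[OF D Yj ntrans_hom[OF rg[OF e] b] h[OF t]] ntrans_nat[OF rg[OF e] nj]
              comp_assoc[OF D ntrans_hom[OF rg[OF e] hj] Xh[OF t nj] h[OF t]] h_nu[OF t j]
              comp_assoc[OF D ntrans_hom[OF rg[OF e] hj] m[OF hj t] th_h[OF j]] by simp
          finally show "h (src G e) \<cdot>\<^bsub>D\<^esub> ntmap (lft G e) b \<cdot>\<^bsub>D\<^esub> farr (apex G e) (\<nu> j) =
            h (tgt G e) \<cdot>\<^bsub>D\<^esub> ntmap (rgt G e) b \<cdot>\<^bsub>D\<^esub> farr (apex G e) (\<nu> j)" .
        qed
      qed (use d h in auto)
      from q_univ[OF b this] obtain u where u: "u \<in> hom D (q b) d" "\<And>i. i \<in> Vert G \<Longrightarrow> u \<cdot>\<^bsub>D\<^esub> m b i = h i"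
        and u_unique: "\<And>v. v \<in> hom D (q b) d \<Longrightarrow> (\<And>i. i \<in> Vert G \<Longrightarrow> v \<cdot>\<^bsub>D\<^esub> m b i = h i) \<Longrightarrow> v = u" by metis
      have swap: "v \<cdot>\<^bsub>D\<^esub> farr Q (\<nu> j) \<cdot>\<^bsub>D\<^esub> m (vobj H j) i = v \<cdot>\<^bsub>D\<^esub> m b i \<cdot>\<^bsub>D\<^esub> farr (vobj G i) (\<nu> j)"
        if "v \<in> hom D (q b) d" "i \<in> Vert G" "j \<in> Vert H" for v i j
        using comp_assoc[OF D m[OF H'(1)[OF that(3)] that(2)] Qh[OF nu'(2)[OF that(3)]] that(1)]
          Qm[OF nu'(2)[OF that(3)] that(2)] comp_assoc[OF D Xh[OF that(2) nu'(2)[OF that(3)]] m[OF b that(2)] that(1)] by simp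
      have u_nu: "u \<cdot>\<^bsub>D\<^esub> farr Q (\<nu> j) = \<theta> j" if j: "j \<in> Vert H" for j
        by (rule q_unique[OF H'(1)[OF j] comp_hom[OF D Qh[OF nu'(2)[OF j]] u(1)] th_h[OF j]])
          (simp add: swap[OF u(1) _ j] u(2) h_nu[OF _ j])
      have u_only: "v = u" if v: "v \<in> hom D (q b) d" and vj: "\<And>j. j \<in> Vert H \<Longrightarrow> v \<cdot>\<^bsub>D\<^esub> farr Q (\<nu> j) = \<theta> j" for v
      proof (rule u_unique[OF v])
        fix i assume i: "i \<in> Vert G"
        show "v \<cdot>\<^bsub>D\<^esub> m b i = h i"
          by (rule X_epi[OF i comp_hom[OF D m[OF b i] v] h[OF i]])
            (simp add: swap[OF v i, symmetric] vj h_nu[OF i])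
      qed
      show "\<exists>!h. h \<in> hom D (fobj Q b) d \<and> (\<forall>j\<in>Vert (map_spans Q H). h \<cdot>\<^bsub>D\<^esub> farr Q (\<nu> j) = \<theta> j)"
      proof (rule ex1I[of _ u])
        show "u \<in> hom D (fobj Q b) d \<and> (\<forall>j\<in>Vert (map_spans Q H). u \<cdot>\<^bsub>D\<^esub> farr Q (\<nu> j) = \<theta> j)"
          using u(1) u_nu Qo[OF b] by simp
        fix v assume "v \<in> hom D (fobj Q b) d \<and> (\<forall>j\<in>Vert (map_spans Q H). v \<cdot>\<^bsub>D\<^esub> farr Q (\<nu> j) = \<theta> j)"
        then show "v = u" using Qo[OF b] by (intro u_only) simp_all
      qed
    qed
  qed
  have lQ: "left_adjoint B D Q"
    using adjoint_functor_theorem[OF k lpB D locally_presentableD(3)[OF lpD] Q pres] by blast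
  define \<mu> where "\<mu> i = \<lparr>ntdom = vobj G i, ntcod = Q, ntmap = (\<lambda>b \<in> Obj B. m b i)\<rparr>" for i
  have mu: "\<mu> i \<in> hom (LPr B D) (vobj G i) Q" if i: "i \<in> Vert G" for i
  proof -
    have "\<mu> i \<in> hom (functor_cat B D) (vobj G i) Q"
    proof (rule ntransI[OF left_adjoint_functor[OF X[OF i]] Q])
      fix g b b' assume g: "g \<in> hom B b b'"
      show "ntmap (\<mu> i) b' \<cdot>\<^bsub>D\<^esub> farr (vobj G i) g = farr Q g \<cdot>\<^bsub>D\<^esub> ntmap (\<mu> i) b"
        using Qm[OF g i] hom_obj[OF B g] by (simp add: \<mu>_def)
    qed (use m[OF _ i] Qo in \<open>auto simp: \<mu>_def\<close>)
    then show ?thesis using X[OF i] lQ by (simp add: hom_LPr)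
  qed
  have "span_cocone (LPr B D) G Q \<mu>"
    unfolding span_cocone_def
  proof (intro conjI ballI)
    fix e assume e: "e \<in> Edge G"
    note s = G'(2)[OF e] and t = G'(3)[OF e]
    note 1 = comp_hom[OF category_LPr[OF B D] G'(4)[OF e] mu[OF s]]
      and 2 = comp_hom[OF category_LPr[OF B D] G'(5)[OF e] mu[OF t]]
    show "\<mu> (src G e) \<cdot>\<^bsub>LPr B D\<^esub> lft G e = \<mu> (tgt G e) \<cdot>\<^bsub>LPr B D\<^esub> rgt G e"
    proof (rule ntrans_eqI)
      show "\<mu> (src G e) \<cdot>\<^bsub>LPr B D\<^esub> lft G e \<in> hom (functor_cat B D) (apex G e) Q"
        "\<mu> (tgt G e) \<cdot>\<^bsub>LPr B D\<^esub> rgt G e \<in> hom (functor_cat B D) (apex G e) Q"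
        using 1 2 unfolding hom_LPr by blast+
    qed (use me[OF _ e] in \<open>simp add: \<mu>_def\<close>)
  qed (use lQ mu in auto)
  moreover have "span_colimit D (?G b) (fobj Q b) (\<lambda>i. ntmap (\<mu> i) b)" if b: "b \<in> Obj B" for b
    using colim[OF b] Qo[OF b] b by (simp add: \<mu>_def)
  ultimately show thesis by (rule that)
qed

text \<open>Let \<open>P\<close> be the colimit in \<open>LPr B D\<close>, and \<open>Q\<close> the pointwise one, which lies in \<open>LPr B D\<close>. The universal
  property of \<open>P\<close> gives \<open>p : P \<rightarrow> Q\<close>, the pointwise one of \<open>Q\<close> gives \<open>\<rho> : Q \<rightarrow> P\<close>, and \<open>\<rho> \<cdot> p\<close> is the
  identity. Since \<open>p\<close> and \<open>\<rho>\<close> are compatible with the legs, the values of \<open>P\<close> inherit the universal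
  property from those of \<open>Q\<close>.\<close>

lemma eval_preserves_small_colimits:
  fixes \<kappa> :: "'k rel" and B :: "('o, 'a) cat" and D :: "('p, 'b) cat"
  assumes k: "regular_cardinal \<kappa>" and lpB: "locally_presentable \<kappa> B" and lpD: "locally_presentable \<kappa> D"
    and b: "b \<in> Obj B"
  shows "preserves_small_colimits \<kappa> (LPr B D) D (eval_functor B D b)"
  unfolding preserves_small_colimits_def
proof (intro allI impI, elim conjE)
  note B = locally_presentableD(1)[OF lpB] and D = locally_presentableD(1)[OF lpD]
  note L = category_LPr[OF B D]
  fix G :: "('k, 'k, ('o, 'a, 'p, 'b) fctr, ('o, 'a, 'p, 'b) ntrans) spans" and P l
  assume G: "spans_in (LPr B D) G" "small_spans \<kappa> G" and colim: "span_colimit (LPr B D) G P l"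
  obtain Q \<mu> where Q: "span_cocone (LPr B D) G Q \<mu>"
    and Qb: "\<And>b. b \<in> Obj B \<Longrightarrow> span_colimit D (map_spans (eval_functor B D b) G) (fobj Q b) (\<lambda>i. ntmap (\<mu> i) b)"
    using pointwise_colimit[OF k lpB lpD G] by metis
  note l = span_coconeD[OF span_colimitD(1)[OF colim]] and mu = span_coconeD[OF Q]
  have lP: "left_adjoint B D P" and lQ: "left_adjoint B D Q" using l(1) mu(1) by simp_all
  note X = spans_inD(1)[OF G(1)]
  have l_b: "span_cocone D (map_spans (eval_functor B D b) G) (fobj P b) (\<lambda>i. ntmap (l i) b)" if b: "b \<in> Obj B" for b
    using span_cocone_map[OF is_functor_eval[OF B D b] G(1) span_colimitD(1)[OF colim]] lP homD(1)[OF l(2)]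
    by (simp add: span_cocone_def[of D] spans_inD(2,3)[OF G(1)])
  have lf: "l i \<in> hom (functor_cat B D) (vobj G i) P" "\<mu> i \<in> hom (functor_cat B D) (vobj G i) Q" if "i \<in> Vert G" for i
    using l(2)[OF that] mu(2)[OF that] by (simp_all add: hom_LPr)
  obtain p where p: "p \<in> hom (LPr B D) P Q" "\<And>i. i \<in> Vert G \<Longrightarrow> p \<cdot>\<^bsub>LPr B D\<^esub> l i = \<mu> i"
    using span_colimitD(2)[OF colim Q] by blast
  have p': "p \<in> hom (functor_cat B D) P Q" using p(1) by (simp add: hom_LPr)
  have pl: "ntmap p b \<cdot>\<^bsub>D\<^esub> ntmap (l i) b = ntmap (\<mu> i) b" if "i \<in> Vert G" "b \<in> Obj B" for i b
    using arg_cong[OF p(2)[OF that(1)], of "\<lambda>\<tau>. ntmap \<tau> b"] that(2) by simp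
  have "\<exists>h. h \<in> hom D (fobj Q b) (fobj P b) \<and> (\<forall>i \<in> Vert G. h \<cdot>\<^bsub>D\<^esub> ntmap (\<mu> i) b = ntmap (l i) b)" if b: "b \<in> Obj B" for b
    using span_colimitD(2)[OF Qb[OF b] l_b[OF b]] by auto
  then obtain r where r: "\<And>b. b \<in> Obj B \<Longrightarrow> r b \<in> hom D (fobj Q b) (fobj P b)"
    and rm: "\<And>b i. b \<in> Obj B \<Longrightarrow> i \<in> Vert G \<Longrightarrow> r b \<cdot>\<^bsub>D\<^esub> ntmap (\<mu> i) b = ntmap (l i) b" by metis
  have Q_epi: "u = v" if b: "b \<in> Obj B" and u: "u \<in> hom D (fobj Q b) d" and v: "v \<in> hom D (fobj Q b) d"
      and eq: "\<And>i. i \<in> Vert G \<Longrightarrow> u \<cdot>\<^bsub>D\<^esub> ntmap (\<mu> i) b = v \<cdot>\<^bsub>D\<^esub> ntmap (\<mu> i) b" for b u v d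
    using span_colimit_jointly_epi[OF D spans_in_map[OF is_functor_eval[OF B D b] G(1)] Qb[OF b] u v] eq by simp
  define \<rho> where "\<rho> = \<lparr>ntdom = Q, ntcod = P, ntmap = restrict r (Obj B)\<rparr>"
  have "\<rho> \<in> hom (functor_cat B D) Q P"
  proof (rule ntransI[OF left_adjoint_functor[OF lQ] left_adjoint_functor[OF lP]])
    fix g x y assume g: "g \<in> hom B x y"
    note x = hom_obj(1)[OF B g] and y = hom_obj(2)[OF B g]
    note Qg = functor_hom[OF left_adjoint_functor[OF lQ] g] and Pg = functor_hom[OF left_adjoint_functor[OF lP] g]
    have "r y \<cdot>\<^bsub>D\<^esub> farr Q g = farr P g \<cdot>\<^bsub>D\<^esub> r x"
    proof (rule Q_epi[OF x comp_hom[OF D Qg r[OF y]] comp_hom[OF D r[OF x] Pg]])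
      fix i assume i: "i \<in> Vert G"
      have Xg: "farr (vobj G i) g \<in> hom D (fobj (vobj G i) x) (fobj (vobj G i) y)"
        using functor_hom[OF left_adjoint_functor g] X[OF i] by simp
      note mx = ntrans_hom[OF lf(2)[OF i] x] and my = ntrans_hom[OF lf(2)[OF i] y]
      have "r y \<cdot>\<^bsub>D\<^esub> farr Q g \<cdot>\<^bsub>D\<^esub> ntmap (\<mu> i) x = ntmap (l i) y \<cdot>\<^bsub>D\<^esub> farr (vobj G i) g"
        using comp_assoc[OF D mx Qg r[OF y]] ntrans_nat[OF lf(2)[OF i] g] comp_assoc[OF D Xg my r[OF y]] rm[OF y i] by simp
      also have "\<dots> = farr P g \<cdot>\<^bsub>D\<^esub> r x \<cdot>\<^bsub>D\<^esub> ntmap (\<mu> i) x"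
        using ntrans_nat[OF lf(1)[OF i] g] comp_assoc[OF D mx r[OF x] Pg] rm[OF x i] by simp
      finally show "r y \<cdot>\<^bsub>D\<^esub> farr Q g \<cdot>\<^bsub>D\<^esub> ntmap (\<mu> i) x = farr P g \<cdot>\<^bsub>D\<^esub> r x \<cdot>\<^bsub>D\<^esub> ntmap (\<mu> i) x" .
    qed
    then show "ntmap \<rho> y \<cdot>\<^bsub>D\<^esub> farr Q g = farr P g \<cdot>\<^bsub>D\<^esub> ntmap \<rho> x" using x y by (simp add: \<rho>_def)
  qed (use r in \<open>auto simp: \<rho>_def\<close>)
  then have rho: "\<rho> \<in> hom (LPr B D) Q P" using lP lQ by (simp add: hom_LPr)
  note rp = comp_hom[OF L p(1) rho] and iP = id_hom[OF L l(1)]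
  have "\<rho> \<cdot>\<^bsub>LPr B D\<^esub> p = Id (LPr B D) P"
  proof (rule span_colimit_jointly_epi[OF L G(1) colim rp iP])
    fix i assume i: "i \<in> Vert G"
    have "\<rho> \<cdot>\<^bsub>LPr B D\<^esub> p \<cdot>\<^bsub>LPr B D\<^esub> l i = \<rho> \<cdot>\<^bsub>LPr B D\<^esub> \<mu> i"
      by (simp only: comp_assoc[OF L l(2)[OF i] p(1) rho, symmetric] p(2)[OF i])
    also have "\<dots> = l i"
    proof (rule ntrans_eqI[OF _ lf(1)[OF i]])
      show "\<rho> \<cdot>\<^bsub>LPr B D\<^esub> \<mu> i \<in> hom (functor_cat B D) (vobj G i) P"
        using comp_hom[OF L mu(2)[OF i] rho] unfolding hom_LPr by blast
    qed (use rm[OF _ i] in \<open>simp add: \<rho>_def\<close>)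
    also have "\<dots> = Id (LPr B D) P \<cdot>\<^bsub>LPr B D\<^esub> l i" using comp_id_left[OF L l(2)[OF i]] by simp
    finally show "\<rho> \<cdot>\<^bsub>LPr B D\<^esub> p \<cdot>\<^bsub>LPr B D\<^esub> l i = Id (LPr B D) P \<cdot>\<^bsub>LPr B D\<^esub> l i" .
  qed
  from arg_cong[OF this, of "\<lambda>\<tau>. ntmap \<tau> b"] have rp_b: "r b \<cdot>\<^bsub>D\<^esub> ntmap p b = Id D (fobj P b)"
    using b by (simp add: \<rho>_def)
  note pb = ntrans_hom[OF p' b]
  have "span_colimit D (map_spans (eval_functor B D b) G) (fobj P b) (\<lambda>i. ntmap (l i) b)"
    unfolding span_colimit_def
  proof (intro conjI allI impI)
    show "span_cocone D (map_spans (eval_functor B D b) G) (fobj P b) (\<lambda>i. ntmap (l i) b)" using l_b[OF b] .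
    fix d \<theta> assume th: "span_cocone D (map_spans (eval_functor B D b) G) d \<theta>"
    obtain h where h: "h \<in> hom D (fobj Q b) d" "\<And>i. i \<in> Vert G \<Longrightarrow> h \<cdot>\<^bsub>D\<^esub> ntmap (\<mu> i) b = \<theta> i"
      using span_colimitD(2)[OF Qb[OF b] th] by auto
    show "\<exists>!h. h \<in> hom D (fobj P b) d \<and> (\<forall>i\<in>Vert (map_spans (eval_functor B D b) G). h \<cdot>\<^bsub>D\<^esub> ntmap (l i) b = \<theta> i)"
    proof (rule ex1I[of _ "h \<cdot>\<^bsub>D\<^esub> ntmap p b"])
      have "h \<cdot>\<^bsub>D\<^esub> ntmap p b \<cdot>\<^bsub>D\<^esub> ntmap (l i) b = \<theta> i" if i: "i \<in> Vert G" for i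
        using comp_assoc[OF D ntrans_hom[OF lf(1)[OF i] b] pb h(1)] pl[OF i b] h(2)[OF i] by simp
      then show "h \<cdot>\<^bsub>D\<^esub> ntmap p b \<in> hom D (fobj P b) d \<and>
          (\<forall>i\<in>Vert (map_spans (eval_functor B D b) G). h \<cdot>\<^bsub>D\<^esub> ntmap p b \<cdot>\<^bsub>D\<^esub> ntmap (l i) b = \<theta> i)"
        using comp_hom[OF D pb h(1)] by simp
      fix k assume "k \<in> hom D (fobj P b) d \<and> (\<forall>i\<in>Vert (map_spans (eval_functor B D b) G). k \<cdot>\<^bsub>D\<^esub> ntmap (l i) b = \<theta> i)"
      then have kk: "k \<in> hom D (fobj P b) d" "\<And>i. i \<in> Vert G \<Longrightarrow> k \<cdot>\<^bsub>D\<^esub> ntmap (l i) b = \<theta> i" by simp_all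
      have "k \<cdot>\<^bsub>D\<^esub> r b = h"
      proof (rule Q_epi[OF b comp_hom[OF D r[OF b] kk(1)] h(1)])
        fix i assume i: "i \<in> Vert G"
        show "k \<cdot>\<^bsub>D\<^esub> r b \<cdot>\<^bsub>D\<^esub> ntmap (\<mu> i) b = h \<cdot>\<^bsub>D\<^esub> ntmap (\<mu> i) b"
          using comp_assoc[OF D ntrans_hom[OF lf(2)[OF i] b] r[OF b] kk(1)] rm[OF b i] kk(2)[OF i] h(2)[OF i] by simp
      qed
      then show "k = h \<cdot>\<^bsub>D\<^esub> ntmap p b"
        using comp_assoc[OF D pb r[OF b] kk(1)] rp_b comp_id_right[OF D kk(1)] by simp
    qed
  qed
  then show "span_colimit D (map_spans (eval_functor B D b) G) (fobj (eval_functor B D b) P)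
      (\<lambda>i. farr (eval_functor B D b) (l i))"
    using lP homD(1)[OF l(2)] unfolding span_colimit_def
    by (simp add: span_cocone_def[of D _ "fobj P b"] spans_inD(2,3)[OF G(1)] cong: ball_cong)
qed

section \<open>Uncurrying\<close>

lemma preserves_small_colimits_comp:
  fixes \<kappa> :: "'k rel"
  assumes F: "is_functor C D F" and G: "is_functor D E G"
    and pF: "preserves_small_colimits \<kappa> C D F" and pG: "preserves_small_colimits \<kappa> D E G"
    and C: "category C"
  shows "preserves_small_colimits \<kappa> C E (comp_functor C G F)"
  unfolding preserves_small_colimits_def
proof (intro allI impI, elim conjE)
  fix S :: "('k, 'k, 'a, 'b) spans" and c l
  assume S: "spans_in C S" "small_spans \<kappa> S" and l: "span_colimit C S c l"
  note S' = spans_inD[OF S(1)] and l' = span_colimitD(1)[OF l]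
  have sm: "small_spans \<kappa> (map_spans F S)" using S(2) by (simp add: small_spans_def)
  have colim: "span_colimit E (map_spans G (map_spans F S)) (fobj G (fobj F c)) (\<lambda>i. farr G (farr F (l i)))"
    using pF pG S l sm spans_in_map[OF F S(1)] unfolding preserves_small_colimits_def by blast
  have cocone: "span_cocone E (map_spans (comp_functor C G F) S) d m \<longleftrightarrow>
      span_cocone E (map_spans G (map_spans F S)) d m" for d m
    using S'(1) homD(1)[OF S'(4)] homD(1)[OF S'(5)]
    unfolding span_cocone_def by (simp add: comp_functor_def)
  have la: "farr (comp_functor C G F) (l i) = farr G (farr F (l i))" if "i \<in> Vert S" for i
    using homD(1)[OF span_coconeD(2)[OF l' that]] by (simp add: comp_functor_def)
  have co: "fobj (comp_functor C G F) c = fobj G (fobj F c)"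
    using span_coconeD(1)[OF l'] by (simp add: comp_functor_def)
  show "span_colimit E (map_spans (comp_functor C G F) S) (fobj (comp_functor C G F) c)
      (\<lambda>i. farr (comp_functor C G F) (l i))"
    unfolding span_colimit_def
  proof (intro conjI allI impI)
    show "span_cocone E (map_spans (comp_functor C G F) S) (fobj (comp_functor C G F) c) (\<lambda>i. farr (comp_functor C G F) (l i))"
      using span_cocone_map[OF is_functor_comp[OF C F G] S(1) l'] .
    fix d m assume "span_cocone E (map_spans (comp_functor C G F) S) d m"
    from span_colimitD(2)[OF colim this[unfolded cocone]]
    show "\<exists>!h. h \<in> hom E (fobj (comp_functor C G F) c) d \<and>
        (\<forall>i\<in>Vert (map_spans (comp_functor C G F) S). h \<cdot>\<^bsub>E\<^esub> farr (comp_functor C G F) (l i) = m i)"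
      by (simp add: la co)
  qed
qed

definition uncurry_obj ::
    "('o, 'a) cat \<Rightarrow> ('p, 'b) cat \<Rightarrow> ('q, 'c) cat \<Rightarrow>
     ('o, 'a, ('p, 'b, 'q, 'c) fctr, ('p, 'b, 'q, 'c) ntrans) fctr \<Rightarrow> ('o \<times> 'p, 'a \<times> 'b, 'q, 'c) fctr" where
  "uncurry_obj A B D K = \<lparr>fobj = (\<lambda>p \<in> Obj A \<times> Obj B. fobj (fobj K (fst p)) (snd p)),
     farr = (\<lambda>p \<in> Arr A \<times> Arr B. ntmap (farr K (fst p)) (Cod B (snd p)) \<cdot>\<^bsub>D\<^esub> farr (fobj K (Dom A (fst p))) (snd p))\<rparr>"

lemma uncurry_obj_simps [simp]:
  "a \<in> Obj A \<Longrightarrow> b \<in> Obj B \<Longrightarrow> fobj (uncurry_obj A B D K) (a, b) = fobj (fobj K a) b"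
  "f \<in> Arr A \<Longrightarrow> g \<in> Arr B \<Longrightarrow> farr (uncurry_obj A B D K) (f, g) =
     ntmap (farr K f) (Cod B g) \<cdot>\<^bsub>D\<^esub> farr (fobj K (Dom A f)) g"
  by (simp_all add: uncurry_obj_def)

lemma is_functor_uncurry_obj:
  assumes A: "category A" and B: "category B" and D: "category D" and K: "is_functor A (LPr B D) K"
  shows "is_functor (prod_cat A B) D (uncurry_obj A B D K)"
proof -
  have Kf: "is_functor B D (fobj K a)" if "a \<in> Obj A" for a
    using functor_obj[OF K that] left_adjoint_functor by simp
  have Kh: "farr K f \<in> hom (functor_cat B D) (fobj K a) (fobj K a')" if "f \<in> hom A a a'" for f a a'
    using functor_hom[OF K that] by (simp add: hom_LPr)
  show ?thesis
  proof (rule functorI)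
    show "fobj (uncurry_obj A B D K) \<in> extensional (Obj (prod_cat A B))"
      "farr (uncurry_obj A B D K) \<in> extensional (Arr (prod_cat A B))"
      by (simp_all add: uncurry_obj_def)
    show "fobj (uncurry_obj A B D K) p \<in> Obj D" if "p \<in> Obj (prod_cat A B)" for p
      using that functor_obj[OF Kf] by auto
    show "farr (uncurry_obj A B D K) (Id (prod_cat A B) p) = Id D (fobj (uncurry_obj A B D K) p)"
      if p: "p \<in> Obj (prod_cat A B)" for p
    proof -
      obtain a b where ab: "p = (a, b)" "a \<in> Obj A" "b \<in> Obj B" using p by auto
      note ia = id_hom[OF A ab(2)] and ib = id_hom[OF B ab(3)]
      have "ntmap (farr K (Id A a)) b = Id D (fobj (fobj K a) b)"
        using functor_id[OF K ab(2)] ab(3) by simp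
      then show ?thesis
        using ab homD[OF ia] homD[OF ib] functor_id[OF Kf[OF ab(2)] ab(3)]
          comp_id_left[OF D id_hom[OF D functor_obj[OF Kf[OF ab(2)] ab(3)]]] by simp
    qed
    fix u x y assume u: "u \<in> hom (prod_cat A B) x y"
    obtain f g a b a' b' where e: "u = (f, g)" "x = (a, b)" "y = (a', b')" by (metis prod.exhaust)
    have f: "f \<in> hom A a a'" and g: "g \<in> hom B b b'" using u by (simp_all add: e hom_prod)
    note fo = hom_obj[OF A f] and go = hom_obj[OF B g]
    note 1 = ntrans_hom[OF Kh[OF f] go(2)] and 2 = functor_hom[OF Kf[OF fo(1)] g]
    show "farr (uncurry_obj A B D K) u \<in> hom D (fobj (uncurry_obj A B D K) x) (fobj (uncurry_obj A B D K) y)"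
      using comp_hom[OF D 2 1] homD[OF f] homD[OF g] fo go by (simp add: e)
    fix v z assume v: "v \<in> hom (prod_cat A B) y z"
    obtain f' g' a'' b'' where e': "v = (f', g')" "z = (a'', b'')" by (metis prod.exhaust)
    have f': "f' \<in> hom A a' a''" and g': "g' \<in> hom B b' b''" using v by (simp_all add: e e' hom_prod)
    note go' = hom_obj[OF B g']
    note ff = comp_hom[OF A f f'] and gg = comp_hom[OF B g g']
    note 3 = ntrans_hom[OF Kh[OF f'] go'(2)] and 4 = functor_hom[OF Kf[OF fo(2)] g']
      and 5 = ntrans_hom[OF Kh[OF f] go'(2)] and 6 = functor_hom[OF Kf[OF fo(1)] g']
    have "ntmap (farr K (f' \<cdot>\<^bsub>A\<^esub> f)) b'' = ntmap (farr K f') b'' \<cdot>\<^bsub>D\<^esub> ntmap (farr K f) b''"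
      using functor_comp[OF K f f'] go'(2) by simp
    then have "ntmap (farr K (f' \<cdot>\<^bsub>A\<^esub> f)) b'' \<cdot>\<^bsub>D\<^esub> farr (fobj K a) (g' \<cdot>\<^bsub>B\<^esub> g) =
        ntmap (farr K f') b'' \<cdot>\<^bsub>D\<^esub> ntmap (farr K f) b'' \<cdot>\<^bsub>D\<^esub> (farr (fobj K a) g' \<cdot>\<^bsub>D\<^esub> farr (fobj K a) g)"
      using functor_comp[OF Kf[OF fo(1)] g g'] by simp
    also have "\<dots> = ntmap (farr K f') b'' \<cdot>\<^bsub>D\<^esub> (ntmap (farr K f) b'' \<cdot>\<^bsub>D\<^esub> farr (fobj K a) g') \<cdot>\<^bsub>D\<^esub> farr (fobj K a) g"
      using comp_assoc[OF D 2 6 comp_hom[OF D 5 3]] comp_assoc[OF D 6 5 3] by simp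
    also have "\<dots> = ntmap (farr K f') b'' \<cdot>\<^bsub>D\<^esub> farr (fobj K a') g' \<cdot>\<^bsub>D\<^esub> (ntmap (farr K f) b' \<cdot>\<^bsub>D\<^esub> farr (fobj K a) g)"
      using ntrans_nat[OF Kh[OF f] g'] comp_assoc[OF D 1 4 3] comp_assoc[OF D 2 1 comp_hom[OF D 4 3]] by simp
    finally show "farr (uncurry_obj A B D K) (v \<cdot>\<^bsub>prod_cat A B\<^esub> u) =
        farr (uncurry_obj A B D K) v \<cdot>\<^bsub>D\<^esub> farr (uncurry_obj A B D K) u"
      using homD[OF f] homD[OF g] homD[OF f'] homD[OF g'] homD[OF ff] homD[OF gg] by (simp add: e e')
  qed
qed

lemma partial_functor_uncurry:
  assumes A: "category A" and B: "category B" and D: "category D" and K: "is_functor A (LPr B D) K"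
    and a: "a \<in> Obj A"
  shows "partial_functor A B (uncurry_obj A B D K) a = fobj K a"
proof (rule functor_eqI[OF is_functor_partial[OF A B is_functor_uncurry_obj[OF A B D K] a]])
  show Ka: "is_functor B D (fobj K a)" using functor_obj[OF K a] left_adjoint_functor by simp
  note ia = id_hom[OF A a]
  show "farr (partial_functor A B (uncurry_obj A B D K) a) g = farr (fobj K a) g" if g: "g \<in> Arr B" for g
  proof -
    note g' = arr_hom[OF g]
    have "ntmap (farr K (Id A a)) (Cod B g) = Id D (fobj (fobj K a) (Cod B g))"
      using functor_id[OF K a] arr_obj[OF B g] by simp
    then show ?thesis
      using g homD[OF ia] comp_id_left[OF D functor_hom[OF Ka g']] by simp
  qed
qed (use a in simp)

lemma curry_uncurry:
  assumes A: "category A" and B: "category B" and D: "category D" and K: "is_functor A (LPr B D) K"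
  shows "curry_obj A B (uncurry_obj A B D K) = K"
proof -
  let ?F = "uncurry_obj A B D K"
  note F = is_functor_uncurry_obj[OF A B D K] and part = partial_functor_uncurry[OF A B D K]
  have Ka: "left_adjoint B D (fobj K a)" if "a \<in> Obj A" for a using functor_obj[OF K that] by simp
  show ?thesis
  proof (rule functor_eqI[OF is_functor_curry_obj[OF A B D F] K])
    show "left_adjoint B D (partial_functor A B ?F a)" if "a \<in> Obj A" for a using part[OF that] Ka[OF that] by simp
    show "fobj (curry_obj A B ?F) a = fobj K a" if "a \<in> Obj A" for a using part that by simp
    fix f assume f: "f \<in> Arr A"
    note f' = arr_hom[OF f] and fo = arr_obj[OF A f]
    show "farr (curry_obj A B ?F) f = farr K f"
    proof (rule ntrans_eqI)
      show "farr (curry_obj A B ?F) f \<in> hom (functor_cat B D) (fobj K (Dom A f)) (fobj K (Cod A f))"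
        using curry_obj_hom[OF A B F f'] part fo by simp
      show Kf: "farr K f \<in> hom (functor_cat B D) (fobj K (Dom A f)) (fobj K (Cod A f))"
        using functor_hom[OF K f'] by (simp add: hom_LPr)
      fix b assume b: "b \<in> Obj B"
      note ib = id_hom[OF B b]
      show "ntmap (farr (curry_obj A B ?F) f) b = ntmap (farr K f) b"
        using f b homD[OF ib] functor_id[OF left_adjoint_functor[OF Ka[OF fo(1)]] b]
          comp_id_right[OF D ntrans_hom[OF Kf b]] by simp
    qed
  qed
qed

text \<open>With \<open>b\<close> fixed, the functor \<open>a \<mapsto> K(a)(b)\<close> is \<open>K\<close> followed by evaluation at \<open>b\<close>, so it preserves small
  colimits and has a right adjoint by the adjoint functor theorem on \<open>A\<close>.\<close>

lemma uncurry_two_var_left_adjoint: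
  fixes \<kappa> :: "'k rel"
  assumes k: "regular_cardinal \<kappa>" and lpA: "locally_presentable \<kappa> A" and lpB: "locally_presentable \<kappa> B"
    and lpD: "locally_presentable \<kappa> D" and K: "left_adjoint A (LPr B D) K"
  shows "two_var_left_adjoint A B D (uncurry_obj A B D K)"
proof -
  note A = locally_presentableD(1)[OF lpA] and B = locally_presentableD(1)[OF lpB]
    and D = locally_presentableD(1)[OF lpD]
  note fK = left_adjoint_functor[OF K]
  let ?F = "uncurry_obj A B D K"
  note F = is_functor_uncurry_obj[OF A B D fK]
  have Ka: "left_adjoint B D (fobj K a)" if "a \<in> Obj A" for a using functor_obj[OF fK that] by simp
  have "left_adjoint A D (partial_functor B A (swap_functor ?F) b)" if b: "b \<in> Obj B" for b
  proof -
    note ev = is_functor_eval[OF B D b]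
    note c = is_functor_comp[OF A fK ev]
    have "partial_functor B A (swap_functor ?F) b = comp_functor A (eval_functor B D b) K"
    proof (rule functor_eqI[OF is_functor_partial[OF B A is_functor_swap[OF F] b] c])
      show "fobj (partial_functor B A (swap_functor ?F) b) a = fobj (comp_functor A (eval_functor B D b) K) a"
        if "a \<in> Obj A" for a using that b Ka by (simp add: comp_functor_def)
      fix f assume f: "f \<in> Arr A"
      note f' = arr_hom[OF f] and fo = arr_obj[OF A f] and ib = id_hom[OF B b]
      have Kf: "farr K f \<in> hom (functor_cat B D) (fobj K (Dom A f)) (fobj K (Cod A f))"
        using functor_hom[OF fK f'] by (simp add: hom_LPr)
      show "farr (partial_functor B A (swap_functor ?F) b) f = farr (comp_functor A (eval_functor B D b) K) f"
        using f b homD[OF ib] functor_id[OF left_adjoint_functor[OF Ka[OF fo(1)]] b]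
          comp_id_right[OF D ntrans_hom[OF Kf b]] homD(1)[OF functor_hom[OF fK f']]
        by (simp add: comp_functor_def)
    qed
    moreover have "preserves_small_colimits \<kappa> A D (comp_functor A (eval_functor B D b) K)"
      using preserves_small_colimits_comp[OF fK ev
        left_adjoint_preserves_small_colimits[OF A category_LPr[OF B D] K]
        eval_preserves_small_colimits[OF k lpB lpD b] A] .
    ultimately show ?thesis
      using adjoint_functor_theorem[OF k lpA D locally_presentableD(3)[OF lpD] c] by simp
  qed
  then show ?thesis
    unfolding two_var_left_adjoint_iff[OF A B D]
    using F Ka partial_functor_uncurry[OF A B D fK] by simp
qed

section \<open>Currying is an equivalence\<close>

lemma category_two_var_cat: "category A \<Longrightarrow> category B \<Longrightarrow> category D \<Longrightarrow> category (two_var_cat A B D)"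
  unfolding two_var_cat_def by (intro category_full_subcat category_functor_cat category_prod)

lemma two_var_functor: "two_var_left_adjoint A B D F \<Longrightarrow> is_functor (prod_cat A B) D F"
  by (simp add: two_var_left_adjoint_def)

lemma two_var_cat_simps [simp]:
  "Obj (two_var_cat A B D) = {F. two_var_left_adjoint A B D F}"
  "Dom (two_var_cat A B D) = ntdom" "Cod (two_var_cat A B D) = ntcod"
  "Id (two_var_cat A B D) = Id (functor_cat (prod_cat A B) D)"
  "\<tau> \<cdot>\<^bsub>two_var_cat A B D\<^esub> \<sigma> = \<tau> \<cdot>\<^bsub>functor_cat (prod_cat A B) D\<^esub> \<sigma>"
  unfolding two_var_cat_def by (auto simp: two_var_functor)

lemma hom_two_var_cat:
  "\<tau> \<in> hom (two_var_cat A B D) F F' \<longleftrightarrow> \<tau> \<in> hom (functor_cat (prod_cat A B) D) F F' \<and>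
     two_var_left_adjoint A B D F \<and> two_var_left_adjoint A B D F'"
  unfolding two_var_cat_def by (simp add: hom_full_subcat)

lemma ntrans_bifunctor_hom:
  "\<tau> \<in> hom (functor_cat (prod_cat A B) D) F F' \<Longrightarrow> a \<in> Obj A \<Longrightarrow> b \<in> Obj B \<Longrightarrow>
     ntmap \<tau> (a, b) \<in> hom D (fobj F (a, b)) (fobj F' (a, b))"
  using ntrans_hom[of \<tau> "prod_cat A B" D F F' "(a, b)"] by simp

lemma ntrans_bifunctor_nat:
  "\<tau> \<in> hom (functor_cat (prod_cat A B) D) F F' \<Longrightarrow> f \<in> hom A a a' \<Longrightarrow> g \<in> hom B b b' \<Longrightarrow>
     ntmap \<tau> (a', b') \<cdot>\<^bsub>D\<^esub> farr F (f, g) = farr F' (f, g) \<cdot>\<^bsub>D\<^esub> ntmap \<tau> (a, b)"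
  using ntrans_nat[of \<tau> "prod_cat A B" D F F' "(f, g)" "(a, b)" "(a', b')"] by (simp add: hom_prod)

lemma curry_arr_simps [simp]:
  "ntdom (curry_arr A B \<tau>) = curry_obj A B (ntdom \<tau>)" "ntcod (curry_arr A B \<tau>) = curry_obj A B (ntcod \<tau>)"
  "a \<in> Obj A \<Longrightarrow> ntmap (curry_arr A B \<tau>) a = \<lparr>ntdom = partial_functor A B (ntdom \<tau>) a,
     ntcod = partial_functor A B (ntcod \<tau>) a, ntmap = (\<lambda>b \<in> Obj B. ntmap \<tau> (a, b))\<rparr>"
  by (simp_all add: curry_arr_def)

lemma curry_arr_component:
  assumes A: "category A" and B: "category B"
    and t: "\<tau> \<in> hom (functor_cat (prod_cat A B) D) F F'" and a: "a \<in> Obj A"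
  shows "ntmap (curry_arr A B \<tau>) a \<in> hom (functor_cat B D) (partial_functor A B F a) (partial_functor A B F' a)"
proof (rule ntransI[OF is_functor_partial[OF A B ntrans_functor(1)[OF t] a] is_functor_partial[OF A B ntrans_functor(2)[OF t] a]])
  fix g b b' assume g: "g \<in> hom B b b'"
  show "ntmap (ntmap (curry_arr A B \<tau>) a) b' \<cdot>\<^bsub>D\<^esub> farr (partial_functor A B F a) g =
      farr (partial_functor A B F' a) g \<cdot>\<^bsub>D\<^esub> ntmap (ntmap (curry_arr A B \<tau>) a) b"
    using ntrans_bifunctor_nat[OF t id_hom[OF A a] g] a homD(1)[OF g] hom_obj[OF B g] by simp
qed (use a t ntrans_bifunctor_hom[OF t a] in \<open>auto simp: hom_functor_cat\<close>)

text \<open>Uncurrying is a strict inverse of currying, on objects and on arrows. A family that is natural in each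
  variable separately is natural in both, because an arrow \<open>(f, g)\<close> of the product is
  \<open>(f, id) \<cdot> (id, g)\<close>.\<close>

lemma curry_equivalence:
  fixes \<kappa> :: "'k rel" and A :: "('o1, 'a1) cat" and B :: "('o2, 'a2) cat" and D :: "('o, 'a) cat"
  assumes k: "regular_cardinal \<kappa>" and lpA: "locally_presentable \<kappa> A" and cA: "complete_cat \<kappa> A"
    and lpB: "locally_presentable \<kappa> B" and lpD: "locally_presentable \<kappa> D"
  shows "equivalence (two_var_cat A B D) (LPr A (LPr B D)) (curry_functor A B (two_var_cat A B D))"
proof -
  note A = locally_presentableD(1)[OF lpA] and B = locally_presentableD(1)[OF lpB]
    and D = locally_presentableD(1)[OF lpD]
  note LBD = category_LPr[OF B D]
  let ?T = "two_var_cat A B D" and ?L = "LPr A (LPr B D)"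
  let ?C = "curry_functor A B ?T"
  note T = category_two_var_cat[OF A B D] and L = category_LPr[OF A LBD]
  note curry = curry_obj_left_adjoint[OF k A cA lpB D]
  have part: "left_adjoint B D (partial_functor A B F a)" if "two_var_left_adjoint A B D F" "a \<in> Obj A" for F a
    using that unfolding two_var_left_adjoint_iff[OF A B D] by blast
  have Co: "fobj ?C F = curry_obj A B F" if "two_var_left_adjoint A B D F" for F
    using that by (simp add: curry_functor_def)
  have Ca: "farr ?C \<tau> = curry_arr A B \<tau>" if "\<tau> \<in> hom ?T F F'" for \<tau> F F'
    using homD(1)[OF that] by (simp add: curry_functor_def)
  have comp_a: "ntmap (curry_arr A B \<tau>) a \<in> hom (LPr B D) (partial_functor A B F a) (partial_functor A B F' a)"
    if "\<tau> \<in> hom ?T F F'" "a \<in> Obj A" for \<tau> F F' a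
    using curry_arr_component[OF A B _ that(2), of \<tau> D F F'] that part by (simp add: hom_LPr hom_two_var_cat)
  have Ch: "curry_arr A B \<tau> \<in> hom ?L (curry_obj A B F) (curry_obj A B F')" if t: "\<tau> \<in> hom ?T F F'" for \<tau> F F'
  proof -
    have t': "\<tau> \<in> hom (functor_cat (prod_cat A B) D) F F'" and F: "two_var_left_adjoint A B D F" "two_var_left_adjoint A B D F'"
      using t by (simp_all add: hom_two_var_cat)
    have "curry_arr A B \<tau> \<in> hom (functor_cat A (LPr B D)) (curry_obj A B F) (curry_obj A B F')"
    proof (rule ntransI[OF left_adjoint_functor[OF curry[OF F(1)]] left_adjoint_functor[OF curry[OF F(2)]]])
      show "ntdom (curry_arr A B \<tau>) = curry_obj A B F" "ntcod (curry_arr A B \<tau>) = curry_obj A B F'"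
        using t' by (simp_all add: hom_functor_cat)
      show "ntmap (curry_arr A B \<tau>) \<in> extensional (Obj A)" by (simp add: curry_arr_def)
      show "ntmap (curry_arr A B \<tau>) a \<in> hom (LPr B D) (fobj (curry_obj A B F) a) (fobj (curry_obj A B F') a)"
        if "a \<in> Obj A" for a using comp_a[OF t that] that by (simp del: curry_arr_simps)
      fix f a a' assume f: "f \<in> hom A a a'"
      note a = hom_obj(1)[OF A f] and a' = hom_obj(2)[OF A f]
      have cF: "farr (curry_obj A B F) f \<in> hom (LPr B D) (partial_functor A B F a) (partial_functor A B F a')"
        and cF': "farr (curry_obj A B F') f \<in> hom (LPr B D) (partial_functor A B F' a) (partial_functor A B F' a')"
        using functor_hom[OF left_adjoint_functor[OF curry[OF F(1)]] f]
          functor_hom[OF left_adjoint_functor[OF curry[OF F(2)]] f] a a' by simp_all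
      show "ntmap (curry_arr A B \<tau>) a' \<cdot>\<^bsub>LPr B D\<^esub> farr (curry_obj A B F) f =
          farr (curry_obj A B F') f \<cdot>\<^bsub>LPr B D\<^esub> ntmap (curry_arr A B \<tau>) a"
      proof (rule ntrans_eqI)
        show "ntmap (curry_arr A B \<tau>) a' \<cdot>\<^bsub>LPr B D\<^esub> farr (curry_obj A B F) f \<in>
            hom (functor_cat B D) (partial_functor A B F a) (partial_functor A B F' a')"
          "farr (curry_obj A B F') f \<cdot>\<^bsub>LPr B D\<^esub> ntmap (curry_arr A B \<tau>) a \<in>
            hom (functor_cat B D) (partial_functor A B F a) (partial_functor A B F' a')"
          using comp_hom[OF LBD cF comp_a[OF t a']] comp_hom[OF LBD comp_a[OF t a] cF'] unfolding hom_LPr by blast+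
        fix b assume b: "b \<in> Obj B"
        show "ntmap (ntmap (curry_arr A B \<tau>) a' \<cdot>\<^bsub>LPr B D\<^esub> farr (curry_obj A B F) f) b =
            ntmap (farr (curry_obj A B F') f \<cdot>\<^bsub>LPr B D\<^esub> ntmap (curry_arr A B \<tau>) a) b"
          using ntrans_bifunctor_nat[OF t' f id_hom[OF B b]] a a' b homD(1)[OF f] by simp
      qed
    qed
    then show ?thesis using curry F by (simp add: hom_LPr)
  qed
  have C: "is_functor ?T ?L ?C"
  proof (rule functorI)
    show "fobj ?C \<in> extensional (Obj ?T)" "farr ?C \<in> extensional (Arr ?T)" by (simp_all add: curry_functor_def)
    show "fobj ?C F \<in> Obj ?L" if "F \<in> Obj ?T" for F using that curry Co by simp
    show "farr ?C (Id ?T F) = Id ?L (fobj ?C F)" if F: "F \<in> Obj ?T" for F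
    proof -
      have F': "two_var_left_adjoint A B D F" using F by simp
      note i = id_hom[OF T F]
      have iL: "Id ?L (curry_obj A B F) \<in> hom ?L (curry_obj A B F) (curry_obj A B F)"
        using id_hom[OF L, of "curry_obj A B F"] curry[OF F'] by (simp del: functor_cat_simps LPr_simps(4))
      have "curry_arr A B (Id ?T F) = Id ?L (curry_obj A B F)"
      proof (rule ntrans_eqI)
        show "curry_arr A B (Id ?T F) \<in> hom (functor_cat A (LPr B D)) (curry_obj A B F) (curry_obj A B F)"
          "Id ?L (curry_obj A B F) \<in> hom (functor_cat A (LPr B D)) (curry_obj A B F) (curry_obj A B F)"
          using Ch[OF i] iL unfolding hom_LPr by blast+
        show "ntmap (curry_arr A B (Id ?T F)) a = ntmap (Id ?L (curry_obj A B F)) a" if a: "a \<in> Obj A" for a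
          using a by (simp add: restrict_def fun_eq_iff)
      qed
      then show ?thesis using Ca[OF i] Co[OF F'] by simp
    qed
    show "farr ?C \<tau> \<in> hom ?L (fobj ?C F) (fobj ?C F')" if t: "\<tau> \<in> hom ?T F F'" for \<tau> F F'
      using Ch[OF t] Ca[OF t] Co t by (simp add: hom_two_var_cat)
    fix \<tau> \<sigma> F F' F'' assume t: "\<tau> \<in> hom ?T F F'" and s: "\<sigma> \<in> hom ?T F' F''"
    note st = comp_hom[OF T t s]
    have "curry_arr A B (\<sigma> \<cdot>\<^bsub>?T\<^esub> \<tau>) = curry_arr A B \<sigma> \<cdot>\<^bsub>?L\<^esub> curry_arr A B \<tau>"
    proof (rule ntrans_eqI)
      show "curry_arr A B (\<sigma> \<cdot>\<^bsub>?T\<^esub> \<tau>) \<in> hom (functor_cat A (LPr B D)) (curry_obj A B F) (curry_obj A B F'')"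
        "curry_arr A B \<sigma> \<cdot>\<^bsub>?L\<^esub> curry_arr A B \<tau> \<in> hom (functor_cat A (LPr B D)) (curry_obj A B F) (curry_obj A B F'')"
        using Ch[OF st] comp_hom[OF L Ch[OF t] Ch[OF s]] unfolding hom_LPr by blast+
      show "ntmap (curry_arr A B (\<sigma> \<cdot>\<^bsub>?T\<^esub> \<tau>)) a = ntmap (curry_arr A B \<sigma> \<cdot>\<^bsub>?L\<^esub> curry_arr A B \<tau>) a" if a: "a \<in> Obj A" for a
        using a by (simp add: restrict_def fun_eq_iff)
    qed
    then show "farr ?C (\<sigma> \<cdot>\<^bsub>?T\<^esub> \<tau>) = farr ?C \<sigma> \<cdot>\<^bsub>?L\<^esub> farr ?C \<tau>" using Ca[OF t] Ca[OF s] Ca[OF st] by simp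
  qed
  show ?thesis
  proof (rule equivalenceI[OF T L C])
    show "essentially_surjective ?T ?L ?C"
      unfolding essentially_surjective_def
    proof
      fix K assume K: "K \<in> Obj ?L"
      let ?F = "uncurry_obj A B D K"
      have "two_var_left_adjoint A B D ?F" using uncurry_two_var_left_adjoint[OF k lpA lpB lpD] K by simp
      moreover have "curry_obj A B ?F = K" using curry_uncurry[OF A B D left_adjoint_functor] K by simp
      ultimately show "\<exists>F\<in>Obj ?T. \<exists>f\<in>hom ?L (fobj ?C F) K. iso ?L f"
        using id_hom[OF L K] iso_id[OF L K] Co by (intro bexI[of _ ?F]) auto
    qed
    show "fully_faithful ?T ?L ?C"
      unfolding fully_faithful_def
    proof (intro ballI)
      fix F F' assume "F \<in> Obj ?T" "F' \<in> Obj ?T"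
      then have F: "two_var_left_adjoint A B D F" and F': "two_var_left_adjoint A B D F'" by simp_all
      note fF = two_var_functor[OF F] and fF' = two_var_functor[OF F']
      define U where "U \<omega> = \<lparr>ntdom = F, ntcod = F', ntmap = (\<lambda>p \<in> Obj (prod_cat A B). ntmap (ntmap \<omega> (fst p)) (snd p))\<rparr>"
        for \<omega> :: "('o1, 'a1, ('o2, 'a2, 'o, 'a) fctr, ('o2, 'a2, 'o, 'a) ntrans) ntrans"
      have Um: "ntmap (U \<omega>) (a, b) = ntmap (ntmap \<omega> a) b" if "a \<in> Obj A" "b \<in> Obj B" for \<omega> a b
        using that by (simp add: U_def)
      have wa: "ntmap \<omega> a \<in> hom (functor_cat B D) (partial_functor A B F a) (partial_functor A B F' a)"
        if "\<omega> \<in> hom ?L (curry_obj A B F) (curry_obj A B F')" "a \<in> Obj A" for \<omega> a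
        using ntrans_hom[of \<omega> A "LPr B D" "curry_obj A B F" "curry_obj A B F'" a] that by (simp add: hom_LPr)
      have U: "U \<omega> \<in> hom ?T F F'" if w: "\<omega> \<in> hom ?L (curry_obj A B F) (curry_obj A B F')" for \<omega>
      proof -
        have w': "\<omega> \<in> hom (functor_cat A (LPr B D)) (curry_obj A B F) (curry_obj A B F')" using w by (simp add: hom_LPr)
        have wh: "ntmap (ntmap \<omega> a) b \<in> hom D (fobj F (a, b)) (fobj F' (a, b))" if "a \<in> Obj A" "b \<in> Obj B" for a b
          using ntrans_hom[OF wa[OF w that(1)] that(2)] that by simp
        have "U \<omega> \<in> hom (functor_cat (prod_cat A B) D) F F'"
        proof (rule ntransI[OF fF fF'])
          show "ntmap (U \<omega>) p \<in> hom D (fobj F p) (fobj F' p)" if "p \<in> Obj (prod_cat A B)" for p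
            using that wh by (auto simp: Um)
          fix u x y assume u: "u \<in> hom (prod_cat A B) x y"
          obtain f g a b a' b' where e: "u = (f, g)" "x = (a, b)" "y = (a', b')" by (metis prod.exhaust)
          have f: "f \<in> hom A a a'" and g: "g \<in> hom B b b'" using u by (simp_all add: e hom_prod)
          note a = hom_obj[OF A f] and b = hom_obj[OF B g]
          have 1: "ntmap (ntmap \<omega> a') b' \<cdot>\<^bsub>D\<^esub> farr F (f, Id B b') = farr F' (f, Id B b') \<cdot>\<^bsub>D\<^esub> ntmap (ntmap \<omega> a) b'"
            using arg_cong[OF ntrans_nat[OF w' f], of "\<lambda>\<tau>. ntmap \<tau> b'"] b homD(1)[OF f] by simp
          have 2: "ntmap (ntmap \<omega> a) b' \<cdot>\<^bsub>D\<^esub> farr F (Id A a, g) = farr F' (Id A a, g) \<cdot>\<^bsub>D\<^esub> ntmap (ntmap \<omega> a) b"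
            using ntrans_nat[OF wa[OF w a(1)] g] homD(1)[OF g] by simp
          note Ff = bifunctor_hom[OF fF f id_hom[OF B b(2)]] and Fg = bifunctor_hom[OF fF id_hom[OF A a(1)] g]
            and Ff' = bifunctor_hom[OF fF' f id_hom[OF B b(2)]] and Fg' = bifunctor_hom[OF fF' id_hom[OF A a(1)] g]
          have "ntmap (ntmap \<omega> a') b' \<cdot>\<^bsub>D\<^esub> farr F (f, g) = farr F' (f, Id B b') \<cdot>\<^bsub>D\<^esub> ntmap (ntmap \<omega> a) b' \<cdot>\<^bsub>D\<^esub> farr F (Id A a, g)"
            using bifunctor_split(1)[OF A B fF f g] comp_assoc[OF D Fg Ff wh[OF a(2) b(2)]] 1 by simp
          also have "\<dots> = farr F' (f, g) \<cdot>\<^bsub>D\<^esub> ntmap (ntmap \<omega> a) b"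
            using comp_assoc[OF D Fg wh[OF a(1) b(2)] Ff'] 2 comp_assoc[OF D wh[OF a(1) b(1)] Fg' Ff']
              bifunctor_split(1)[OF A B fF' f g] by simp
          finally show "ntmap (U \<omega>) y \<cdot>\<^bsub>D\<^esub> farr F u = farr F' u \<cdot>\<^bsub>D\<^esub> ntmap (U \<omega>) x"
            using a b by (simp add: e Um)
        qed (simp_all add: U_def)
        then show ?thesis using F F' by (simp add: hom_two_var_cat)
      qed
      have "bij_betw (curry_arr A B) (hom ?T F F') (hom ?L (curry_obj A B F) (curry_obj A B F'))"
      proof (rule bij_betw_byWitness[of _ U])
        show "\<forall>\<tau>\<in>hom ?T F F'. U (curry_arr A B \<tau>) = \<tau>"
        proof
          fix \<tau> assume t: "\<tau> \<in> hom ?T F F'"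
          show "U (curry_arr A B \<tau>) = \<tau>"
          proof (rule ntrans_eqI)
            show "U (curry_arr A B \<tau>) \<in> hom (functor_cat (prod_cat A B) D) F F'" "\<tau> \<in> hom (functor_cat (prod_cat A B) D) F F'"
              using U[OF Ch[OF t]] t unfolding hom_two_var_cat by blast+
          qed (auto simp: Um)
        qed
        show "\<forall>\<omega>\<in>hom ?L (curry_obj A B F) (curry_obj A B F'). curry_arr A B (U \<omega>) = \<omega>"
        proof
          fix \<omega> assume w: "\<omega> \<in> hom ?L (curry_obj A B F) (curry_obj A B F')"
          show "curry_arr A B (U \<omega>) = \<omega>"
          proof (rule ntrans_eqI)
            show "curry_arr A B (U \<omega>) \<in> hom (functor_cat A (LPr B D)) (curry_obj A B F) (curry_obj A B F')"
              "\<omega> \<in> hom (functor_cat A (LPr B D)) (curry_obj A B F) (curry_obj A B F')"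
              using Ch[OF U[OF w]] w unfolding hom_LPr by blast+
            fix a assume a: "a \<in> Obj A"
            show "ntmap (curry_arr A B (U \<omega>)) a = ntmap \<omega> a"
            proof (rule ntrans_eqI[OF _ wa[OF w a]])
              show "ntmap (curry_arr A B (U \<omega>)) a \<in> hom (functor_cat B D) (partial_functor A B F a) (partial_functor A B F' a)"
                using comp_a[OF U[OF w] a] unfolding hom_LPr by blast
            qed (use a in \<open>simp add: Um\<close>)
          qed
        qed
        show "curry_arr A B ` hom ?T F F' \<subseteq> hom ?L (curry_obj A B F) (curry_obj A B F')" using Ch by blast
        show "U ` hom ?L (curry_obj A B F) (curry_obj A B F') \<subseteq> hom ?T F F'" using U by blast
      qed
      then show "bij_betw (farr ?C) (hom ?T F F') (hom ?L (fobj ?C F) (fobj ?C F'))"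
        using Co[OF F] Co[OF F'] Ca by (subst bij_betw_cong[of _ _ "curry_arr A B"]) auto
    qed
  qed
qed

section \<open>Quillen bifunctors\<close>

lemma is_pushout_iso:
  assumes D: "category D" and po: "is_pushout D p q i j"
    and p: "p \<in> hom D x y" and q: "q \<in> hom D x z"
    and p': "p' \<in> hom D x' y'" and q': "q' \<in> hom D x' z'"
    and ax: "ax \<in> hom D x x'" and bx: "bx \<in> hom D x' x" and abx: "ax \<cdot>\<^bsub>D\<^esub> bx = Id D x'"
    and ay: "ay \<in> hom D y y'" and b_y: "b_y \<in> hom D y' y" and aby: "ay \<cdot>\<^bsub>D\<^esub> b_y = Id D y'" and bay: "b_y \<cdot>\<^bsub>D\<^esub> ay = Id D y"
    and az: "az \<in> hom D z z'" and bz: "bz \<in> hom D z' z" and abz: "az \<cdot>\<^bsub>D\<^esub> bz = Id D z'" and baz: "bz \<cdot>\<^bsub>D\<^esub> az = Id D z"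
    and sp: "p' \<cdot>\<^bsub>D\<^esub> ax = ay \<cdot>\<^bsub>D\<^esub> p" and sq: "q' \<cdot>\<^bsub>D\<^esub> ax = az \<cdot>\<^bsub>D\<^esub> q"
  shows "is_pushout D p' q' (i \<cdot>\<^bsub>D\<^esub> b_y) (j \<cdot>\<^bsub>D\<^esub> bz)"
proof -
  let ?P = "Cod D i"
  have i: "i \<in> hom D y ?P" and j: "j \<in> hom D z ?P" and ij: "i \<cdot>\<^bsub>D\<^esub> p = j \<cdot>\<^bsub>D\<^esub> q"
    and univ: "\<And>w r s. w \<in> Obj D \<Longrightarrow> r \<in> hom D y w \<Longrightarrow> s \<in> hom D z w \<Longrightarrow> r \<cdot>\<^bsub>D\<^esub> p = s \<cdot>\<^bsub>D\<^esub> q \<Longrightarrow>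
        \<exists>!m. m \<in> hom D ?P w \<and> m \<cdot>\<^bsub>D\<^esub> i = r \<and> m \<cdot>\<^bsub>D\<^esub> j = s"
    using po homD[OF p] homD[OF q] unfolding is_pushout_def by auto
  note i' = comp_hom[OF D b_y i] and j' = comp_hom[OF D bz j]
  have iy: "i \<cdot>\<^bsub>D\<^esub> b_y \<cdot>\<^bsub>D\<^esub> ay = i" using comp_assoc[OF D ay b_y i] bay comp_id_right[OF D i] by simp
  have jz: "j \<cdot>\<^bsub>D\<^esub> bz \<cdot>\<^bsub>D\<^esub> az = j" using comp_assoc[OF D az bz j] baz comp_id_right[OF D j] by simp
  have ax_epi: "u = v" if u: "u \<in> hom D x' w" and v: "v \<in> hom D x' w" and eq: "u \<cdot>\<^bsub>D\<^esub> ax = v \<cdot>\<^bsub>D\<^esub> ax" for u v w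
  proof -
    have "u = u \<cdot>\<^bsub>D\<^esub> ax \<cdot>\<^bsub>D\<^esub> bx" using comp_assoc[OF D bx ax u] abx comp_id_right[OF D u] by simp
    also have "\<dots> = v" using eq comp_assoc[OF D bx ax v] abx comp_id_right[OF D v] by simp
    finally show ?thesis .
  qed
  have square: "i \<cdot>\<^bsub>D\<^esub> b_y \<cdot>\<^bsub>D\<^esub> p' = j \<cdot>\<^bsub>D\<^esub> bz \<cdot>\<^bsub>D\<^esub> q'"
  proof (rule ax_epi[OF comp_hom[OF D p' i'] comp_hom[OF D q' j']])
    have "i \<cdot>\<^bsub>D\<^esub> b_y \<cdot>\<^bsub>D\<^esub> p' \<cdot>\<^bsub>D\<^esub> ax = i \<cdot>\<^bsub>D\<^esub> p"
      using comp_assoc[OF D ax p' i'] sp comp_assoc[OF D p ay i'] iy by simp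
    moreover have "j \<cdot>\<^bsub>D\<^esub> bz \<cdot>\<^bsub>D\<^esub> q' \<cdot>\<^bsub>D\<^esub> ax = j \<cdot>\<^bsub>D\<^esub> q"
      using comp_assoc[OF D ax q' j'] sq comp_assoc[OF D q az j'] jz by simp
    ultimately show "i \<cdot>\<^bsub>D\<^esub> b_y \<cdot>\<^bsub>D\<^esub> p' \<cdot>\<^bsub>D\<^esub> ax = j \<cdot>\<^bsub>D\<^esub> bz \<cdot>\<^bsub>D\<^esub> q' \<cdot>\<^bsub>D\<^esub> ax" using ij by simp
  qed
  have "\<exists>!m. m \<in> hom D ?P w \<and> m \<cdot>\<^bsub>D\<^esub> (i \<cdot>\<^bsub>D\<^esub> b_y) = r \<and> m \<cdot>\<^bsub>D\<^esub> (j \<cdot>\<^bsub>D\<^esub> bz) = s"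
    if w: "w \<in> Obj D" and r: "r \<in> hom D y' w" and s: "s \<in> hom D z' w" and rs: "r \<cdot>\<^bsub>D\<^esub> p' = s \<cdot>\<^bsub>D\<^esub> q'" for w r s
  proof -
    have "r \<cdot>\<^bsub>D\<^esub> ay \<cdot>\<^bsub>D\<^esub> p = r \<cdot>\<^bsub>D\<^esub> p' \<cdot>\<^bsub>D\<^esub> ax"
      using comp_assoc[OF D p ay r] comp_assoc[OF D ax p' r] sp by simp
    also have "\<dots> = s \<cdot>\<^bsub>D\<^esub> az \<cdot>\<^bsub>D\<^esub> q"
      using comp_assoc[OF D q az s] comp_assoc[OF D ax q' s] sq rs by simp
    finally have ex: "\<exists>!m. m \<in> hom D ?P w \<and> m \<cdot>\<^bsub>D\<^esub> i = r \<cdot>\<^bsub>D\<^esub> ay \<and> m \<cdot>\<^bsub>D\<^esub> j = s \<cdot>\<^bsub>D\<^esub> az"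
      using univ[OF w comp_hom[OF D ay r] comp_hom[OF D az s]] by blast
    have cancel: "m \<cdot>\<^bsub>D\<^esub> k = t \<cdot>\<^bsub>D\<^esub> a \<longleftrightarrow> m \<cdot>\<^bsub>D\<^esub> (k \<cdot>\<^bsub>D\<^esub> b) = t"
      if "m \<in> hom D ?P w" "k \<in> hom D c ?P" "t \<in> hom D c' w" "a \<in> hom D c c'" "b \<in> hom D c' c"
        "a \<cdot>\<^bsub>D\<^esub> b = Id D c'" "b \<cdot>\<^bsub>D\<^esub> a = Id D c" for m k t a b c c'
    proof
      assume "m \<cdot>\<^bsub>D\<^esub> k = t \<cdot>\<^bsub>D\<^esub> a"
      then show "m \<cdot>\<^bsub>D\<^esub> (k \<cdot>\<^bsub>D\<^esub> b) = t"
        using comp_assoc[OF D that(5,2,1)] comp_assoc[OF D that(5,4,3)] that(6) comp_id_right[OF D that(3)] by simp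
    next
      assume "m \<cdot>\<^bsub>D\<^esub> (k \<cdot>\<^bsub>D\<^esub> b) = t"
      then have "t \<cdot>\<^bsub>D\<^esub> a = m \<cdot>\<^bsub>D\<^esub> (k \<cdot>\<^bsub>D\<^esub> (b \<cdot>\<^bsub>D\<^esub> a))"
        using comp_assoc[OF D that(4) comp_hom[OF D that(5,2)] that(1)] comp_assoc[OF D that(4,5,2)] by simp
      then show "m \<cdot>\<^bsub>D\<^esub> k = t \<cdot>\<^bsub>D\<^esub> a" using that(7) comp_id_right[OF D that(2)] by simp
    qed
    have "m \<in> hom D ?P w \<and> m \<cdot>\<^bsub>D\<^esub> i = r \<cdot>\<^bsub>D\<^esub> ay \<and> m \<cdot>\<^bsub>D\<^esub> j = s \<cdot>\<^bsub>D\<^esub> az \<longleftrightarrow>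
        m \<in> hom D ?P w \<and> m \<cdot>\<^bsub>D\<^esub> (i \<cdot>\<^bsub>D\<^esub> b_y) = r \<and> m \<cdot>\<^bsub>D\<^esub> (j \<cdot>\<^bsub>D\<^esub> bz) = s" for m
      using cancel[OF _ i r ay b_y aby bay] cancel[OF _ j s az bz abz baz] by blast
    then show ?thesis using ex by simp
  qed
  then show ?thesis
    unfolding is_pushout_def using homD[OF p'] homD[OF q'] homD[OF i'] homD[OF j'] i' j' square by simp
qed

text \<open>One pushout object serves both squares, with its legs changed by the given isomorphisms. So the
  corner maps differ by the isomorphism of the fourth corners only.\<close>

lemma corner_maps_iso:
  assumes D: "category D" and m: "m \<in> corner_maps D p q r s"
    and p: "p \<in> hom D x y" and q: "q \<in> hom D x z" and r: "r \<in> hom D y w" and s: "s \<in> hom D z w"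
    and p': "p' \<in> hom D x' y'" and q': "q' \<in> hom D x' z'" and r': "r' \<in> hom D y' w'" and s': "s' \<in> hom D z' w'"
    and ax: "ax \<in> hom D x x'" "iso D ax" and ay: "ay \<in> hom D y y'" "iso D ay"
    and az: "az \<in> hom D z z'" "iso D az" and aw: "aw \<in> hom D w w'"
    and sp: "p' \<cdot>\<^bsub>D\<^esub> ax = ay \<cdot>\<^bsub>D\<^esub> p" and sq: "q' \<cdot>\<^bsub>D\<^esub> ax = az \<cdot>\<^bsub>D\<^esub> q"
    and sr: "r' \<cdot>\<^bsub>D\<^esub> ay = aw \<cdot>\<^bsub>D\<^esub> r" and ss: "s' \<cdot>\<^bsub>D\<^esub> az = aw \<cdot>\<^bsub>D\<^esub> s"
  shows "aw \<cdot>\<^bsub>D\<^esub> m \<in> corner_maps D p' q' r' s'" "Cod D m = w" "m \<in> Arr D"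
proof -
  obtain i j where po: "is_pushout D p q i j" and mh: "m \<in> hom D (Cod D i) (Cod D r)"
    and mi: "m \<cdot>\<^bsub>D\<^esub> i = r" and mj: "m \<cdot>\<^bsub>D\<^esub> j = s" using m unfolding corner_maps_def by blast
  have mw: "m \<in> hom D (Cod D i) w" using mh homD(3)[OF r] by simp
  then show "Cod D m = w" "m \<in> Arr D" by (auto dest: homD)
  have i: "i \<in> hom D y (Cod D i)" and j: "j \<in> hom D z (Cod D i)"
    using po homD[OF p] homD[OF q] unfolding is_pushout_def by auto
  obtain bx where bx: "bx \<in> hom D x' x" "ax \<cdot>\<^bsub>D\<^esub> bx = Id D x'" using isoE[OF ax(2,1)] by metis
  obtain b_y where b_y: "b_y \<in> hom D y' y" "b_y \<cdot>\<^bsub>D\<^esub> ay = Id D y" "ay \<cdot>\<^bsub>D\<^esub> b_y = Id D y'" using isoE[OF ay(2,1)] .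
  obtain bz where bz: "bz \<in> hom D z' z" "bz \<cdot>\<^bsub>D\<^esub> az = Id D z" "az \<cdot>\<^bsub>D\<^esub> bz = Id D z'" using isoE[OF az(2,1)] .
  note i' = comp_hom[OF D b_y(1) i]
  have po': "is_pushout D p' q' (i \<cdot>\<^bsub>D\<^esub> b_y) (j \<cdot>\<^bsub>D\<^esub> bz)"
    by (rule is_pushout_iso[OF D po p q p' q' ax(1) bx ay(1) b_y(1,3,2) az(1) bz(1,3,2) sp sq])
  have leg: "aw \<cdot>\<^bsub>D\<^esub> m \<cdot>\<^bsub>D\<^esub> (k \<cdot>\<^bsub>D\<^esub> b) = t'"
    if "k \<in> hom D c (Cod D i)" "b \<in> hom D c' c" "a \<in> hom D c c'" "a \<cdot>\<^bsub>D\<^esub> b = Id D c'"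
      "t' \<in> hom D c' w'" "t' \<cdot>\<^bsub>D\<^esub> a = aw \<cdot>\<^bsub>D\<^esub> (m \<cdot>\<^bsub>D\<^esub> k)" for k b a t' c c'
    using comp_assoc[OF D that(2,1) comp_hom[OF D mw aw]] comp_assoc[OF D that(1) mw aw] that(4,6)
      comp_assoc[OF D that(2,3,5)] comp_id_right[OF D that(5)] by simp
  have "aw \<cdot>\<^bsub>D\<^esub> m \<cdot>\<^bsub>D\<^esub> (i \<cdot>\<^bsub>D\<^esub> b_y) = r'" using leg[OF i b_y(1) ay(1) b_y(3) r'] sr mi by simp
  moreover have "aw \<cdot>\<^bsub>D\<^esub> m \<cdot>\<^bsub>D\<^esub> (j \<cdot>\<^bsub>D\<^esub> bz) = s'" using leg[OF j bz(1) az(1) bz(3) s'] ss mj by simp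
  moreover have "aw \<cdot>\<^bsub>D\<^esub> m \<in> hom D (Cod D (i \<cdot>\<^bsub>D\<^esub> b_y)) (Cod D r')"
    using comp_hom[OF D mw aw] homD(3)[OF i'] homD(3)[OF r'] by metis
  ultimately show "aw \<cdot>\<^bsub>D\<^esub> m \<in> corner_maps D p' q' r' s'"
    unfolding corner_maps_def using po' by blast
qed

lemma llp_iso_comp:
  assumes C: "category C" and R: "R \<subseteq> Arr C" and l: "l \<in> llp C R" and f: "f \<in> hom C (Cod C l) z" "iso C f"
  shows "f \<cdot>\<^bsub>C\<^esub> l \<in> llp C R"
proof -
  have la: "l \<in> hom C (Dom C l) (Cod C l)" using l arr_hom by (auto simp: llp_def)
  note fl = comp_hom[OF C la f(1)]
  obtain g where g: "g \<in> hom C z (Cod C l)" "g \<cdot>\<^bsub>C\<^esub> f = Id C (Cod C l)" "f \<cdot>\<^bsub>C\<^esub> g = Id C z" using isoE[OF f(2,1)] .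
  have "lifts C (f \<cdot>\<^bsub>C\<^esub> l) r" if r: "r \<in> R" for r
    unfolding lifts_def
  proof (intro ballI impI)
    have ra: "r \<in> hom C (Dom C r) (Cod C r)" using arr_hom[of r C] r R by auto
    fix u v assume "u \<in> hom C (Dom C (f \<cdot>\<^bsub>C\<^esub> l)) (Dom C r)" "v \<in> hom C (Cod C (f \<cdot>\<^bsub>C\<^esub> l)) (Cod C r)"
      and sq: "r \<cdot>\<^bsub>C\<^esub> u = v \<cdot>\<^bsub>C\<^esub> (f \<cdot>\<^bsub>C\<^esub> l)"
    then have u: "u \<in> hom C (Dom C l) (Dom C r)" and v: "v \<in> hom C z (Cod C r)" using homD[OF fl] by simp_all
    have "r \<cdot>\<^bsub>C\<^esub> u = v \<cdot>\<^bsub>C\<^esub> f \<cdot>\<^bsub>C\<^esub> l" using sq comp_assoc[OF C la f(1) v] by simp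
    then obtain d where d: "d \<in> hom C (Cod C l) (Dom C r)" "d \<cdot>\<^bsub>C\<^esub> l = u" "r \<cdot>\<^bsub>C\<^esub> d = v \<cdot>\<^bsub>C\<^esub> f"
      using l r u comp_hom[OF C f(1) v] unfolding llp_def lifts_def by blast
    have "d \<cdot>\<^bsub>C\<^esub> g \<cdot>\<^bsub>C\<^esub> (f \<cdot>\<^bsub>C\<^esub> l) = u"
      using comp_assoc[OF C la f(1) comp_hom[OF C g(1) d(1)]] comp_assoc[OF C f(1) g(1) d(1)] g(2)
        comp_id_right[OF C d(1)] d(2) by simp
    moreover have "r \<cdot>\<^bsub>C\<^esub> (d \<cdot>\<^bsub>C\<^esub> g) = v"
      using comp_assoc[OF C g(1) d(1) ra] d(3) comp_assoc[OF C g(1) f(1) v] g(3) comp_id_right[OF C v] by simp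
    ultimately show "\<exists>d\<in>hom C (Cod C (f \<cdot>\<^bsub>C\<^esub> l)) (Dom C r). d \<cdot>\<^bsub>C\<^esub> (f \<cdot>\<^bsub>C\<^esub> l) = u \<and> r \<cdot>\<^bsub>C\<^esub> d = v"
      using comp_hom[OF C g(1) d(1)] homD[OF fl] by (intro bexI[of _ "d \<cdot>\<^bsub>C\<^esub> g"]) auto
  qed
  then show ?thesis using homD(1)[OF fl] by (simp add: llp_def)
qed

lemma premodel_categoryD:
  assumes "premodel_category \<kappa> M"
  shows "category (cat_of M)" "complete_cat \<kappa> (cat_of M)" "Cof M \<subseteq> Arr (cat_of M)" "ACof M \<subseteq> Cof M"
    "l \<in> Cof M \<Longrightarrow> f \<in> hom (cat_of M) (Cod (cat_of M) l) z \<Longrightarrow> iso (cat_of M) f \<Longrightarrow> f \<cdot>\<^bsub>cat_of M\<^esub> l \<in> Cof M"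
    "l \<in> ACof M \<Longrightarrow> f \<in> hom (cat_of M) (Cod (cat_of M) l) z \<Longrightarrow> iso (cat_of M) f \<Longrightarrow> f \<cdot>\<^bsub>cat_of M\<^esub> l \<in> ACof M"
proof -
  show C: "category (cat_of M)" "complete_cat \<kappa> (cat_of M)" "ACof M \<subseteq> Cof M"
    using assms by (simp_all add: premodel_category_def)
  have L: "Cof M = llp (cat_of M) (AFib M)" "ACof M = llp (cat_of M) (Fib M)"
    and R: "AFib M = rlp (cat_of M) (Cof M)" "Fib M = rlp (cat_of M) (ACof M)"
    using assms unfolding premodel_category_def weak_factorization_system_def by blast+
  show "Cof M \<subseteq> Arr (cat_of M)" using L(1) by (auto simp: llp_def)
  have sub: "AFib M \<subseteq> Arr (cat_of M)" "Fib M \<subseteq> Arr (cat_of M)" using R by (auto simp: rlp_def)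
  show "f \<cdot>\<^bsub>cat_of M\<^esub> l \<in> Cof M" if "l \<in> Cof M" "f \<in> hom (cat_of M) (Cod (cat_of M) l) z" "iso (cat_of M) f"
    using llp_iso_comp[OF C(1) sub(1)] that L(1) by metis
  show "f \<cdot>\<^bsub>cat_of M\<^esub> l \<in> ACof M" if "l \<in> ACof M" "f \<in> hom (cat_of M) (Cod (cat_of M) l) z" "iso (cat_of M) f"
    using llp_iso_comp[OF C(1) sub(2)] that L(2) by metis
qed

lemma bifunctor_corner_iso:
  assumes A: "category A" and B: "category B" and D: "category D"
    and t: "\<tau> \<in> hom (functor_cat (prod_cat A B) D) F F'"
    and iso: "\<And>a b. a \<in> Obj A \<Longrightarrow> b \<in> Obj B \<Longrightarrow> iso D (ntmap \<tau> (a, b))"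
    and f: "f \<in> hom A a a'" and g: "g \<in> hom B b b'" and m: "m \<in> bifunctor_corner A B D F f g"
  shows "ntmap \<tau> (a', b') \<cdot>\<^bsub>D\<^esub> m \<in> bifunctor_corner A B D F' f g"
    "Cod D m = fobj F (a', b')" "m \<in> Arr D"
proof -
  note F = bifunctor_hom[OF ntrans_functor(1)[OF t]] and F' = bifunctor_hom[OF ntrans_functor(2)[OF t]]
  note th = ntrans_bifunctor_hom[OF t] and nat = ntrans_bifunctor_nat[OF t, symmetric]
  note a = hom_obj(1)[OF A f] and a' = hom_obj(2)[OF A f] and b = hom_obj(1)[OF B g] and b' = hom_obj(2)[OF B g]
  note ia = id_hom[OF A a] and ia' = id_hom[OF A a'] and ib = id_hom[OF B b] and ib' = id_hom[OF B b']
  have m': "m \<in> corner_maps D (farr F (f, Id B b)) (farr F (Id A a, g)) (farr F (Id A a', g)) (farr F (f, Id B b'))"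
    using m homD(2,3)[OF f] homD(2,3)[OF g] by (simp add: bifunctor_corner_def)
  note c = corner_maps_iso[OF D m' F[OF f ib] F[OF ia g] F[OF ia' g] F[OF f ib']
    F'[OF f ib] F'[OF ia g] F'[OF ia' g] F'[OF f ib']
    th[OF a b] iso[OF a b] th[OF a' b] iso[OF a' b] th[OF a b'] iso[OF a b'] th[OF a' b']
    nat[OF f ib] nat[OF ia g] nat[OF ia' g] nat[OF f ib']]
  show "ntmap \<tau> (a', b') \<cdot>\<^bsub>D\<^esub> m \<in> bifunctor_corner A B D F' f g"
    using c(1) homD(2,3)[OF f] homD(2,3)[OF g] by (simp add: bifunctor_corner_def)
  show "Cod D m = fobj F (a', b')" "m \<in> Arr D" by (fact c(2), fact c(3))
qed

text \<open>If \<open>m\<close> is a corner map of \<open>F\<close> and \<open>\<tau>\<close> an isomorphism to \<open>F'\<close> with inverse \<open>\<sigma>\<close>, then \<open>\<tau> \<cdot> m\<close> is a corner map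
  of \<open>F'\<close>, and \<open>m = \<sigma> \<cdot> (\<tau> \<cdot> m)\<close> is a cofibration because \<open>\<tau> \<cdot> m\<close> is one; likewise for anodyne
  cofibrations.\<close>

lemma quillen_bifunctor_iso:
  assumes M1: "premodel_category \<kappa> M1" and M2: "premodel_category \<kappa> M2" and N: "premodel_category \<kappa> N"
    and t: "\<tau> \<in> hom (two_var_cat (cat_of M1) (cat_of M2) (cat_of N)) F F'"
    and iso: "iso (two_var_cat (cat_of M1) (cat_of M2) (cat_of N)) \<tau>"
    and q: "quillen_bifunctor M1 M2 N F'"
  shows "quillen_bifunctor M1 M2 N F"
proof -
  let ?A = "cat_of M1" and ?B = "cat_of M2" and ?D = "cat_of N"
  let ?T = "two_var_cat ?A ?B ?D"
  note A = premodel_categoryD(1)[OF M1] and B = premodel_categoryD(1)[OF M2] and D = premodel_categoryD(1)[OF N]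
  obtain \<sigma> where s: "\<sigma> \<in> hom ?T F' F" "\<sigma> \<cdot>\<^bsub>?T\<^esub> \<tau> = Id ?T F" "\<tau> \<cdot>\<^bsub>?T\<^esub> \<sigma> = Id ?T F'" using isoE[OF iso t] .
  have t': "\<tau> \<in> hom (functor_cat (prod_cat ?A ?B) ?D) F F'" and s': "\<sigma> \<in> hom (functor_cat (prod_cat ?A ?B) ?D) F' F"
    and F: "two_var_left_adjoint ?A ?B ?D F"
    using t s(1) by (simp_all add: hom_two_var_cat)
  have inv: "ntmap \<sigma> (a, b) \<cdot>\<^bsub>?D\<^esub> ntmap \<tau> (a, b) = Id ?D (fobj F (a, b))"
    "ntmap \<tau> (a, b) \<cdot>\<^bsub>?D\<^esub> ntmap \<sigma> (a, b) = Id ?D (fobj F' (a, b))" if "a \<in> Obj ?A" "b \<in> Obj ?B" for a b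
    using arg_cong[OF s(2), of "\<lambda>\<tau>. ntmap \<tau> (a, b)"] arg_cong[OF s(3), of "\<lambda>\<tau>. ntmap \<tau> (a, b)"] that by simp_all
  note th = ntrans_bifunctor_hom[OF t'] and sh = ntrans_bifunctor_hom[OF s']
  have ti: "iso ?D (ntmap \<tau> (a, b))" and si: "iso ?D (ntmap \<sigma> (a, b))" if "a \<in> Obj ?A" "b \<in> Obj ?B" for a b
    using isoI[OF th[OF that] sh[OF that] inv[OF that]] isoI[OF sh[OF that] th[OF that] inv(2,1)[OF that]] by blast+
  have transfer: "bifunctor_corner ?A ?B ?D F f g \<subseteq> W"
    if f: "f \<in> Arr ?A" and g: "g \<in> Arr ?B" and W: "bifunctor_corner ?A ?B ?D F' f g \<subseteq> W"
      and closed: "\<And>l k z. l \<in> W \<Longrightarrow> k \<in> hom ?D (Cod ?D l) z \<Longrightarrow> iso ?D k \<Longrightarrow> k \<cdot>\<^bsub>?D\<^esub> l \<in> W" for f g W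
  proof
    fix m assume m: "m \<in> bifunctor_corner ?A ?B ?D F f g"
    let ?a = "Cod ?A f" and ?b = "Cod ?B g"
    note a = arr_obj(2)[OF A f] and b = arr_obj(2)[OF B g]
    note c = bifunctor_corner_iso[OF A B D t' ti arr_hom[OF f] arr_hom[OF g] m]
    have mh: "m \<in> hom ?D (Dom ?D m) (fobj F (?a, ?b))" using c(2,3) by (simp add: hom_def)
    note tm = comp_hom[OF D mh th[OF a b]]
    have "ntmap \<sigma> (?a, ?b) \<cdot>\<^bsub>?D\<^esub> (ntmap \<tau> (?a, ?b) \<cdot>\<^bsub>?D\<^esub> m) \<in> W"
      using closed[of "ntmap \<tau> (?a, ?b) \<cdot>\<^bsub>?D\<^esub> m" "ntmap \<sigma> (?a, ?b)"] c(1) W sh[OF a b] si[OF a b] homD(3)[OF tm] by auto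
    then show "m \<in> W"
      using comp_assoc[OF D mh th[OF a b] sh[OF a b]] inv(1)[OF a b] comp_id_left[OF D mh] by simp
  qed
  have F'q: "\<And>f g. f \<in> Cof M1 \<Longrightarrow> g \<in> Cof M2 \<Longrightarrow> bifunctor_corner ?A ?B ?D F' f g \<subseteq> Cof N"
    "\<And>f g. f \<in> Cof M1 \<Longrightarrow> g \<in> Cof M2 \<Longrightarrow> f \<in> ACof M1 \<or> g \<in> ACof M2 \<Longrightarrow> bifunctor_corner ?A ?B ?D F' f g \<subseteq> ACof N"
    using q unfolding quillen_bifunctor_def by blast+
  show ?thesis
    unfolding quillen_bifunctor_def
  proof (intro conjI ballI impI)
    fix f g assume f: "f \<in> Cof M1" and g: "g \<in> Cof M2"
    have fa: "f \<in> Arr ?A" and ga: "g \<in> Arr ?B"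
      using f g premodel_categoryD(3)[OF M1] premodel_categoryD(3)[OF M2] by blast+
    show "bifunctor_corner ?A ?B ?D F f g \<subseteq> Cof N"
      by (rule transfer[OF fa ga F'q(1)[OF f g] premodel_categoryD(5)[OF N]])
    assume "f \<in> ACof M1 \<or> g \<in> ACof M2"
    then show "bifunctor_corner ?A ?B ?D F f g \<subseteq> ACof N"
      by (intro transfer[OF fa ga F'q(2)[OF f g] premodel_categoryD(6)[OF N]])
  qed (rule F)
qed

lemma ntrans_corner_curry:
  assumes "category A" "category B" "f \<in> Arr A" "g \<in> Arr B"
  shows "ntrans_corner B D (farr (curry_obj A B F) f) g = bifunctor_corner A B D F f g"
  unfolding ntrans_corner_def bifunctor_corner_def
  using arr_obj[OF assms(1,3)] arr_obj[OF assms(2,4)] assms(3,4) by simp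

text \<open>Both sides impose the same conditions on the same corner maps: the cofibration and anodyne conditions
  in \<open>CPM M2 N\<close> on the transformation \<open>F(f, -)\<close> range over the second argument \<open>g\<close>.\<close>

lemma left_quillen_curry_iff:
  assumes M1: "premodel_category \<kappa> M1" and M2: "premodel_category \<kappa> M2"
    and F: "two_var_left_adjoint (cat_of M1) (cat_of M2) (cat_of N) F"
    and cF: "left_adjoint (cat_of M1) (LPr (cat_of M2) (cat_of N)) (curry_obj (cat_of M1) (cat_of M2) F)"
  shows "left_quillen M1 (CPM M2 N) (curry_obj (cat_of M1) (cat_of M2) F) \<longleftrightarrow> quillen_bifunctor M1 M2 N F"
proof -
  let ?A = "cat_of M1" and ?B = "cat_of M2" and ?D = "cat_of N"
  note A = premodel_categoryD(1)[OF M1] and B = premodel_categoryD(1)[OF M2]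
  have fa: "f \<in> Arr ?A" if "f \<in> Cof M1" for f using that premodel_categoryD(3)[OF M1] by blast
  have ga: "g \<in> Arr ?B" if "g \<in> Cof M2" for g using that premodel_categoryD(3)[OF M2] by blast
  have acof: "f \<in> Cof M1" if "f \<in> ACof M1" for f using that premodel_categoryD(4)[OF M1] by blast
  have arr: "farr (curry_obj ?A ?B F) f \<in> Arr (LPr ?B ?D)" if "f \<in> Cof M1" for f
    using homD(1)[OF functor_hom[OF left_adjoint_functor[OF cF] arr_hom[OF fa[OF that]]]] .
  have corner: "ntrans_corner ?B ?D (farr (curry_obj ?A ?B F) f) g = bifunctor_corner ?A ?B ?D F f g"
    if "f \<in> Cof M1" "g \<in> Cof M2" for f g
    using ntrans_corner_curry[OF A B fa[OF that(1)] ga[OF that(2)]] .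
  have "farr (curry_obj ?A ?B F) f \<in> CPM_Cof M2 N \<longleftrightarrow> (\<forall>g \<in> Cof M2. bifunctor_corner ?A ?B ?D F f g \<subseteq> Cof N \<and>
      (g \<in> ACof M2 \<longrightarrow> bifunctor_corner ?A ?B ?D F f g \<subseteq> ACof N))" if "f \<in> Cof M1" for f
    unfolding CPM_Cof_def using arr[OF that] corner[OF that] by auto
  moreover have "farr (curry_obj ?A ?B F) f \<in> CPM_ACof M2 N \<longleftrightarrow>
      (\<forall>g \<in> Cof M2. bifunctor_corner ?A ?B ?D F f g \<subseteq> ACof N)" if "f \<in> Cof M1" for f
    unfolding CPM_ACof_def using arr[OF that] corner[OF that] by auto
  ultimately show ?thesis
    unfolding left_quillen_def quillen_bifunctor_def using cF F acof by (simp add: CPM_def) blast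
qed

section \<open>The tensor-Hom equivalence\<close>

theorem proposition4p8p9:
  fixes \<kappa> :: "'k rel"
    and M1 :: "('o1, 'a1) premodel" and M2 :: "('o2, 'a2) premodel"
    and N T :: "('o, 'a) premodel"
    and t :: "('o1 \<times> 'o2, 'a1 \<times> 'a2, 'o, 'a) fctr"
  assumes "regular_cardinal \<kappa>"
    and "combinatorial_premodel_category \<kappa> M1"
    and "combinatorial_premodel_category \<kappa> M2"
    and "combinatorial_premodel_category \<kappa> N"
    and "is_tensor_product \<kappa> M1 M2 T t"
  shows "equivalence
           (LPr (cat_of T) (cat_of N))
           (LPr (cat_of M1) (LPr (cat_of M2) (cat_of N)))
           (tensor_hom_functor (cat_of M1) (cat_of M2) (cat_of T) (cat_of N) t)
       \<and> equivalence
           (Hom_CPM T N)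
           (Hom_CPM M1 (CPM M2 N))
           (restrict_functor (Hom_CPM T N)
             (tensor_hom_functor (cat_of M1) (cat_of M2) (cat_of T) (cat_of N) t))"
proof
  let ?A = "cat_of M1" and ?B = "cat_of M2" and ?T = "cat_of T" and ?D = "cat_of N"
  let ?pre = "precomp (prod_cat ?A ?B) (LPr ?T ?D) t" and ?V = "two_var_cat ?A ?B ?D"
  let ?cur = "curry_functor ?A ?B ?V" and ?L = "LPr ?A (LPr ?B ?D)"
  let ?th = "tensor_hom_functor ?A ?B ?T ?D t"
  note k = assms(1)
  have M1: "premodel_category \<kappa> M1" and M2: "premodel_category \<kappa> M2" and N: "premodel_category \<kappa> N"
    and lpA: "locally_presentable \<kappa> ?A" and lpB: "locally_presentable \<kappa> ?B" and lpD: "locally_presentable \<kappa> ?D"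
    using assms(2-4) by (simp_all add: combinatorial_premodel_category_def)
  note A = locally_presentableD(1)[OF lpA] and B = locally_presentableD(1)[OF lpB] and D = locally_presentableD(1)[OF lpD]
  have pre: "equivalence (LPr ?T ?D) ?V ?pre"
    and quillen: "\<And>F. left_adjoint ?T ?D F \<Longrightarrow>
      left_quillen T N F \<longleftrightarrow> quillen_bifunctor M1 M2 N (comp_functor (prod_cat ?A ?B) F t)"
    using assms(4,5) lpD unfolding is_tensor_product_def by blast+
  have cur: "equivalence ?V ?L ?cur"
    using curry_equivalence[OF k lpA premodel_categoryD(2)[OF M1] lpB lpD] .
  show th: "equivalence (LPr ?T ?D) ?L ?th"
    unfolding tensor_hom_functor_def using equivalence_comp[OF pre cur] .
  have curry: "left_adjoint ?A (LPr ?B ?D) (curry_obj ?A ?B F)" if "two_var_left_adjoint ?A ?B ?D F" for F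
    using curry_obj_left_adjoint[OF k A premodel_categoryD(2)[OF M1] lpB D that] .
  have V: "category ?V" and cur_f: "is_functor ?V ?L ?cur" and pre_f: "is_functor (LPr ?T ?D) ?V ?pre"
    using cur pre by (simp_all add: equivalence_def)
  note cur_ff = equivalence_imp_fully_faithful(1)[OF cur]
  have cur_o: "fobj ?cur F = curry_obj ?A ?B F" if "two_var_left_adjoint ?A ?B ?D F" for F
    using that by (simp add: curry_functor_def)
  have two_var: "two_var_left_adjoint ?A ?B ?D (comp_functor (prod_cat ?A ?B) F t)" if "left_adjoint ?T ?D F" for F
    using functor_obj[OF pre_f, of F] that by (simp add: precomp_def)
  have th_o: "fobj ?th F = curry_obj ?A ?B (comp_functor (prod_cat ?A ?B) F t)" if "left_adjoint ?T ?D F" for F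
    using that cur_o[OF two_var[OF that]] by (simp add: tensor_hom_functor_def comp_functor_def[of "LPr ?T ?D"] precomp_def)
  have "equivalence (full_subcat (LPr ?T ?D) (left_quillen T N)) (full_subcat ?L (left_quillen M1 (CPM M2 N)))
        (restrict_functor (full_subcat (LPr ?T ?D) (left_quillen T N)) ?th)"
  proof (rule equivalence_restrict[OF th])
    fix F assume "F \<in> Obj (LPr ?T ?D)"
    then have F: "left_adjoint ?T ?D F" by simp
    let ?F = "comp_functor (prod_cat ?A ?B) F t"
    note F0 = two_var[OF F]
    show "left_quillen T N F \<longleftrightarrow> left_quillen M1 (CPM M2 N) (fobj ?th F)"
      using quillen[OF F] left_quillen_curry_iff[OF M1 M2 F0 curry[OF F0]] th_o[OF F] by simp
    fix K f assume f: "f \<in> hom ?L (fobj ?th F) K" "iso ?L f" and qK: "left_quillen M1 (CPM M2 N) K"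
    have K: "left_adjoint ?A (LPr ?B ?D) K" using f(1) by (simp add: hom_LPr)
    \<comment> \<open>Every target \<open>K\<close> is a curried functor, so the isomorphism \<open>f\<close> comes from one of bifunctors.\<close>
    let ?K = "uncurry_obj ?A ?B ?D K"
    have K0: "two_var_left_adjoint ?A ?B ?D ?K" using uncurry_two_var_left_adjoint[OF k lpA lpB lpD K] .
    have cK: "curry_obj ?A ?B ?K = K" using curry_uncurry[OF A B D left_adjoint_functor[OF K]] .
    have "f \<in> hom ?L (fobj ?cur ?F) (fobj ?cur ?K)"
      using f(1) th_o[OF F] cur_o[OF F0] cur_o[OF K0] cK by simp
    then obtain u where u: "u \<in> hom ?V ?F ?K" "farr ?cur u = f"
      using fully_faithful_surj[OF cur_ff, of ?F ?K f] F0 K0 by auto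
    have "iso ?V u" using fully_faithful_reflects_iso[OF V cur_f cur_ff u(1)] u(2) f(2) by simp
    moreover have "quillen_bifunctor M1 M2 N ?K"
      using left_quillen_curry_iff[OF M1 M2 K0 curry[OF K0]] cK qK by simp
    ultimately have "quillen_bifunctor M1 M2 N ?F" using quillen_bifunctor_iso[OF M1 M2 N u(1)] by blast
    then show "left_quillen M1 (CPM M2 N) (fobj ?th F)"
      using left_quillen_curry_iff[OF M1 M2 F0 curry[OF F0]] th_o[OF F] by simp
  qed
  moreover have "cat_of (CPM M2 N) = LPr ?B ?D" by (simp add: CPM_def)
  ultimately show "equivalence (Hom_CPM T N) (Hom_CPM M1 (CPM M2 N)) (restrict_functor (Hom_CPM T N) ?th)"
    unfolding Hom_CPM_def by simp
qed

end
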